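(* The decision problem \textsc{Broadcast Graph} is NP-complete: given a finite graph $G$ on $n$ vertices, decide whether $b(G)=\lceil \log_2 n\rceil$.
   Context: Broadcast model: $G=(V,E)$ is a finite undirected graph. A broadcast from an originator $v\in V$ proceeds in discrete time units. At time $0$ only $v$ is informed. In each time unit, every informed vertex may call at most one of its neighbors, which thereby becomes informed. The broadcast ends when all vertices are informed. $b(G,v)$ is the minimum number of time units needed to inform all vertices when broadcasting from $v$; it is infinite if $G$ is disconnected. $b(G)=\max_{u\in V} b(G,u)$. A graph $G$ on $n$ vertices is called a broadcast graph if $b(G)=\lceil\log_2 n\rceil$. \textsc{Broadcast Graph} is the problem: input a graph $G$; question: is $G$ a broadcast graph? *)

theory Defs
  imports
    Complex_Main
    "HOL-Library.Extended_Nat"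
    "HOL-Computational_Algebra.Polynomial"
    "Graph_Theory.Pair_Digraph"
begin

section \<open>Broadcasting\<close>

text \<open>
  A finite simple undirected graph is a \<^locale>\<open>pair_graph\<close>: a finite, loop-free, symmetric
  relation \<^const>\<open>parcs\<close> on the vertex set \<^const>\<open>pverts\<close>.

  One time unit is described by a partial function \<open>c\<close>, where \<open>c u = Some v\<close> means that \<open>u\<close>
  calls \<open>v\<close>. Being a function, it lets every vertex make at most one call; making no call is allowed.
\<close>

definition broadcast_step :: "'a pair_pre_digraph \<Rightarrow> 'a set \<Rightarrow> 'a set \<Rightarrow> bool" where
  "broadcast_step G I I' \<longleftrightarrow>
     (\<exists>c :: 'a \<Rightarrow> 'a option.
        (\<forall>u v. c u = Some v \<longrightarrow> u \<in> I \<and> (u, v) \<in> parcs G) \<and>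
        I' = I \<union> {v. \<exists>u. c u = Some v})"

text \<open>The infimum of the empty set is \<^term>\<open>\<infinity>\<close>: this is the case of a disconnected graph.\<close>

definition broadcast_time_from :: "'a pair_pre_digraph \<Rightarrow> 'a \<Rightarrow> enat" where
  "broadcast_time_from G v = Inf {enat t | t. (broadcast_step G ^^ t) {v} (pverts G)}"

definition broadcast_time :: "'a pair_pre_digraph \<Rightarrow> enat" where
  "broadcast_time G = Max (broadcast_time_from G ` pverts G)"

definition is_broadcast_graph :: "'a pair_pre_digraph \<Rightarrow> bool" where
  "is_broadcast_graph G \<longleftrightarrow>
     broadcast_time G = enat (nat \<lceil>log 2 (real (card (pverts G)))\<rceil>)"


section \<open>Turing machines\<close>

text \<open>
  Deterministic Turing machines with any fixed number of two-way infinite tapes. States and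
  tape symbols are initial segments of the natural numbers; symbol 0 is the blank, symbols 1
  and 2 represent the bits \<^const>\<open>False\<close> and \<^const>\<open>True\<close>.
\<close>

datatype move = MLeft | MStay | MRight

record tm =
  tm_tapes :: nat
  tm_symbols :: nat
  tm_states :: nat
  tm_start :: nat
  tm_acc :: nat
  tm_rej :: nat
  tm_delta :: "nat \<Rightarrow> nat list \<Rightarrow> nat \<times> (nat \<times> move) list"

text \<open>
  The closure condition on the transition function is essential: it confines the control to
  finitely many states and the tapes to finitely many symbols.
\<close>

definition wf_tm :: "tm \<Rightarrow> bool" where
  "wf_tm M \<longleftrightarrow>
     1 \<le> tm_tapes M \<and> 3 \<le> tm_symbols M \<and>
     tm_start M < tm_states M \<and> tm_acc M < tm_states M \<and> tm_rej M < tm_states M \<and>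
     tm_acc M \<noteq> tm_rej M \<and>
     (\<forall>q rs. q < tm_states M \<and> length rs = tm_tapes M \<and> (\<forall>r\<in>set rs. r < tm_symbols M) \<longrightarrow>
        (case tm_delta M q rs of (q', as) \<Rightarrow>
           q' < tm_states M \<and> length as = tm_tapes M \<and> (\<forall>(s, d)\<in>set as. s < tm_symbols M)))"

type_synonym tape = "(int \<Rightarrow> nat) \<times> int"
type_synonym config = "nat \<times> tape list"

fun tape_read :: "tape \<Rightarrow> nat" where
  "tape_read (f, h) = f h"

fun move_offset :: "move \<Rightarrow> int" where
  "move_offset MLeft = - 1"
| "move_offset MStay = 0"
| "move_offset MRight = 1"

fun tape_act :: "tape \<Rightarrow> nat \<times> move \<Rightarrow> tape" where
  "tape_act (f, h) (s, d) = (f(h := s), h + move_offset d)"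

definition halted :: "tm \<Rightarrow> config \<Rightarrow> bool" where
  "halted M c \<longleftrightarrow> fst c \<in> {tm_acc M, tm_rej M}"

definition tm_step :: "tm \<Rightarrow> config \<Rightarrow> config" where
  "tm_step M c =
     (if halted M c then c
      else case tm_delta M (fst c) (map tape_read (snd c)) of
        (q', as) \<Rightarrow> (q', map2 tape_act (snd c) as))"

fun bit_symbol :: "bool \<Rightarrow> nat" where
  "bit_symbol False = 1"
| "bit_symbol True = 2"

definition string_content :: "bool list \<Rightarrow> int \<Rightarrow> nat" where
  "string_content x = (\<lambda>i. if 0 \<le> i \<and> i < int (length x) then bit_symbol (x ! nat i) else 0)"

text \<open>
  The arguments are written on the first tapes, one per tape; the remaining tapes are blank.
  All heads start at cell 0.
\<close>

definition tm_init :: "tm \<Rightarrow> bool list list \<Rightarrow> config" where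
  "tm_init M xs =
     (tm_start M,
      map (\<lambda>x. (string_content x, 0)) (xs @ replicate (tm_tapes M - length xs) []))"

definition tm_run :: "tm \<Rightarrow> bool list list \<Rightarrow> nat \<Rightarrow> config" where
  "tm_run M xs t = (tm_step M ^^ t) (tm_init M xs)"

definition tm_accepts :: "tm \<Rightarrow> bool list list \<Rightarrow> bool" where
  "tm_accepts M xs \<longleftrightarrow> (\<exists>t. fst (tm_run M xs t) = tm_acc M)"

text \<open>The output stands on the last tape, from cell 0 up to the first blank.\<close>

definition tm_outputs :: "tm \<Rightarrow> bool list list \<Rightarrow> bool list \<Rightarrow> bool" where
  "tm_outputs M xs y \<longleftrightarrow>
     (\<exists>t. halted M (tm_run M xs t) \<and>
        (\<forall>i \<le> length y.
           fst (last (snd (tm_run M xs t))) (int i) = string_content y (int i)))"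


section \<open>Polynomial time and NP-completeness\<close>

text \<open>\<open>M\<close> is a machine with \<open>k\<close> arguments that halts on all inputs in polynomial time.\<close>

definition poly_time_tm :: "nat \<Rightarrow> tm \<Rightarrow> bool" where
  "poly_time_tm k M \<longleftrightarrow>
     wf_tm M \<and> k \<le> tm_tapes M \<and>
     (\<exists>p :: nat poly. \<forall>xs. length xs = k \<longrightarrow>
        halted M (tm_run M xs (poly p (sum_list (map length xs)))))"

definition poly_time_computable :: "(bool list \<Rightarrow> bool list) \<Rightarrow> bool" where
  "poly_time_computable f \<longleftrightarrow>
     (\<exists>M. poly_time_tm 1 M \<and> (\<forall>x. tm_outputs M [x] (f x)))"

definition NP :: "bool list set set" where
  "NP = {L. \<exists>M. \<exists>p :: nat poly. poly_time_tm 2 M \<and>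
           (\<forall>x. x \<in> L \<longleftrightarrow> (\<exists>w. length w \<le> poly p (length x) \<and> tm_accepts M [x, w]))}"

definition poly_reducible :: "bool list set \<Rightarrow> bool list set \<Rightarrow> bool" where
  "poly_reducible A B \<longleftrightarrow>
     (\<exists>f. poly_time_computable f \<and> (\<forall>x. x \<in> A \<longleftrightarrow> f x \<in> B))"

definition NP_hard :: "bool list set \<Rightarrow> bool" where
  "NP_hard B \<longleftrightarrow> (\<forall>A\<in>NP. poly_reducible A B)"

definition NP_complete :: "bool list set \<Rightarrow> bool" where
  "NP_complete B \<longleftrightarrow> B \<in> NP \<and> NP_hard B"


section \<open>The decision problem\<close>

text \<open>
  A graph with vertex set \<open>{..<n}\<close> is given by its adjacency matrix, row by row: a string of
  \<open>n * n\<close> bits, which determines \<open>n\<close>. The null graph is not an instance, since neither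
  \<open>b(G)\<close> nor the logarithm is defined for it.
\<close>

definition adjacency_string :: "nat pair_pre_digraph \<Rightarrow> bool list" where
  "adjacency_string G =
     (let n = card (pverts G)
      in concat (map (\<lambda>i. map (\<lambda>j. (i, j) \<in> parcs G) [0..<n]) [0..<n]))"

definition BROADCAST_GRAPH :: "bool list set" where
  "BROADCAST_GRAPH =
     {adjacency_string G | G.
        pair_graph G \<and> (\<exists>n\<ge>1. pverts G = {..<n}) \<and> is_broadcast_graph G}"

end

theory Submission
  imports Defs
begin

text \<open>
  Membership in NP: the calls of all broadcasts form a certificate of polynomial length.

  Hardness: if \<open>n = 2 ^ K + 1\<close> and the originator has degree 1, a broadcast in
  \<open>\<lceil>log 2 n\<rceil> = K + 1\<close> steps must, after the first step, double the number of informed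
  vertices in every step. In the gadget graph a core clique of \<open>2 ^ z\<close> vertices, one of them adjacent
  to the pendant vertex, carries binomial trees of \<open>2 ^ d\<close> vertices with \<open>K = z + d\<close>. The doubling
  forces the core to be informed first, and then each node of a constraint system to call one of its
  tiles, which can reach all its elements in time only if tiles of partner nodes agree on their
  common bit. All other originators can always finish in time. So broadcasting within the time bound
  is the same as satisfying the constraint system, and the tableau of a nondeterministic computation
  is such a system: a cell is compared with its copies in neighbouring cells bit by bit.

  The machines of the definition of polynomial time are obtained from structured programs whose
  variables are counters, a counter being the distance of a head from a mark on its tape.
  Polynomially bounded functions built from arithmetic, bounded sums and bounded quantifiers are
  computed by such programs, and every bit of the reduction is given by such a formula.
\<close>

section \<open>Structured tape programs\<close>

text \<open>With \<open>2 ^ K + 1\<close> vertices and \<open>K + 1\<close> steps every originator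
  except the pendant one has nearly a factor 2 to spare, so all rigidity comes from a single vertex
  while every other originator has to be kept fast. The two demands compete for degrees. In a
  perfect broadcast of \<open>z + d\<close> steps a noncore vertex informed within the first
  \<open>z\<close> still makes \<open>d\<close> calls and has a caller besides, so degree at most
  \<open>d\<close> keeps it out of these steps. On the other hand noncore vertices need arcs to two
  hubs to reach the core quickly. This shapes \<open>depth\<close> and the exceptional offsets in
  \<open>hubbed\<close>.

  The agreement of a bit is a covering condition: of two partner nodes each owns one element per
  bit, and a node calls its own element if the bit is 0 and its partner's if it is 1. Both elements
  are called only if the bits agree.

  A node has \<open>2 ^ D\<close> tiles and a tree has \<open>2 ^ depth D\<close> vertices, but
  \<open>D\<close> depends on the machine alone. So these are constants, only the number of nodes
  grows with the input, and everything about tiles and offsets can be read from finite tables when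
  the reduction is computed.\<close>

datatype prog =
  Act "nat \<Rightarrow> nat \<Rightarrow> nat \<times> move"
| Seq prog prog
| Cond nat "nat set" prog prog
| While nat "nat set" prog
| Reject

type_synonym store = "nat \<Rightarrow> tape"

text \<open>The times are exact machine times: each unfolding of a composite program costs one step.
  \<open>Reject\<close> has no rule, as it never hands over to a continuation; its effect is treated
  directly on the machine.\<close>

inductive exec :: "prog \<Rightarrow> store \<Rightarrow> nat \<Rightarrow> store \<Rightarrow> bool" where
  exec_Act: "exec (Act f) C 1 (\<lambda>j. tape_act (C j) (f j (tape_read (C j))))"
| exec_Seq: "exec p C t C' \<Longrightarrow> exec q C' t' C'' \<Longrightarrow> exec (Seq p q) C (t' + t + 1) C''"
| exec_Cond_True: "tape_read (C k) \<in> S \<Longrightarrow> exec p C t C' \<Longrightarrow> exec (Cond k S p q) C (t + 1) C'"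
| exec_Cond_False: "tape_read (C k) \<notin> S \<Longrightarrow> exec q C t C' \<Longrightarrow> exec (Cond k S p q) C (t + 1) C'"
| exec_While_True: "tape_read (C k) \<in> S \<Longrightarrow> exec p C t C' \<Longrightarrow> exec (While k S p) C' t' C'' \<Longrightarrow>
    exec (While k S p) C (t' + t + 1) C''"
| exec_While_False: "tape_read (C k) \<notin> S \<Longrightarrow> exec (While k S p) C 1 C"

fun wf_prog :: "nat \<Rightarrow> prog \<Rightarrow> bool" where
  "wf_prog n (Act f) \<longleftrightarrow> (\<forall>j r. r < 3 \<longrightarrow> fst (f j r) < 3)"
| "wf_prog n (Seq p q) \<longleftrightarrow> wf_prog n p \<and> wf_prog n q"
| "wf_prog n (Cond k S p q) \<longleftrightarrow> k < n \<and> wf_prog n p \<and> wf_prog n q"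
| "wf_prog n (While k S p) \<longleftrightarrow> k < n \<and> wf_prog n p"
| "wf_prog n Reject \<longleftrightarrow> True"

lemma tape_act_idle [simp]: "tape_act T (tape_read T, MStay) = T"
  by (cases T) simp

lemma wf_prog_mono: "wf_prog n p \<Longrightarrow> n \<le> n' \<Longrightarrow> wf_prog n' p"
  by (induction p) auto

text \<open>
  The control state of the machine for a program is the list of programs still to be executed.
  Only finitely many such lists are reachable, so they can be numbered.
\<close>

fun next_act :: "prog list \<Rightarrow> (nat \<Rightarrow> nat) \<Rightarrow> prog list \<times> (nat \<Rightarrow> nat \<times> move)" where
  "next_act [] r = ([], \<lambda>j. (r j, MStay))"
| "next_act (Act f # K) r = (K, \<lambda>j. f j (r j))"
| "next_act (Seq p q # K) r = (p # q # K, \<lambda>j. (r j, MStay))"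
| "next_act (Cond k S p q # K) r = ((if r k \<in> S then p else q) # K, \<lambda>j. (r j, MStay))"
| "next_act (While k S p # K) r =
     (if r k \<in> S then p # While k S p # K else K, \<lambda>j. (r j, MStay))"
| "next_act (Reject # K) r = ([Reject], \<lambda>j. (r j, MStay))"

text \<open>The continuations met while some of \<open>p\<close> is pending on top of
  \<open>K\<close>; \<open>K\<close> itself is left out. The set is finite in spite of loops because
  the body of a loop is run with the loop itself as continuation, so that each round returns to the
  same list.\<close>

fun conts :: "prog \<Rightarrow> prog list \<Rightarrow> prog list set" where
  "conts (Act f) K = {Act f # K}"
| "conts (Seq p q) K = insert (Seq p q # K) (conts p (q # K) \<union> conts q K)"
| "conts (Cond k S p q) K = insert (Cond k S p q # K) (conts p K \<union> conts q K)"
| "conts (While k S p) K = insert (While k S p # K) (conts p (While k S p # K))"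
| "conts Reject K = {Reject # K}"

lemma finite_conts: "finite (conts p K)"
  by (induction p arbitrary: K) auto

lemma self_in_conts: "p # K \<in> conts p K"
  by (cases p) auto

lemma next_act_conts:
  "L \<in> conts p K \<Longrightarrow> fst (next_act L r) \<in> insert K (insert [Reject] (conts p K))"
proof (induction p arbitrary: K)
  case (Seq p q)
  then show ?case
    using self_in_conts[of p "q # K"] self_in_conts[of q K] by fastforce
next
  case (Cond k S p q)
  then show ?case
    using self_in_conts[of p K] self_in_conts[of q K] by fastforce
next
  case (While k S p)
  then show ?case
    using self_in_conts[of p "While k S p # K"] by fastforce
qed auto

lemma wf_conts:
  "L \<in> conts p K \<Longrightarrow> wf_prog n p \<Longrightarrow> list_all (wf_prog n) K \<Longrightarrow> list_all (wf_prog n) L"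
proof (induction p arbitrary: K)
  case (Seq p q)
  then show ?case by (metis UnE conts.simps(2) insertE list.pred_inject(2) wf_prog.simps(2))
next
  case (Cond k S p q)
  then show ?case by (metis UnE conts.simps(3) insertE list.pred_inject(2) wf_prog.simps(3))
next
  case (While k S p)
  then show ?case by (metis conts.simps(4) insertE list.pred_inject(2) wf_prog.simps(4))
qed auto

section \<open>The machine of a program\<close>

definition machine_states :: "prog \<Rightarrow> prog list set" where
  "machine_states p = insert [] (insert [Reject] (conts p []))"

definition reads :: "nat \<Rightarrow> nat list \<Rightarrow> nat \<Rightarrow> nat" where
  "reads n rs j = (if j < n then rs ! j else 0)"

definition machine :: "nat \<Rightarrow> prog \<Rightarrow> (prog list \<Rightarrow> nat) \<Rightarrow> tm" where
  "machine n p e =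
     \<lparr>tm_tapes = n, tm_symbols = 3, tm_states = card (machine_states p),
      tm_start = e [p], tm_acc = e [], tm_rej = e [Reject],
      tm_delta = \<lambda>q rs.
        (case next_act (inv_into (machine_states p) e q) (reads n rs) of
          (K, a) \<Rightarrow> (e K, map a [0..<n]))\<rparr>"

lemma wf_next_act:
  assumes "list_all (wf_prog n) L" "\<And>j. r j < 3"
  shows "fst (snd (next_act L r) j) < 3"
proof -
  show ?thesis
    using assms by (cases "(L, r)" rule: next_act.cases) auto
qed

locale tape_machine =
  fixes n :: nat and p :: prog and e :: "prog list \<Rightarrow> nat" and M :: tm
  assumes n: "1 \<le> n" and wfp: "wf_prog n p"
    and e: "bij_betw e (machine_states p) {..<card (machine_states p)}"
    and M_def: "M = machine n p e"
begin

lemma inv_e: "K \<in> machine_states p \<Longrightarrow> inv_into (machine_states p) e (e K) = K"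
  using e by (simp add: bij_betw_def)

lemma e_eq_iff:
  "K \<in> machine_states p \<Longrightarrow> K' \<in> machine_states p \<Longrightarrow> e K = e K' \<longleftrightarrow> K = K'"
  by (metis inv_e)

lemma e_less: "K \<in> machine_states p \<Longrightarrow> e K < card (machine_states p)"
  using e by (auto simp: bij_betw_def)

lemma special_states:
  "[] \<in> machine_states p" "[Reject] \<in> machine_states p" "[p] \<in> machine_states p"
  using self_in_conts[of p "[]"] by (auto simp: machine_states_def)

lemma next_act_states:
  assumes "L \<in> machine_states p"
  shows "fst (next_act L r) \<in> machine_states p"
  using assms next_act_conts[of L p "[]" r] by (auto simp: machine_states_def)

lemma wf_states:
  assumes "L \<in> machine_states p"
  shows "list_all (wf_prog n) L"
  using assms wf_conts[of L p "[]" n] wfp by (auto simp: machine_states_def)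

lemma wf_machine: "wf_tm M"
proof -
  have "e (fst (next_act (inv_into (machine_states p) e q) (reads n rs))) < card (machine_states p) \<and>
    (\<forall>j. fst (snd (next_act (inv_into (machine_states p) e q) (reads n rs)) j) < 3)"
    if "q < card (machine_states p)" "length rs = n" "\<forall>r\<in>set rs. r < 3" for q rs
  proof -
    have "inv_into (machine_states p) e q \<in> machine_states p"
      using e that(1) by (metis bij_betw_def inv_into_into lessThan_iff)
    moreover have "reads n rs j < 3" for j
      using that by (auto simp: reads_def)
    ultimately show ?thesis
      using next_act_states e_less wf_next_act wf_states by blast
  qed
  moreover have "e [] \<noteq> e [Reject]"
    using e_eq_iff special_states by simp
  ultimately show ?thesis
    unfolding wf_tm_def M_def machine_def
    using n e_less[OF special_states(1)] e_less[OF special_states(2)] e_less[OF special_states(3)]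
    by (simp add: case_prod_unfold)
qed

lemma tapes [simp]: "tm_tapes M = n"
  by (simp add: M_def machine_def)

lemma halted_iff: "K \<in> machine_states p \<Longrightarrow> halted M (e K, Cs) \<longleftrightarrow> K = [] \<or> K = [Reject]"
  using e_eq_iff special_states by (simp add: halted_def M_def machine_def)

lemma step:
  assumes "L \<in> machine_states p" "L \<noteq> []" "L \<noteq> [Reject]"
    and r: "next_act L r = (K, a)" "r = (\<lambda>j. if j < n then tape_read (C j) else 0)"
  shows "tm_step M (e L, map C [0..<n]) = (e K, map (\<lambda>j. tape_act (C j) (a j)) [0..<n])"
proof -
  have "\<not> halted M (e L, map C [0..<n])"
    using assms halted_iff by simp
  moreover have "reads n (map tape_read (map C [0..<n])) = r"
    by (auto simp: reads_def r)
  ultimately show ?thesis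
    using assms by (simp add: tm_step_def M_def machine_def inv_e del: map_map)
      (auto intro!: nth_equalityI)
qed

text \<open>The continuation \<open>K\<close> is arbitrary because a subprogram is always run on top
  of the rest of the program; the inclusion guarantees that all lists met on the way are numbered by
  \<open>e\<close>.\<close>

lemma steps:
  assumes "exec p' C t C'" "conts p' K \<subseteq> machine_states p"
  shows "(tm_step M ^^ t) (e (p' # K), map C [0..<n]) = (e K, map C' [0..<n])"
  using assms
proof (induction arbitrary: K rule: exec.induct)
  case (exec_Act f C)
  have "map (\<lambda>j. tape_act (C j) (f j (if j < n then tape_read (C j) else 0))) [0..<n] =
      map (\<lambda>j. tape_act (C j) (f j (tape_read (C j)))) [0..<n]"
    by (auto intro!: nth_equalityI)
  then show ?case
    using step[OF _ _ _ next_act.simps(2) refl, of f K C] exec_Act by simp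
next
  case (exec_Seq p1 C t C' q t' C'')
  have "tm_step M (e (Seq p1 q # K), map C [0..<n]) = (e (p1 # q # K), map C [0..<n])"
    using step[OF _ _ _ next_act.simps(3) refl, of p1 q K C] exec_Seq.prems
    by (simp cong: map_cong)
  then show ?case
    using exec_Seq by (simp add: funpow_add funpow_swap1 del: funpow.simps add: funpow_Suc_right)
next
  case (exec_Cond_True C k S p1 t C' q)
  have "wf_prog n (Cond k S p1 q)"
    using wf_states[of "Cond k S p1 q # K"] exec_Cond_True.prems by simp
  then have "tm_step M (e (Cond k S p1 q # K), map C [0..<n]) = (e (p1 # K), map C [0..<n])"
    using step[OF _ _ _ next_act.simps(4) refl, of k S p1 q K C] exec_Cond_True
    by (simp cong: map_cong)
  then show ?case
    using exec_Cond_True by (simp add: funpow_add funpow_swap1 del: funpow.simps add: funpow_Suc_right)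
next
  case (exec_Cond_False C k S q t C' p1)
  have "wf_prog n (Cond k S p1 q)"
    using wf_states[of "Cond k S p1 q # K"] exec_Cond_False.prems by simp
  then have "tm_step M (e (Cond k S p1 q # K), map C [0..<n]) = (e (q # K), map C [0..<n])"
    using step[OF _ _ _ next_act.simps(4) refl, of k S p1 q K C] exec_Cond_False
    by (simp cong: map_cong)
  then show ?case
    using exec_Cond_False by (simp add: funpow_add funpow_swap1 del: funpow.simps add: funpow_Suc_right)
next
  case (exec_While_True C k S p1 t C' t' C'')
  have "wf_prog n (While k S p1)"
    using wf_states[of "While k S p1 # K"] exec_While_True.prems by simp
  then have "tm_step M (e (While k S p1 # K), map C [0..<n]) = (e (p1 # While k S p1 # K), map C [0..<n])"
    using step[OF _ _ _ next_act.simps(5) refl, of k S p1 K C] exec_While_True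
    by (simp cong: map_cong)
  then show ?case
    using exec_While_True by (simp add: funpow_add funpow_swap1 del: funpow.simps add: funpow_Suc_right)
next
  case (exec_While_False C k S p1)
  have "wf_prog n (While k S p1)"
    using wf_states[of "While k S p1 # K"] exec_While_False.prems by simp
  then show ?case
    using step[OF _ _ _ next_act.simps(5) refl, of k S p1 K C] exec_While_False
    by (simp cong: map_cong)
qed

lemma runs_to:
  assumes "exec p C t C'"
  shows "(tm_step M ^^ t) (e [p], map C [0..<n]) = (e [], map C' [0..<n])"
  using steps[OF assms, of "[]"] by (auto simp: machine_states_def)

end

section \<open>Functions computable with counters in polynomial time\<close>

text \<open>A normal form for polynomial bounds: since the base is at least 2, constants and sums
  are absorbed by a larger exponent, so one number \<open>c\<close> describes the bound.\<close>

definition pb :: "(nat \<Rightarrow> nat) \<Rightarrow> bool" where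
  "pb g \<longleftrightarrow> (\<exists>c. \<forall>s. g s \<le> (s + 2) ^ c)"

lemma pb_const: "pb (\<lambda>s. c)"
proof -
  have "c \<le> (s + 2) ^ c" for s :: nat
    by (rule order_trans[OF less_imp_le[OF less_exp]]) (simp add: power_mono)
  then show ?thesis
    unfolding pb_def by blast
qed

lemma pb_id: "pb (\<lambda>s. s)"
  unfolding pb_def by (rule exI[of _ 1]) simp

lemma pb_add:
  assumes "pb f" "pb g"
  shows "pb (\<lambda>s. f s + g s)"
proof -
  obtain a b where a: "\<And>s. f s \<le> (s + 2) ^ a" and b: "\<And>s. g s \<le> (s + 2) ^ b"
    using assms unfolding pb_def by auto
  have "f s + g s \<le> (s + 2) ^ (a + b + 1)" for s
  proof -
    have "f s \<le> (s + 2) ^ (a + b)"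
      by (rule order_trans[OF a], rule power_increasing) simp_all
    moreover have "g s \<le> (s + 2) ^ (a + b)"
      by (rule order_trans[OF b], rule power_increasing) simp_all
    ultimately have "f s + g s \<le> 2 * (s + 2) ^ (a + b)"
      by simp
    also have "\<dots> \<le> (s + 2) * (s + 2) ^ (a + b)"
      by (rule mult_le_mono1) simp
    finally show ?thesis
      by simp
  qed
  then show ?thesis
    unfolding pb_def by blast
qed

lemma pb_mult:
  assumes "pb f" "pb g"
  shows "pb (\<lambda>s. f s * g s)"
proof -
  obtain a b where "\<And>s. f s \<le> (s + 2) ^ a" "\<And>s. g s \<le> (s + 2) ^ b"
    using assms unfolding pb_def by auto
  then have "f s * g s \<le> (s + 2) ^ (a + b)" for s
    unfolding power_add by (rule mult_le_mono)
  then show ?thesis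
    unfolding pb_def by blast
qed

lemma pb_comp:
  assumes "pb f" "pb g"
  shows "pb (\<lambda>s. f (g s))"
proof -
  obtain a where a: "\<And>s. f s \<le> (s + 2) ^ a"
    using assms unfolding pb_def by auto
  obtain b where b: "\<And>s. g s + 2 \<le> (s + 2) ^ b"
    using pb_add[OF assms(2) pb_const[of 2]] unfolding pb_def by auto
  have "f (g s) \<le> (s + 2) ^ (b * a)" for s
    unfolding power_mult by (rule order_trans[OF a]) (rule power_mono[OF b], simp)
  then show ?thesis
    unfolding pb_def by blast
qed

lemmas pb_intros = pb_const pb_id pb_add pb_mult

section \<open>Execution within a time bound\<close>

definition runs :: "prog \<Rightarrow> store \<Rightarrow> nat \<Rightarrow> store \<Rightarrow> bool" where
  "runs p C T C' \<longleftrightarrow> (\<exists>t\<le>T. exec p C t C')"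

lemma runs_mono: "runs p C T C' \<Longrightarrow> T \<le> T' \<Longrightarrow> runs p C T' C'"
  unfolding runs_def by (meson order_trans)

lemma runs_Seq: "runs p C T C' \<Longrightarrow> runs q C' T' C'' \<Longrightarrow> runs (Seq p q) C (T' + T + 1) C''"
  unfolding runs_def by (meson exec_Seq add_le_mono order_refl)

lemma runs_Cond_True:
  "tape_read (C k) \<in> S \<Longrightarrow> runs p C T C' \<Longrightarrow> runs (Cond k S p q) C (T + 1) C'"
  unfolding runs_def by (meson exec_Cond_True add_le_mono order_refl)

lemma runs_Cond_False:
  "tape_read (C k) \<notin> S \<Longrightarrow> runs q C T C' \<Longrightarrow> runs (Cond k S p q) C (T + 1) C'"
  unfolding runs_def by (meson exec_Cond_False add_le_mono order_refl)

lemma runs_While: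
  assumes "\<And>i. i < v \<Longrightarrow> tape_read (Cs i k) \<in> S \<and> runs p (Cs i) T (Cs (Suc i))"
    and "tape_read (Cs v k) \<notin> S"
  shows "runs (While k S p) (Cs 0) (v * (T + 1) + 1) (Cs v)"
proof -
  have "runs (While k S p) (Cs i) ((v - i) * (T + 1) + 1) (Cs v)" if "i \<le> v" for i
    using that
  proof (induction "v - i" arbitrary: i)
    case 0
    then show ?case
      using assms(2) exec_While_False[of "Cs v" k S p] unfolding runs_def
      by (intro exI[of _ 1]) simp
  next
    case (Suc d)
    then have i: "i < v" and d: "d = v - Suc i"
      by auto
    then obtain t where t: "t \<le> (v - Suc i) * (T + 1) + 1" "exec (While k S p) (Cs (Suc i)) t (Cs v)"
      using Suc(1)[OF d] unfolding runs_def by auto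
    obtain t' where t': "t' \<le> T" "exec p (Cs i) t' (Cs (Suc i))"
      using assms(1)[OF i] unfolding runs_def by auto
    have "exec (While k S p) (Cs i) (t + t' + 1) (Cs v)"
      using exec_While_True[OF _ t'(2) t(2)] assms(1)[OF i] by simp
    moreover have "t + t' + 1 \<le> (v - i) * (T + 1) + 1"
      using t(1) t'(1) i Suc_diff_Suc[OF i] by (simp flip: Suc_diff_Suc)
    ultimately show ?case
      unfolding runs_def by blast
  qed
  from this[of 0] show ?thesis
    by simp
qed

text \<open>
  A number is stored as the position of the head on a tape whose only nonblank cell is cell 0.
\<close>

definition counter :: "nat \<Rightarrow> tape" where
  "counter v = (\<lambda>i. if i = 0 then 1 else 0, int v)"

lemma read_counter [simp]: "tape_read (counter v) = (if v = 0 then 1 else 0)"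
  by (simp add: counter_def)

definition mv :: "(nat \<Rightarrow> move) \<Rightarrow> prog" where
  "mv m = Act (\<lambda>j r. (r, m j))"

definition shift :: "(nat \<Rightarrow> move) \<Rightarrow> nat \<Rightarrow> store \<Rightarrow> store" where
  "shift m v C = (\<lambda>j. (fst (C j), snd (C j) + int v * move_offset (m j)))"

lemma wf_mv [simp]: "wf_prog n (mv m)"
  by (simp add: mv_def)

lemma runs_mv: "runs (mv m) C 1 (shift m 1 C)"
proof -
  have "tape_act (C j) (tape_read (C j), m j) = (fst (C j), snd (C j) + move_offset (m j))" for j
    by (cases "C j") simp
  then show ?thesis
    using exec_Act[of "\<lambda>j r. (r, m j)" C] unfolding runs_def mv_def shift_def by auto
qed

lemma runs_mv': "C' = shift m 1 C \<Longrightarrow> runs (mv m) C 1 C'"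
  using runs_mv by simp

text \<open>All heads move in the same instruction. Hence the loop that counts \<open>a\<close> down
  to 0 can add its value to, or subtract it from, any number of other tapes; copying, restoring and
  moving an input head are all instances.\<close>

lemma runs_transfer:
  assumes "C a = counter v" "m a = MLeft"
  shows "runs (While a {0} (mv m)) C (2 * v + 1) (shift m v C)"
proof -
  have "runs (While a {0} (mv m)) (shift m 0 C) (v * (1 + 1) + 1) (shift m v C)"
  proof (rule runs_While)
    show "tape_read (shift m v C a) \<notin> {0}"
      using assms by (simp add: shift_def counter_def)
    show "tape_read (shift m i C a) \<in> {0} \<and> runs (mv m) (shift m i C) 1 (shift m (Suc i) C)"
      if "i < v" for i
      using assms that
      by (auto intro!: runs_mv'[unfolded One_nat_def] simp: shift_def counter_def algebra_simps)
  qed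
  moreover have "shift m 0 C = C"
    by (simp add: shift_def)
  ultimately show ?thesis
    by (simp add: mult_2_right mult_2)
qed

lemma runs_transfer':
  "C a = counter v \<Longrightarrow> m a = MLeft \<Longrightarrow> C' = shift m v C \<Longrightarrow>
    runs (While a {0} (mv m)) C (2 * v + 1) C'"
  using runs_transfer by simp

text \<open>One number \<open>s\<close> measures the input lengths and the values of the variables
  together. A bound variable below \<open>g s\<close> then simply turns size \<open>s\<close> into
  size \<open>s + g s\<close>.\<close>

definition bounded :: "nat \<Rightarrow> nat \<Rightarrow> bool list list \<Rightarrow> (nat \<Rightarrow> nat) \<Rightarrow> nat \<Rightarrow> bool" where
  "bounded k m xs e s \<longleftrightarrow> length xs = k \<and> (\<forall>i<k. length (xs ! i) \<le> s) \<and> (\<forall>i<m. e i \<le> s)"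

definition layout :: "nat \<Rightarrow> nat \<Rightarrow> (nat \<Rightarrow> nat) \<Rightarrow> nat \<Rightarrow> nat \<Rightarrow> bool" where
  "layout k m \<rho> acc f \<longleftrightarrow> k \<le> acc \<and> acc < f \<and> (\<forall>i<m. k \<le> \<rho> i \<and> \<rho> i < f \<and> \<rho> i \<noteq> acc)"

definition pre :: "nat \<Rightarrow> nat \<Rightarrow> (nat \<Rightarrow> nat) \<Rightarrow> nat \<Rightarrow> nat \<Rightarrow> nat \<Rightarrow>
    bool list list \<Rightarrow> (nat \<Rightarrow> nat) \<Rightarrow> store \<Rightarrow> nat \<Rightarrow> bool" where
  "pre k m \<rho> acc f B xs e C a \<longleftrightarrow>
     (\<forall>i<k. C i = (string_content (xs ! i), 0)) \<and> (\<forall>i<m. C (\<rho> i) = counter (e i)) \<and>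
     C acc = counter a \<and> (\<forall>j. f \<le> j \<and> j < f + B \<longrightarrow> C j = counter 0)"

text \<open>
  \<open>F xs e\<close> depends on the \<open>k\<close> input strings \<open>xs\<close> and on the first \<open>m\<close> variables. A program for it
  \<^emph>\<open>adds\<close> its value to the counter \<open>acc\<close>, finds variable \<open>i\<close> on tape \<open>\<rho> i\<close>, may use \<open>B\<close> scratch
  tapes from tape \<open>f\<close> on, and leaves everything but \<open>acc\<close> as it was.
\<close>

definition computes :: "nat \<Rightarrow> nat \<Rightarrow> (bool list list \<Rightarrow> (nat \<Rightarrow> nat) \<Rightarrow> nat) \<Rightarrow> nat \<Rightarrow>
    (nat \<Rightarrow> nat) \<Rightarrow> bool" where
  "computes k m F B g \<longleftrightarrow>
     (\<forall>xs e s. bounded k m xs e s \<longrightarrow> F xs e \<le> g s) \<and>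
     (\<forall>\<rho> acc f. layout k m \<rho> acc f \<longrightarrow>
       (\<exists>p. wf_prog (f + B) p \<and>
         (\<forall>xs e s C a. bounded k m xs e s \<longrightarrow> pre k m \<rho> acc f B xs e C a \<longrightarrow>
            runs p C (g s) (C(acc := counter (a + F xs e))))))"

definition dfn :: "nat \<Rightarrow> nat \<Rightarrow> (bool list list \<Rightarrow> (nat \<Rightarrow> nat) \<Rightarrow> nat) \<Rightarrow> bool" where
  "dfn k m F \<longleftrightarrow> (\<exists>B g. pb g \<and> computes k m F B g)"

lemma computes_mono:
  assumes "computes k m F B g" "B \<le> B'" "\<And>s. g s \<le> g' s"
  shows "computes k m F B' g'"
proof -
  have "\<exists>p. wf_prog (f + B') p \<and>
         (\<forall>xs e s C a. bounded k m xs e s \<longrightarrow> pre k m \<rho> acc f B' xs e C a \<longrightarrow>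
            runs p C (g' s) (C(acc := counter (a + F xs e))))"
    if l: "layout k m \<rho> acc f" for \<rho> acc f
  proof -
    obtain p where p: "wf_prog (f + B) p" "\<And>xs e s C a. bounded k m xs e s \<Longrightarrow>
        pre k m \<rho> acc f B xs e C a \<Longrightarrow> runs p C (g s) (C(acc := counter (a + F xs e)))"
      using assms(1) l unfolding computes_def by blast
    have "pre k m \<rho> acc f B xs e C a" if "pre k m \<rho> acc f B' xs e C a" for xs e C a
      using that assms(2) unfolding pre_def by auto
    then show ?thesis
      using p wf_prog_mono[OF p(1)] assms(2,3) runs_mono
      by (intro exI[of _ p] conjI allI impI) (simp, metis)
  qed
  moreover have "\<forall>xs e s. bounded k m xs e s \<longrightarrow> F xs e \<le> g' s"
    using assms unfolding computes_def by (meson order_trans)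
  ultimately show ?thesis
    unfolding computes_def by blast
qed

lemma dfnI:
  assumes "pb g" "\<And>xs e s. bounded k m xs e s \<Longrightarrow> F xs e \<le> g s"
    and "\<And>\<rho> acc f. layout k m \<rho> acc f \<Longrightarrow>
       (\<exists>p. wf_prog (f + B) p \<and>
         (\<forall>xs e s C a. bounded k m xs e s \<longrightarrow> pre k m \<rho> acc f B xs e C a \<longrightarrow>
            runs p C (g s) (C(acc := counter (a + F xs e)))))"
  shows "dfn k m F"
  using assms unfolding dfn_def computes_def by blast

lemma dfnE:
  assumes "dfn k m F"
  obtains B g where "pb g" "mono g" "computes k m F B g"
proof -
  obtain B g c where *: "computes k m F B g" and c: "\<And>s. g s \<le> (s + 2) ^ c"
    using assms unfolding dfn_def pb_def by auto
  show ?thesis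
  proof
    show "pb (\<lambda>s. (s + 2) ^ c)"
      unfolding pb_def by blast
    show "mono (\<lambda>s. (s + 2) ^ c :: nat)"
      by (intro monoI power_mono) simp_all
    show "computes k m F B (\<lambda>s. (s + 2) ^ c)"
      using computes_mono[OF * order_refl c] .
  qed
qed

lemma dfn2E:
  assumes "dfn k m F" "dfn k' m' G"
  obtains B g where "pb g" "mono g" "computes k m F B g" "computes k' m' G B g"
proof -
  obtain B g where F: "pb g" "mono g" "computes k m F B g"
    using assms(1) by (rule dfnE)
  obtain B' g' where G: "pb g'" "mono g'" "computes k' m' G B' g'"
    using assms(2) by (rule dfnE)
  have "pb (\<lambda>s. g s + g' s)" "mono (\<lambda>s. g s + g' s)"
    using F G by (auto intro!: pb_add monoI add_mono dest: monoD)
  then show ?thesis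
    using that[of "\<lambda>s. g s + g' s" "B + B'"] computes_mono[OF F(3)] computes_mono[OF G(3)] by simp
qed

lemma computesD:
  assumes "computes k m F B g" "layout k m \<rho> acc f"
  obtains p where "wf_prog (f + B) p"
    "\<And>xs e s C a. bounded k m xs e s \<Longrightarrow> pre k m \<rho> acc f B xs e C a \<Longrightarrow>
       runs p C (g s) (C(acc := counter (a + F xs e)))"
  using assms unfolding computes_def by blast

lemma computes_bound: "computes k m F B g \<Longrightarrow> bounded k m xs e s \<Longrightarrow> F xs e \<le> g s"
  unfolding computes_def by blast

section \<open>Basic functions, sums and access to the input\<close>

abbreviation moves :: "nat set \<Rightarrow> nat set \<Rightarrow> nat \<Rightarrow> move" where
  "moves L R j \<equiv> if j \<in> L then MLeft else if j \<in> R then MRight else MStay"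

lemma dfn_zero: "dfn k m (\<lambda>xs e. 0)"
proof (rule dfnI[where g = "\<lambda>_. 1" and B = 0])
  fix \<rho> acc f
  have "shift (\<lambda>_. MStay) 1 C = C(acc := counter a)" if "C acc = counter a" for C a
    using that by (auto simp: shift_def fun_eq_iff)
  then show "\<exists>p. wf_prog (f + 0) p \<and>
      (\<forall>xs e s C a. bounded k m xs e s \<longrightarrow> pre k m \<rho> acc f 0 xs e C a \<longrightarrow>
        runs p C 1 (C(acc := counter (a + 0))))"
    by (intro exI[of _ "mv (\<lambda>_. MStay)"]) (simp add: pre_def runs_mv' del: One_nat_def)
qed (auto intro: pb_const)

lemma dfn_one: "dfn k m (\<lambda>xs e. 1)"
proof (rule dfnI[where g = "\<lambda>_. 1" and B = 0])
  fix \<rho> acc f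
  have "shift (moves {} {acc}) 1 C = C(acc := counter (a + 1))" if "C acc = counter a" for C a
    using that by (auto simp: shift_def fun_eq_iff counter_def)
  then show "\<exists>p. wf_prog (f + 0) p \<and>
      (\<forall>xs e s C a. bounded k m xs e s \<longrightarrow> pre k m \<rho> acc f 0 xs e C a \<longrightarrow>
        runs p C 1 (C(acc := counter (a + 1))))"
    by (intro exI[of _ "mv (moves {} {acc})"]) (simp add: pre_def runs_mv' del: One_nat_def)
qed (auto intro: pb_const)

text \<open>Reading a counter destroys it, so its value is moved to the accumulator and to a scratch
  tape at once, and then moved back from the scratch tape.\<close>

lemma dfn_var:
  assumes "i < m"
  shows "dfn k m (\<lambda>xs e. e i)"
proof (rule dfnI[where g = "\<lambda>s. 4 * s + 3" and B = 1])
  show "pb (\<lambda>s. 4 * s + 3)"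
    by (intro pb_intros)
  show "e i \<le> 4 * s + 3" if "bounded k m xs e s" for xs e s
    using that assms by (force simp: bounded_def)
  fix \<rho> acc f assume l: "layout k m \<rho> acc f"
  define r where "r = \<rho> i"
  define p where "p = Seq (While r {0} (mv (moves {r} {acc, f}))) (While f {0} (mv (moves {f} {r})))"
  have r: "r < f" "r \<noteq> acc" "acc < f"
    using l assms by (auto simp: layout_def r_def)
  have "runs p C (4 * s + 3) (C(acc := counter (a + e i)))"
    if b: "bounded k m xs e s" and pre: "pre k m \<rho> acc f 1 xs e C a" for xs e s C a
  proof -
    have C: "C r = counter (e i)" "C acc = counter a" "C f = counter 0"
      using pre assms by (auto simp: pre_def r_def)
    let ?C1 = "C(r := counter 0, acc := counter (a + e i), f := counter (e i))"
    have "runs (While r {0} (mv (moves {r} {acc, f}))) C (2 * e i + 1) ?C1"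
      by (rule runs_transfer') (use C r in \<open>auto simp: shift_def fun_eq_iff counter_def\<close>)
    moreover have "runs (While f {0} (mv (moves {f} {r}))) ?C1 (2 * e i + 1) (C(acc := counter (a + e i)))"
      by (rule runs_transfer') (use C r in \<open>auto simp: shift_def fun_eq_iff counter_def\<close>)
    ultimately have "runs p C (2 * e i + 1 + (2 * e i + 1) + 1) (C(acc := counter (a + e i)))"
      unfolding p_def by (rule runs_Seq)
    then show ?thesis
      by (rule runs_mono) (use b assms in \<open>auto simp: bounded_def\<close>)
  qed
  then show "\<exists>p. wf_prog (f + 1) p \<and>
      (\<forall>xs e s C a. bounded k m xs e s \<longrightarrow> pre k m \<rho> acc f 1 xs e C a \<longrightarrow>
        runs p C (4 * s + 3) (C(acc := counter (a + e i))))"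
    using r by (intro exI[of _ p]) (auto simp: p_def)
qed

lemma dfn_add:
  assumes "dfn k m F" "dfn k m G"
  shows "dfn k m (\<lambda>xs e. F xs e + G xs e)"
proof -
  obtain B g where g: "pb g" "mono g" and F: "computes k m F B g" and G: "computes k m G B g"
    using assms by (rule dfn2E)
  show ?thesis
  proof (rule dfnI[where g = "\<lambda>s. g s + g s + 1" and B = B])
    show "pb (\<lambda>s. g s + g s + 1)"
      by (intro pb_intros g)
    show "F xs e + G xs e \<le> g s + g s + 1" if "bounded k m xs e s" for xs e s
      using computes_bound[OF F that] computes_bound[OF G that] by simp
    fix \<rho> acc f assume l: "layout k m \<rho> acc f"
    obtain p where p: "wf_prog (f + B) p"
      "\<And>xs e s C a. bounded k m xs e s \<Longrightarrow> pre k m \<rho> acc f B xs e C a \<Longrightarrow>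
         runs p C (g s) (C(acc := counter (a + F xs e)))"
      using F l by (rule computesD) blast
    obtain q where q: "wf_prog (f + B) q"
      "\<And>xs e s C a. bounded k m xs e s \<Longrightarrow> pre k m \<rho> acc f B xs e C a \<Longrightarrow>
         runs q C (g s) (C(acc := counter (a + G xs e)))"
      using G l by (rule computesD) blast
    have "runs (Seq p q) C (g s + g s + 1) (C(acc := counter (a + (F xs e + G xs e))))"
      if b: "bounded k m xs e s" and pre: "pre k m \<rho> acc f B xs e C a" for xs e s C a
    proof -
      have "pre k m \<rho> acc f B xs e (C(acc := counter (a + F xs e))) (a + F xs e)"
        using pre l by (auto simp: pre_def layout_def)
      from runs_Seq[OF p(2)[OF b pre] q(2)[OF b this]] show ?thesis
        by (simp add: add.assoc)
    qed
    then show "\<exists>p. wf_prog (f + B) p \<and>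
      (\<forall>xs e s C a. bounded k m xs e s \<longrightarrow> pre k m \<rho> acc f B xs e C a \<longrightarrow>
        runs p C (g s + g s + 1) (C(acc := counter (a + (F xs e + G xs e)))))"
      using p(1) q(1) by (intro exI[of _ "Seq p q"]) auto
  qed
qed

text \<open>Both values are computed on scratch tapes \<open>f\<close> and \<open>f + 1\<close>; the
  second is counted down while the first is decremented as long as it is positive, which is
  truncated subtraction. Moving the remainder to \<open>acc\<close> leaves both scratch tapes at
  0.\<close>

lemma dfn_diff:
  assumes "dfn k m F" "dfn k m G"
  shows "dfn k m (\<lambda>xs e. F xs e - G xs e)"
proof -
  obtain B g where g: "pb g" "mono g" and F: "computes k m F B g" and G: "computes k m G B g"
    using assms by (rule dfn2E)
  let ?g = "\<lambda>s. 8 * g s + 6"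
  show ?thesis
  proof (rule dfnI[where g = ?g and B = "B + 2"])
    show "pb ?g"
      by (intro pb_intros g)
    show "F xs e - G xs e \<le> ?g s" if "bounded k m xs e s" for xs e s
      using computes_bound[OF F that] by simp
    fix \<rho> acc f assume l: "layout k m \<rho> acc f"
    have "layout k m \<rho> f (f + 2)" "layout k m \<rho> (f + 1) (f + 2)"
      using l unfolding layout_def by fastforce+
    note l12 = this
    obtain p where p: "wf_prog (f + 2 + B) p"
      "\<And>xs e s C a. bounded k m xs e s \<Longrightarrow> pre k m \<rho> f (f + 2) B xs e C a \<Longrightarrow>
         runs p C (g s) (C(f := counter (a + F xs e)))"
      using F l12(1) by (rule computesD) blast
    obtain q where q: "wf_prog (f + 2 + B) q"
      "\<And>xs e s C a. bounded k m xs e s \<Longrightarrow> pre k m \<rho> (f + 1) (f + 2) B xs e C a \<Longrightarrow>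
         runs q C (g s) (C(f + 1 := counter (a + G xs e)))"
      using G l12(2) by (rule computesD) blast
    define loop where "loop = While (f + 1) {0}
      (Seq (mv (moves {f + 1} {})) (Cond f {0} (mv (moves {f} {})) (mv (moves {} {}))))"
    define last where "last = While f {0} (mv (moves {f} {acc}))"
    define r where "r = Seq (Seq p q) (Seq loop last)"
    have acc: "acc < f"
      using l by (simp add: layout_def)
    have "runs r C (?g s) (C(acc := counter (a + (F xs e - G xs e))))"
      if b: "bounded k m xs e s" and pre: "pre k m \<rho> acc f (B + 2) xs e C a" for xs e s C a
    proof -
      define Cs where "Cs i = C(f := counter (F xs e - i), f + 1 := counter (G xs e - i))" for i
      have C: "C acc = counter a" "C f = counter 0" "C (f + 1) = counter 0"
        using pre by (auto simp: pre_def)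
      have "pre k m \<rho> f (f + 2) B xs e C 0"
        using pre by (auto simp: pre_def)
      from p(2)[OF b this] have 1: "runs p C (g s) (C(f := counter (F xs e)))"
        by simp
      have "pre k m \<rho> (f + 1) (f + 2) B xs e (C(f := counter (F xs e))) 0"
        using pre l by (auto simp: pre_def layout_def)
      from q(2)[OF b this] have 2: "runs q (C(f := counter (F xs e))) (g s) (Cs 0)"
        by (simp add: Cs_def)
      have 3: "runs loop (Cs 0) (G xs e * (4 + 1) + 1) (Cs (G xs e))"
        unfolding loop_def
      proof (rule runs_While)
        show "tape_read (Cs (G xs e) (f + 1)) \<notin> {0}"
          by (simp add: Cs_def)
        fix i assume i: "i < G xs e"
        let ?C = "(Cs i)(f + 1 := counter (G xs e - Suc i))"
        have s1: "runs (mv (moves {f + 1} {})) (Cs i) 1 ?C"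
          by (rule runs_mv') (use i in \<open>auto simp: Cs_def shift_def counter_def fun_eq_iff of_nat_diff\<close>)
        have "runs (Cond f {0} (mv (moves {f} {})) (mv (moves {} {}))) ?C (1 + 1) (Cs (Suc i))"
        proof (cases "i < F xs e")
          case True
          show ?thesis
            by (rule runs_Cond_True, use True in \<open>simp add: Cs_def\<close>, rule runs_mv')
              (use True in \<open>auto simp: Cs_def shift_def counter_def fun_eq_iff of_nat_diff\<close>)
        next
          case False
          show ?thesis
            by (rule runs_Cond_False, use False in \<open>simp add: Cs_def\<close>, rule runs_mv')
              (use False in \<open>auto simp: Cs_def shift_def fun_eq_iff\<close>)
        qed
        from runs_Seq[OF s1 this] i
        show "tape_read (Cs i (f + 1)) \<in> {0} \<and>
          runs (Seq (mv (moves {f + 1} {})) (Cond f {0} (mv (moves {f} {})) (mv (moves {} {}))))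
            (Cs i) 4 (Cs (Suc i))"
          by (simp add: Cs_def numeral_eq_Suc)
      qed
      have 4: "runs last (Cs (G xs e)) (2 * (F xs e - G xs e) + 1) (C(acc := counter (a + (F xs e - G xs e))))"
        unfolding last_def
        by (rule runs_transfer') (use C acc in \<open>auto simp: Cs_def shift_def fun_eq_iff counter_def\<close>)
      have "F xs e \<le> g s" "G xs e \<le> g s"
        using computes_bound[OF F b] computes_bound[OF G b] by simp_all
      then show ?thesis
        unfolding r_def by (intro runs_mono[OF runs_Seq[OF runs_Seq[OF 1 2] runs_Seq[OF 3 4]]]) simp
    qed
    then show "\<exists>p. wf_prog (f + (B + 2)) p \<and>
      (\<forall>xs e s C a. bounded k m xs e s \<longrightarrow> pre k m \<rho> acc f (B + 2) xs e C a \<longrightarrow>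
        runs p C (?g s) (C(acc := counter (a + (F xs e - G xs e)))))"
      using p(1) q(1) by (intro exI[of _ r]) (auto simp: r_def loop_def last_def add_ac)
  qed
qed

lemma dfn_rename:
  assumes "dfn k m F" "\<And>i. i < m \<Longrightarrow> \<sigma> i < n"
  shows "dfn k n (\<lambda>xs e. F xs (\<lambda>i. e (\<sigma> i)))"
proof -
  obtain B g where g: "pb g" and F: "computes k m F B g"
    using assms(1) by (rule dfnE)
  have b: "bounded k m xs (\<lambda>i. e (\<sigma> i)) s" if "bounded k n xs e s" for xs e s
    using that assms(2) by (auto simp: bounded_def)
  show ?thesis
  proof (rule dfnI[OF g])
    show "F xs (\<lambda>i. e (\<sigma> i)) \<le> g s" if "bounded k n xs e s" for xs e s
      using computes_bound[OF F b[OF that]] .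
    fix \<rho> acc f assume l: "layout k n \<rho> acc f"
    then have "layout k m (\<lambda>i. \<rho> (\<sigma> i)) acc f"
      using assms(2) by (auto simp: layout_def)
    with F obtain p where p: "wf_prog (f + B) p"
      "\<And>xs e s C a. bounded k m xs e s \<Longrightarrow> pre k m (\<lambda>i. \<rho> (\<sigma> i)) acc f B xs e C a \<Longrightarrow>
         runs p C (g s) (C(acc := counter (a + F xs e)))"
      by (rule computesD) blast
    have "pre k m (\<lambda>i. \<rho> (\<sigma> i)) acc f B xs (\<lambda>i. e (\<sigma> i)) C a" if "pre k n \<rho> acc f B xs e C a" for xs e C a
      using that assms(2) by (auto simp: pre_def)
    then show "\<exists>p. wf_prog (f + B) p \<and>
      (\<forall>xs e s C a. bounded k n xs e s \<longrightarrow> pre k n \<rho> acc f B xs e C a \<longrightarrow>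
        runs p C (g s) (C(acc := counter (a + F xs (\<lambda>i. e (\<sigma> i))))))"
      using p b by (intro exI[of _ p]) blast
  qed
qed

text \<open>Variables are de Bruijn indices: the summation index is variable 0 of the body and lives
  on tape \<open>f + 1\<close>, while \<open>f\<close> counts the remaining rounds. The body adds
  its value directly to \<open>acc\<close>; this is why programs add their result instead of storing
  it.\<close>

lemma dfn_sum:
  assumes "dfn k m T" "dfn k (Suc m) (\<lambda>xs e. F xs (e 0) (\<lambda>i. e (Suc i)))"
  shows "dfn k m (\<lambda>xs e. \<Sum>i<T xs e. F xs i e)"
proof -
  obtain B g where g: "pb g" "mono g" and T: "computes k m T B g"
    and F: "computes k (Suc m) (\<lambda>xs e. F xs (e 0) (\<lambda>i. e (Suc i))) B g"
    using assms by (rule dfn2E)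
  let ?g' = "\<lambda>s. g (s + g s)"
  let ?g = "\<lambda>s. g s * (?g' s + 5) + 3 * g s + 5"
  have b': "bounded k (Suc m) xs (case_nat i e) (s + g s)"
    if b: "bounded k m xs e s" and "i < T xs e" for xs e s i
    using that computes_bound[OF T b] unfolding bounded_def
    by (auto split: nat.splits intro: trans_le_add1 trans_le_add2)
  have F': "F xs i e \<le> ?g' s" if b: "bounded k m xs e s" and "i < T xs e" for xs e s i
    using computes_bound[OF F b'[OF that]] by simp
  have T': "T xs e \<le> g s" if b: "bounded k m xs e s" for xs e s
    using computes_bound[OF T b] .
  show ?thesis
  proof (rule dfnI[where g = ?g and B = "B + 2"])
    show "pb ?g"
      by (intro pb_intros g pb_comp[OF g(1)])
    show "(\<Sum>i<T xs e. F xs i e) \<le> ?g s" if b: "bounded k m xs e s" for xs e s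
    proof -
      have "(\<Sum>i<T xs e. F xs i e) \<le> (\<Sum>i<T xs e. ?g' s)"
        using F'[OF b] by (intro sum_mono) simp
      also have "\<dots> \<le> g s * ?g' s"
        using T'[OF b] by simp
      finally show ?thesis
        by (simp add: distrib_left)
    qed
    fix \<rho> acc f assume l: "layout k m \<rho> acc f"
    have l1: "layout k m \<rho> f (f + 2)"
      using l unfolding layout_def by fastforce
    have l2: "layout k (Suc m) (case_nat (f + 1) \<rho>) acc (f + 2)"
      using l unfolding layout_def by (force split: nat.splits)
    obtain p where p: "wf_prog (f + 2 + B) p"
      "\<And>xs e s C a. bounded k m xs e s \<Longrightarrow> pre k m \<rho> f (f + 2) B xs e C a \<Longrightarrow>
         runs p C (g s) (C(f := counter (a + T xs e)))"
      using T l1 by (rule computesD) blast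
    obtain q where q: "wf_prog (f + 2 + B) q"
      "\<And>xs e s C a. bounded k (Suc m) xs e s \<Longrightarrow> pre k (Suc m) (case_nat (f + 1) \<rho>) acc (f + 2) B xs e C a \<Longrightarrow>
         runs q C (g s) (C(acc := counter (a + F xs (e 0) (\<lambda>i. e (Suc i)))))"
      using F l2 by (rule computesD) blast
    define loop where "loop = While f {0}
      (Seq (mv (moves {f} {})) (Seq q (mv (moves {} {f + 1}))))"
    define last where "last = While (f + 1) {0} (mv (moves {f + 1} {}))"
    define r where "r = Seq p (Seq loop last)"
    have acc: "acc < f"
      using l by (simp add: layout_def)
    have "runs r C (?g s) (C(acc := counter (a + (\<Sum>i<T xs e. F xs i e))))"
      if b: "bounded k m xs e s" and pre: "pre k m \<rho> acc f (B + 2) xs e C a" for xs e s C a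
    proof -
      define Cs where "Cs i = C(f := counter (T xs e - i), f + 1 := counter i,
        acc := counter (a + (\<Sum>j<i. F xs j e)))" for i
      have C: "C acc = counter a" "C f = counter 0" "C (f + 1) = counter 0"
        using pre by (auto simp: pre_def)
      have "pre k m \<rho> f (f + 2) B xs e C 0"
        using pre by (auto simp: pre_def)
      from p(2)[OF b this] have 1: "runs p C (g s) (Cs 0)"
        using C acc by (simp add: Cs_def fun_upd_idem)
      have 2: "runs loop (Cs 0) (T xs e * (?g' s + 4 + 1) + 1) (Cs (T xs e))"
        unfolding loop_def
      proof (rule runs_While)
        show "tape_read (Cs (T xs e) f) \<notin> {0}"
          using acc by (simp add: Cs_def)
        fix i assume i: "i < T xs e"
        let ?C = "(Cs i)(f := counter (T xs e - Suc i))"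
        let ?C' = "?C(acc := counter (a + (\<Sum>j<Suc i. F xs j e)))"
        have s1: "runs (mv (moves {f} {})) (Cs i) 1 ?C"
          by (rule runs_mv') (use i acc in \<open>auto simp: Cs_def shift_def counter_def fun_eq_iff of_nat_diff\<close>)
        have "pre k (Suc m) (case_nat (f + 1) \<rho>) acc (f + 2) B xs (case_nat i e) ?C (a + (\<Sum>j<i. F xs j e))"
          using pre l unfolding pre_def layout_def Cs_def
          by (auto split: nat.splits simp: less_Suc_eq_0_disj)
        from q(2)[OF b'[OF b i] this] have s2: "runs q ?C (?g' s) ?C'"
          by (simp add: add.assoc)
        have s3: "runs (mv (moves {} {f + 1})) ?C' 1 (Cs (Suc i))"
          by (rule runs_mv') (use i acc in \<open>auto simp: Cs_def shift_def counter_def fun_eq_iff\<close>)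
        show "tape_read (Cs i f) \<in> {0} \<and>
          runs (Seq (mv (moves {f} {})) (Seq q (mv (moves {} {f + 1})))) (Cs i) (?g' s + 4) (Cs (Suc i))"
          using runs_Seq[OF s1 runs_Seq[OF s2 s3]] i acc by (simp add: Cs_def numeral_eq_Suc)
      qed
      have 3: "runs last (Cs (T xs e)) (2 * T xs e + 1) (C(acc := counter (a + (\<Sum>i<T xs e. F xs i e))))"
        unfolding last_def
        by (rule runs_transfer') (use C acc in \<open>auto simp: Cs_def shift_def fun_eq_iff counter_def\<close>)
      have "T xs e * (?g' s + 4 + 1) \<le> g s * (?g' s + 5)"
        using T'[OF b] by (intro mult_le_mono) simp_all
      then show ?thesis
        unfolding r_def using T'[OF b]
        by (intro runs_mono[OF runs_Seq[OF 1 runs_Seq[OF 2 3]]]) linarith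
    qed
    then show "\<exists>p. wf_prog (f + (B + 2)) p \<and>
      (\<forall>xs e s C a. bounded k m xs e s \<longrightarrow> pre k m \<rho> acc f (B + 2) xs e C a \<longrightarrow>
        runs p C (?g s) (C(acc := counter (a + (\<Sum>i<T xs e. F xs i e)))))"
      using p(1) q(1) by (intro exI[of _ r]) (auto simp: r_def loop_def last_def add_ac)
  qed
qed

text \<open>The head of the input tape walks to the requested cell while the distance is kept on
  tape \<open>f + 1\<close>, which brings it back after the symbol has been tested.\<close>

lemma dfn_symbol:
  assumes "j < k" "dfn k m F"
  shows "dfn k m (\<lambda>xs e. string_content (xs ! j) (int (F xs e)))"
proof -
  obtain B g where g: "pb g" "mono g" and F: "computes k m F B g"
    using assms(2) by (rule dfnE)
  let ?g = "\<lambda>s. 5 * g s + 15"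
  let ?sym = "\<lambda>xs e. string_content (xs ! j) (int (F xs e))"
  have sym: "?sym xs e \<in> {0, 1, 2}" for xs e
    unfolding string_content_def using bit_symbol.elims by auto
  show ?thesis
  proof (rule dfnI[where g = ?g and B = "B + 2"])
    show "pb ?g"
      by (intro pb_intros g)
    show "?sym xs e \<le> ?g s" for xs e s
      using sym[of xs e] by auto
    fix \<rho> acc f assume l: "layout k m \<rho> acc f"
    have l1: "layout k m \<rho> f (f + 2)"
      using l unfolding layout_def by fastforce
    obtain p where p: "wf_prog (f + 2 + B) p"
      "\<And>xs e s C a. bounded k m xs e s \<Longrightarrow> pre k m \<rho> f (f + 2) B xs e C a \<Longrightarrow>
         runs p C (g s) (C(f := counter (a + F xs e)))"
      using F l1 by (rule computesD) blast
    let ?m1 = "moves {f} {j, f + 1}"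
    let ?m2 = "moves {f + 1, j} {}"
    let ?inc = "mv (moves {} {acc})"
    define test where "test = Cond j {1} ?inc (Cond j {2} (Seq ?inc ?inc) (mv (moves {} {})))"
    define r where "r = Seq p (Seq (While f {0} (mv ?m1)) (Seq test (While (f + 1) {0} (mv ?m2))))"
    have ord: "acc < f" "j < acc"
      using l assms(1) by (auto simp: layout_def)
    have "runs r C (?g s) (C(acc := counter (a + ?sym xs e)))"
      if b: "bounded k m xs e s" and pre: "pre k m \<rho> acc f (B + 2) xs e C a" for xs e s C a
    proof -
      let ?x = "string_content (xs ! j)"
      have C: "C acc = counter a" "C f = counter 0" "C (f + 1) = counter 0" "C j = (?x, 0)"
        using pre assms(1) by (auto simp: pre_def)
      let ?C1 = "C(f := counter (F xs e))"
      let ?C2 = "C(f + 1 := counter (F xs e), j := (?x, int (F xs e)))"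
      let ?C3 = "?C2(acc := counter (a + ?sym xs e))"
      have "pre k m \<rho> f (f + 2) B xs e C 0"
        using pre by (auto simp: pre_def)
      from p(2)[OF b this] have 1: "runs p C (g s) ?C1"
        by simp
      have 2: "runs (While f {0} (mv ?m1)) ?C1 (2 * F xs e + 1) ?C2"
        by (rule runs_transfer') (use C ord in \<open>auto simp: shift_def fun_eq_iff counter_def\<close>)
      have inc: "runs ?inc (?C2(acc := counter v)) 1 (?C2(acc := counter (v + 1)))" for v
        by (rule runs_mv') (use ord in \<open>auto simp: shift_def fun_eq_iff counter_def\<close>)
      have C2: "?C2(acc := counter a) = ?C2"
        using C ord by (auto simp: fun_eq_iff)
      have idle: "runs (mv (moves {} {})) ?C2 1 ?C2"
        by (rule runs_mv') (auto simp: shift_def fun_eq_iff)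
      have read: "tape_read (?C2 j) = ?sym xs e"
        using ord by simp
      have 3: "runs test ?C2 5 ?C3"
      proof -
        consider "?sym xs e = 0" | "?sym xs e = 1" | "?sym xs e = 2"
          using sym[of xs e] by auto
        then show ?thesis
        proof cases
          case 1
          then have "runs test ?C2 (1 + 1 + 1) ?C3"
            unfolding test_def using idle C2 read
            by (intro runs_Cond_False) (simp_all del: tape_read.simps)
          then show ?thesis
            by (rule runs_mono) simp
        next
          case 2
          have "runs ?inc ?C2 1 ?C3"
            using inc[of a] 2 C2 by simp
          then have "runs test ?C2 (1 + 1) ?C3"
            unfolding test_def using read 2 by (intro runs_Cond_True) (simp_all del: tape_read.simps)
          then show ?thesis
            by (rule runs_mono) simp
        next
          case 3
          have "runs (Seq ?inc ?inc) ?C2 (1 + 1 + 1) ?C3"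
            using runs_Seq[OF inc[of a] inc[of "a + 1"]] 3 C2 by simp
          then have "runs test ?C2 (1 + 1 + 1 + 1 + 1) ?C3"
            unfolding test_def using read 3
            by (intro runs_Cond_False runs_Cond_True) (simp_all del: tape_read.simps)
          then show ?thesis
            by (rule runs_mono) simp
        qed
      qed
      have 4: "runs (While (f + 1) {0} (mv ?m2)) ?C3 (2 * F xs e + 1) (C(acc := counter (a + ?sym xs e)))"
        by (rule runs_transfer') (use C ord in \<open>auto simp: shift_def fun_eq_iff counter_def\<close>)
      show ?thesis
        unfolding r_def using computes_bound[OF F b]
        by (intro runs_mono[OF runs_Seq[OF 1 runs_Seq[OF 2 runs_Seq[OF 3 4]]]]) simp
    qed
    then show "\<exists>p. wf_prog (f + (B + 2)) p \<and>
      (\<forall>xs e s C a. bounded k m xs e s \<longrightarrow> pre k m \<rho> acc f (B + 2) xs e C a \<longrightarrow>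
        runs p C (?g s) (C(acc := counter (a + ?sym xs e))))"
      using p(1) ord by (intro exI[of _ r]) (auto simp: r_def test_def add_ac)
  qed
qed

lemma dfn_length:
  assumes "j < k"
  shows "dfn k m (\<lambda>xs e. length (xs ! j))"
proof (rule dfnI[where g = "\<lambda>s. 4 * s + 3" and B = 1])
  show "pb (\<lambda>s. 4 * s + 3)"
    by (intro pb_intros)
  show "length (xs ! j) \<le> 4 * s + 3" if "bounded k m xs e s" for xs e s
    using that assms by (force simp: bounded_def)
  fix \<rho> acc f assume l: "layout k m \<rho> acc f"
  let ?m1 = "moves {} {j, f}" and ?m2 = "moves {f, j} {acc}"
  define p where "p = Seq (While j {1, 2} (mv ?m1)) (While f {0} (mv ?m2))"
  have ord: "acc < f" "j < acc"
    using l assms by (auto simp: layout_def)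
  have "runs p C (4 * s + 3) (C(acc := counter (a + length (xs ! j))))"
    if b: "bounded k m xs e s" and pre: "pre k m \<rho> acc f 1 xs e C a" for xs e s C a
  proof -
    let ?x = "string_content (xs ! j)" and ?l = "length (xs ! j)"
    have C: "C acc = counter a" "C f = counter 0" "C j = (?x, 0)"
      using pre assms by (auto simp: pre_def)
    have "runs (While j {1, 2} (mv ?m1)) (shift ?m1 0 C) (?l * (1 + 1) + 1) (shift ?m1 ?l C)"
    proof (rule runs_While)
      show "tape_read (shift ?m1 ?l C j) \<notin> {1, 2}"
        using C ord by (simp add: shift_def string_content_def)
      fix i assume "i < ?l"
      moreover have "bit_symbol b \<in> {1, 2}" for b
        by (cases b) auto
      ultimately have "tape_read (shift ?m1 i C j) \<in> {1, 2}"
        using C ord by (simp add: shift_def string_content_def)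
      moreover have "runs (mv ?m1) (shift ?m1 i C) 1 (shift ?m1 (Suc i) C)"
        by (rule runs_mv') (auto simp: shift_def)
      ultimately show "tape_read (shift ?m1 i C j) \<in> {1, 2} \<and>
          runs (mv ?m1) (shift ?m1 i C) 1 (shift ?m1 (Suc i) C)" ..
    qed
    moreover have "shift ?m1 0 C = C"
      by (simp add: shift_def)
    ultimately have 1: "runs (While j {1, 2} (mv ?m1)) C (?l + ?l + 1) (shift ?m1 ?l C)"
      by simp
    have 2: "runs (While f {0} (mv ?m2)) (shift ?m1 ?l C) (2 * ?l + 1) (C(acc := counter (a + ?l)))"
      by (rule runs_transfer') (use C ord in \<open>auto simp: shift_def fun_eq_iff counter_def\<close>)
    have "?l \<le> s"
      using b assms by (simp add: bounded_def)
    then show ?thesis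
      unfolding p_def by (intro runs_mono[OF runs_Seq[OF 1 2]]) simp
  qed
  then show "\<exists>p. wf_prog (f + 1) p \<and>
      (\<forall>xs e s C a. bounded k m xs e s \<longrightarrow> pre k m \<rho> acc f 1 xs e C a \<longrightarrow>
        runs p C (4 * s + 3) (C(acc := counter (a + length (xs ! j)))))"
    using ord by (intro exI[of _ p]) (auto simp: p_def)
qed

section \<open>Arithmetic, logic and case distinctions\<close>

lemma dfn_const: "dfn k m (\<lambda>xs e. c)"
proof (induction c)
  case 0
  then show ?case by (rule dfn_zero)
next
  case (Suc c)
  show ?case
    using dfn_add[OF Suc dfn_one] by simp
qed

lemma dfn_weaken: "dfn k m F \<Longrightarrow> dfn k (Suc m) (\<lambda>xs e. F xs (\<lambda>i. e (Suc i)))"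
  by (rule dfn_rename[where \<sigma> = Suc]) auto

lemma dfn_mult:
  assumes "dfn k m F" "dfn k m G"
  shows "dfn k m (\<lambda>xs e. F xs e * G xs e)"
  using dfn_sum[OF assms(1) dfn_weaken[OF assms(2)]] by simp

lemma dfn_Suc: "dfn k m F \<Longrightarrow> dfn k m (\<lambda>xs e. Suc (F xs e))"
  using dfn_add[OF _ dfn_one] by simp

lemma dfn_less:
  assumes "dfn k m F" "dfn k m G"
  shows "dfn k m (\<lambda>xs e. of_bool (F xs e < G xs e))"
proof -
  have "(of_bool (a < b) :: nat) = 1 - (1 - (b - a))" for a b :: nat
    by auto
  then show ?thesis
    using dfn_diff[OF dfn_one dfn_diff[OF dfn_one dfn_diff[OF assms(2,1)]]] by simp
qed

lemma dfn_not:
  assumes "dfn k m (\<lambda>xs e. of_bool (P xs e))"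
  shows "dfn k m (\<lambda>xs e. of_bool (\<not> P xs e))"
proof -
  have "(of_bool (\<not> b) :: nat) = 1 - of_bool b" for b
    by simp
  then show ?thesis
    using dfn_diff[OF dfn_one assms] by simp
qed

lemma dfn_conj:
  assumes "dfn k m (\<lambda>xs e. of_bool (P xs e))" "dfn k m (\<lambda>xs e. of_bool (Q xs e))"
  shows "dfn k m (\<lambda>xs e. of_bool (P xs e \<and> Q xs e))"
  using dfn_mult[OF assms] by (simp flip: of_bool_conj)

lemma dfn_disj:
  assumes "dfn k m (\<lambda>xs e. of_bool (P xs e))" "dfn k m (\<lambda>xs e. of_bool (Q xs e))"
  shows "dfn k m (\<lambda>xs e. of_bool (P xs e \<or> Q xs e))"
  using dfn_not[OF dfn_conj[OF assms[THEN dfn_not]]] by simp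

lemma dfn_imp:
  assumes "dfn k m (\<lambda>xs e. of_bool (P xs e))" "dfn k m (\<lambda>xs e. of_bool (Q xs e))"
  shows "dfn k m (\<lambda>xs e. of_bool (P xs e \<longrightarrow> Q xs e))"
  using dfn_disj[OF dfn_not[OF assms(1)] assms(2)] by simp

lemma dfn_le:
  assumes "dfn k m F" "dfn k m G"
  shows "dfn k m (\<lambda>xs e. of_bool (F xs e \<le> G xs e))"
  using dfn_not[OF dfn_less[OF assms(2,1)]] by (simp add: not_less)

lemma dfn_eq:
  assumes "dfn k m F" "dfn k m G"
  shows "dfn k m (\<lambda>xs e. of_bool (F xs e = G xs e))"
  using dfn_conj[OF dfn_le[OF assms] dfn_le[OF assms(2,1)]] by (simp add: order_eq_iff)

lemma dfn_if:
  assumes "dfn k m (\<lambda>xs e. of_bool (P xs e))" "dfn k m F" "dfn k m G"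
  shows "dfn k m (\<lambda>xs e. if P xs e then F xs e else G xs e)"
proof -
  have "(if b then x else y) = of_bool b * x + of_bool (\<not> b) * y" for b and x y :: nat
    by simp
  then show ?thesis
    using dfn_add[OF dfn_mult[OF assms(1,2)] dfn_mult[OF dfn_not[OF assms(1)] assms(3)]] by simp
qed

lemma dfn_ex:
  assumes "dfn k m T" "dfn k (Suc m) (\<lambda>xs e. of_bool (P xs (e 0) (\<lambda>i. e (Suc i))))"
  shows "dfn k m (\<lambda>xs e. of_bool (\<exists>i<T xs e. P xs i e))"
proof -
  have "(of_bool (\<exists>i<T. P i) :: nat) = of_bool (0 < (\<Sum>i<T. of_bool (P i) :: nat))" for T and P :: "nat \<Rightarrow> bool"
    by (auto simp: sum_pos2 zero_less_iff_neq_zero)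
  then show ?thesis
    using dfn_less[OF dfn_zero dfn_sum[OF assms(1), where F = "\<lambda>xs i e. of_bool (P xs i e)", OF assms(2)]]
    by simp
qed

lemma dfn_all:
  assumes "dfn k m T" "dfn k (Suc m) (\<lambda>xs e. of_bool (P xs (e 0) (\<lambda>i. e (Suc i))))"
  shows "dfn k m (\<lambda>xs e. of_bool (\<forall>i<T xs e. P xs i e))"
  using dfn_not[OF dfn_ex[OF assms(1), where P = "\<lambda>xs i e. \<not> P xs i e", OF dfn_not[OF assms(2)]]]
  by simp

text \<open>The quotient counts the positive multiples of the divisor up to the dividend; the guard
  \<open>0 < b\<close> yields the value 0 for division by 0.\<close>

lemma dfn_div:
  assumes "dfn k m F" "dfn k m G"
  shows "dfn k m (\<lambda>xs e. F xs e div G xs e)"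
proof -
  have "a div b = (\<Sum>i<a. of_bool (0 < b \<and> Suc i * b \<le> a))" for a b :: nat
  proof (cases "b = 0")
    case False
    then have "0 < b \<and> Suc i * b \<le> a \<longleftrightarrow> i < a div b" for i
      using less_eq_div_iff_mult_less_eq[of b "Suc i" a] False by (simp del: mult_Suc add: Suc_le_eq)
    then have "(\<Sum>i<a. of_bool (0 < b \<and> Suc i * b \<le> a)) = (\<Sum>i<a. of_bool (i < a div b) :: nat)"
      by (simp only:)
    also have "\<dots> = card ({..<a} \<inter> {i. i < a div b})"
      by (simp add: sum.If_cases of_bool_def)
    also have "{..<a} \<inter> {i. i < a div b} = {..<a div b}"
      using less_le_trans[OF _ div_le_dividend[of a b]] by blast
    finally show ?thesis
      by simp
  qed simp
  moreover have "dfn k m (\<lambda>xs e. \<Sum>i<F xs e. of_bool (0 < G xs e \<and> Suc i * G xs e \<le> F xs e))"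
    by (rule dfn_sum[OF assms(1)])
      (rule dfn_conj[OF dfn_less[OF dfn_zero dfn_weaken[OF assms(2)]]
        dfn_le[OF dfn_mult[OF dfn_Suc[OF dfn_var] dfn_weaken[OF assms(2)]] dfn_weaken[OF assms(1)]]], simp)
  ultimately show ?thesis
    by simp
qed

lemma dfn_mod:
  assumes "dfn k m F" "dfn k m G"
  shows "dfn k m (\<lambda>xs e. F xs e mod G xs e)"
  using dfn_diff[OF assms(1) dfn_mult[OF dfn_div[OF assms] assms(2)]]
  by (simp add: minus_div_mult_eq_mod)

text \<open>A local definition is a bounded sum with a single nonzero term. Together with renaming
  it gives composition.\<close>

lemma dfn_let:
  assumes "dfn k m A" "dfn k (Suc m) (\<lambda>xs e. F xs (e 0) (\<lambda>i. e (Suc i)))"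
  shows "dfn k m (\<lambda>xs e. F xs (A xs e) e)"
proof -
  have "(\<Sum>i<Suc a. of_bool (i = a) * f i) = f a" for a and f :: "nat \<Rightarrow> nat"
    by simp
  moreover have "dfn k m (\<lambda>xs e. \<Sum>i<Suc (A xs e). of_bool (i = A xs e) * F xs i e)"
    using dfn_sum[OF dfn_Suc[OF assms(1)], of "\<lambda>xs i e. of_bool (i = A xs e) * F xs i e"]
      dfn_mult[OF dfn_eq[OF dfn_var[of 0] dfn_weaken[OF assms(1)]] assms(2)] by simp
  ultimately show ?thesis
    by simp
qed

lemma dfn_comp1:
  assumes "dfn k 1 (\<lambda>xs e. F xs (e 0))" "dfn k m A"
  shows "dfn k m (\<lambda>xs e. F xs (A xs e))"
  using dfn_let[OF assms(2), of "\<lambda>xs i e. F xs i"] dfn_rename[OF assms(1), of id "Suc m"] by simp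

lemma dfn_comp2:
  assumes "dfn k 2 (\<lambda>xs e. F xs (e 0) (e 1))" "dfn k m A" "dfn k m B"
  shows "dfn k m (\<lambda>xs e. F xs (A xs e) (B xs e))"
proof (rule dfn_let[OF assms(2), of "\<lambda>xs i e. F xs i (B xs e)"])
  have "dfn k (Suc (Suc m)) (\<lambda>xs e. F xs (e 1) (e 0))"
    using dfn_rename[OF assms(1), of "\<lambda>i. if i = 0 then 1 else 0"] by simp
  then show "dfn k (Suc m) (\<lambda>xs e. F xs (e 0) (B xs (\<lambda>i. e (Suc i))))"
    using dfn_let[OF dfn_weaken[OF assms(3)], of "\<lambda>xs i e. F xs (e 0) i"] by simp
qed

text \<open>The cases are tested one after the other, so nothing is required of the way
  \<open>F c\<close> depends on \<open>c\<close>. Through tables the data on tiles, tree offsets and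
  machine transitions enter the reduction.\<close>

lemma dfn_table:
  assumes "dfn k m A" "\<And>c. c < B \<Longrightarrow> dfn k m (F c)"
  shows "dfn k m (\<lambda>xs e. if A xs e < B then F (A xs e) xs e else 0)"
  using assms(2)
proof (induction B)
  case 0
  then show ?case by (simp add: dfn_zero)
next
  case (Suc B)
  have "dfn k m (\<lambda>xs e. if A xs e = B then F B xs e else if A xs e < B then F (A xs e) xs e else 0)"
    by (rule dfn_if[OF dfn_eq[OF assms(1) dfn_const] Suc.prems Suc.IH]) (simp_all add: Suc.prems)
  moreover have "(if A xs e = B then F B xs e else if A xs e < B then F (A xs e) xs e else 0) =
      (if A xs e < Suc B then F (A xs e) xs e else 0)" for xs e
    by auto
  ultimately show ?case
    by simp
qed

lemma dfn_table_bool: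
  assumes "dfn k m A" "\<And>c. c < B \<Longrightarrow> dfn k m (\<lambda>xs e. of_bool (P c xs e))"
  shows "dfn k m (\<lambda>xs e. of_bool (A xs e < B \<and> P (A xs e) xs e))"
proof -
  have "(if A xs e < B then of_bool (P (A xs e) xs e) else 0 :: nat) = of_bool (A xs e < B \<and> P (A xs e) xs e)" for xs e
    by simp
  then show ?thesis
    using dfn_table[OF assms(1), where B = B and F = "\<lambda>c xs e. of_bool (P c xs e)", OF assms(2)] by simp
qed

lemma dfn_poly:
  assumes "dfn k m A"
  shows "dfn k m (\<lambda>xs e. poly p (A xs e))"
proof (induction p)
  case 0
  then show ?case by (simp add: dfn_zero)
next
  case (pCons a p)
  then show ?case
    by (simp add: dfn_add dfn_const dfn_mult assms)
qed

lemmas dfn_intros =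
  dfn_var dfn_add dfn_diff dfn_mult dfn_Suc dfn_sum dfn_less dfn_le dfn_eq dfn_not dfn_conj
  dfn_disj dfn_imp dfn_if dfn_ex dfn_all dfn_div dfn_mod dfn_poly

subsection \<open>Deciders and transducers\<close>

lemma run_Suc: "tm_run M xs (Suc t) = tm_step M (tm_run M xs t)"
  by (simp add: tm_run_def)

lemma run_halted:
  assumes "halted M (tm_run M xs t)" "t \<le> t'"
  shows "tm_run M xs t' = tm_run M xs t"
  using assms(2)
proof (induction rule: dec_induct)
  case (step t')
  then show ?case
    using assms(1) by (simp add: run_Suc tm_step_def)
qed simp

lemma accepts_iff:
  assumes "halted M (tm_run M xs t)"
  shows "tm_accepts M xs \<longleftrightarrow> fst (tm_run M xs t) = tm_acc M"
proof
  assume "tm_accepts M xs"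
  then obtain t' where t': "fst (tm_run M xs t') = tm_acc M"
    by (auto simp: tm_accepts_def)
  then have "halted M (tm_run M xs t')"
    by (simp add: halted_def)
  then have "tm_run M xs t' = tm_run M xs t"
    using assms run_halted[of M xs t t'] run_halted[of M xs t' t] nat_le_linear[of t t'] by metis
  then show "fst (tm_run M xs t) = tm_acc M"
    using t' by simp
qed (auto simp: tm_accepts_def)

definition init_store :: "bool list list \<Rightarrow> store" where
  "init_store xs j = (if j < length xs then string_content (xs ! j) else (\<lambda>_. 0), 0)"

context tape_machine
begin

lemma init:
  assumes "length xs \<le> n"
  shows "tm_init M xs = (e [p], map (init_store xs) [0..<n])"
proof -
  have [simp]: "string_content [] = (\<lambda>_. 0)"
    by (simp add: string_content_def fun_eq_iff)
  have "map (\<lambda>x. (string_content x, 0)) (xs @ replicate (n - length xs) []) = map (init_store xs) [0..<n]"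
    using assms by (intro nth_equalityI) (auto simp: init_store_def nth_append)
  moreover have "tm_start M = e [p]"
    by (simp add: M_def machine_def)
  ultimately show ?thesis
    by (simp add: tm_init_def)
qed

lemma run_exec:
  assumes "length xs \<le> n" "exec p (init_store xs) t C"
  shows "tm_run M xs t = (e [], map C [0..<n])"
  using runs_to[OF assms(2)] init[OF assms(1)] by (simp add: tm_run_def)

text \<open>As \<open>Reject\<close> has no execution, the rejecting branch is followed on the
  machine: one step unfolds the sequence, \<open>t\<close> steps run \<open>p'\<close>, one step
  takes the test.\<close>

lemma run_reject:
  assumes "length xs \<le> n" "p = Seq p' (Cond k S Reject q)" "exec p' (init_store xs) t C" "tape_read (C k) \<in> S"
  shows "tm_run M xs (t + 2) = (e [Reject], map C [0..<n])"
proof -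
  have k: "k < n"
    using wfp assms(2) by simp
  have sub: "[p] \<in> machine_states p" "conts p' [Cond k S Reject q] \<subseteq> machine_states p"
    "[Cond k S Reject q] \<in> machine_states p"
    using special_states by (auto simp: machine_states_def assms(2))
  have 1: "tm_step M (e [p], map (init_store xs) [0..<n]) = (e [p', Cond k S Reject q], map (init_store xs) [0..<n])"
    using step[OF _ _ _ next_act.simps(3) refl, of p' "Cond k S Reject q" "[]" "init_store xs"] sub
    by (simp add: assms(2) cong: map_cong)
  have 2: "tm_step M (e [Cond k S Reject q], map C [0..<n]) = (e [Reject], map C [0..<n])"
    using step[OF _ _ _ next_act.simps(4) refl, of k S Reject q "[]" C] sub assms(4) k
    by (simp cong: map_cong)
  have "tm_run M xs (t + 2) = (tm_step M ^^ (1 + t + 1)) (e [p], map (init_store xs) [0..<n])"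
    using init[OF assms(1)] by (simp add: tm_run_def)
  also have "\<dots> = tm_step M ((tm_step M ^^ t) (tm_step M (e [p], map (init_store xs) [0..<n])))"
    by (simp add: funpow_add funpow_swap1)
  also have "\<dots> = (e [Reject], map C [0..<n])"
    unfolding 1 steps[OF assms(3) sub(2)] 2 ..
  finally show ?thesis .
qed

end

lemma machine_exists:
  assumes "1 \<le> n" "wf_prog n p"
  obtains M e where "tape_machine n p e M"
proof -
  have "finite (machine_states p)"
    by (simp add: machine_states_def finite_conts)
  then obtain e where "bij_betw e (machine_states p) {..<card (machine_states p)}"
    using ex_bij_betw_finite_nat[of "machine_states p"] by (auto simp: atLeast0LessThan)
  then show ?thesis
    using assms that by (auto simp: tape_machine_def)
qed

lemma poly_timeI:
  assumes "wf_tm M" "k \<le> tm_tapes M" "pb g"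
    and "\<And>xs. length xs = k \<Longrightarrow> \<exists>t \<le> g (sum_list (map length xs)). halted M (tm_run M xs t)"
  shows "poly_time_tm k M"
proof -
  obtain c where c: "\<And>s. g s \<le> (s + 2) ^ c"
    using assms(3) by (auto simp: pb_def)
  \<comment> \<open>\<open>[:2, 1:] ^ c\<close> is the polynomial whose value at \<open>s\<close> is
    \<open>(s + 2) ^ c\<close>, the bound in \<open>pb\<close>.\<close>
  have "halted M (tm_run M xs (poly ([:2, 1:] ^ c) (sum_list (map length xs))))" if len: "length xs = k" for xs
  proof -
    let ?s = "sum_list (map length xs)"
    obtain t where t: "t \<le> g ?s" "halted M (tm_run M xs t)"
      using assms(4)[OF len] by blast
    have "poly ([:2, 1:] ^ c) ?s = (?s + 2) ^ c"
      by (simp add: poly_power add.commute)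
    then show ?thesis
      using run_halted[OF t(2)] t c[of ?s] by (metis order_trans)
  qed
  then show ?thesis
    using assms(1,2) unfolding poly_time_tm_def by blast
qed

lemma length_le_sum: "i < length xs \<Longrightarrow> length (xs ! i) \<le> sum_list (map length xs)"
  using member_le_sum_list[of "length (xs ! i)" "map length xs"] by simp

text \<open>Writing a 1 into cell 0 turns a blank tape into a counter with value 0.\<close>

definition marks :: "nat \<Rightarrow> nat \<Rightarrow> prog" where
  "marks a b = Act (\<lambda>j r. (if a \<le> j \<and> j < b then 1 else r, MStay))"

lemma runs_marks:
  "runs (marks (length xs) b) (init_store xs) 1
     (\<lambda>j. if length xs \<le> j \<and> j < b then counter 0 else init_store xs j)"
proof -
  have "(\<lambda>j. tape_act (init_store xs j)
      (if length xs \<le> j \<and> j < b then 1 else tape_read (init_store xs j), MStay)) =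
    (\<lambda>j. if length xs \<le> j \<and> j < b then counter 0 else init_store xs j)"
    by (auto simp: init_store_def counter_def fun_eq_iff)
  then show ?thesis
    using exec_Act[of "\<lambda>j r. (if length xs \<le> j \<and> j < b then 1 else r, MStay)" "init_store xs"]
    unfolding runs_def marks_def by auto
qed

theorem decider:
  assumes "dfn k 0 (\<lambda>xs e. of_bool (P xs))"
  obtains M where "poly_time_tm k M" "\<And>xs. length xs = k \<Longrightarrow> tm_accepts M xs \<longleftrightarrow> P xs"
proof -
  obtain B g where g: "pb g" "mono g" and P: "computes k 0 (\<lambda>xs e. of_bool (P xs)) B g"
    using assms by (rule dfnE)
  have "layout k 0 (\<lambda>_. 0) k (k + 1)"
    by (simp add: layout_def)
  with P obtain p where p: "wf_prog (k + 1 + B) p"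
    "\<And>xs e s C a. bounded k 0 xs e s \<Longrightarrow> pre k 0 (\<lambda>_. 0) k (k + 1) B xs e C a \<Longrightarrow>
       runs p C (g s) (C(k := counter (a + of_bool (P xs))))"
    by (rule computesD) blast
  define n where "n = k + 1 + B"
  define p' where "p' = Seq (marks k n) p"
  \<comment> \<open>The symbol 1 is under the head of tape \<open>k\<close> exactly if that counter
    is 0, that is, if \<open>P xs\<close> is false.\<close>
  define q where "q = Seq p' (Cond k {1} Reject (mv (\<lambda>_. MStay)))"
  have wf: "wf_prog n q"
    using p(1) by (simp add: q_def p'_def n_def marks_def)
  obtain M e where "tape_machine n q e M"
    by (rule machine_exists[OF _ wf]) (simp_all add: n_def)
  then interpret tape_machine n q e M .
  define h where "h s = g s + 10" for s
  have main: "\<exists>t\<le>h (sum_list (map length xs)). halted M (tm_run M xs t) \<and>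
      (fst (tm_run M xs t) = tm_acc M \<longleftrightarrow> P xs)" if len: "length xs = k" for xs
  proof -
    let ?s = "sum_list (map length xs)"
    let ?C = "\<lambda>j. if k \<le> j \<and> j < n then counter 0 else init_store xs j"
    have "bounded k 0 xs (\<lambda>_. 0) ?s"
      using length_le_sum[of _ xs] len by (auto simp: bounded_def)
    moreover have "pre k 0 (\<lambda>_. 0) k (k + 1) B xs (\<lambda>_. 0) ?C 0"
      using len by (auto simp: pre_def n_def init_store_def)
    ultimately have "runs p ?C (g ?s) (?C(k := counter (0 + of_bool (P xs))))"
      by (rule p(2))
    from runs_Seq[OF runs_marks[of xs n, unfolded len] this]
    obtain t where t: "t \<le> g ?s + 2" "exec p' (init_store xs) t (?C(k := counter (of_bool (P xs))))"
      unfolding runs_def p'_def by auto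
    let ?C' = "?C(k := counter (of_bool (P xs)))"
    have n: "length xs \<le> n"
      by (simp add: len n_def)
    show ?thesis
    proof (cases "P xs")
      case True
      then have "runs (Cond k {1} Reject (mv (\<lambda>_. MStay))) ?C' (1 + 1) (shift (\<lambda>_. MStay) 1 ?C')"
        by (intro runs_Cond_False runs_mv) simp
      then have "runs q (init_store xs) (1 + 1 + t + 1) (shift (\<lambda>_. MStay) 1 ?C')"
        unfolding q_def using t(2) by (intro runs_Seq[where T = t]) (auto simp: runs_def)
      then obtain t' where t': "t' \<le> 1 + 1 + t + 1" "exec q (init_store xs) t' (shift (\<lambda>_. MStay) 1 ?C')"
        unfolding runs_def by blast
      show ?thesis
        using run_exec[OF n t'(2)] halted_iff[OF special_states(1)] t'(1) t(1) True
        by (intro exI[of _ t']) (simp add: h_def M_def machine_def)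
    next
      case False
      then have "tm_run M xs (t + 2) = (e [Reject], map ?C' [0..<n])"
        by (intro run_reject[OF n q_def t(2)]) simp
      then show ?thesis
        using halted_iff[OF special_states(2)] t(1) False e_eq_iff[OF special_states(2,1)]
        by (intro exI[of _ "t + 2"]) (simp add: h_def M_def machine_def)
    qed
  qed
  show ?thesis
  proof
    show "poly_time_tm k M"
    proof (rule poly_timeI[OF wf_machine])
      show "pb h"
        unfolding h_def by (intro pb_intros g)
      show "k \<le> tm_tapes M"
        by (simp add: n_def)
      show "\<exists>t\<le>h (sum_list (map length xs)). halted M (tm_run M xs t)" if "length xs = k" for xs
        using main[OF that] by blast
    qed
    show "tm_accepts M xs \<longleftrightarrow> P xs" if "length xs = k" for xs
      using main[OF that] accepts_iff by blast
  qed
qed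

definition out :: "nat \<Rightarrow> bool \<Rightarrow> prog" where
  "out n b = Act (\<lambda>j r. if j = n then (bit_symbol b, MRight) else (r, MStay))"

lemma runs_out:
  assumes "C n = (string_content y, int (length y))"
  shows "runs (out n b) C 1 (C(n := (string_content (y @ [b]), int (length y + 1))))"
proof -
  have "string_content (y @ [b]) = (string_content y)(int (length y) := bit_symbol b)"
    by (auto simp: string_content_def fun_eq_iff nth_append)
  then have "(\<lambda>j. tape_act (C j) (if j = n then (bit_symbol b, MRight) else (tape_read (C j), MStay))) =
      C(n := (string_content (y @ [b]), int (length y + 1)))"
    using assms by (auto simp: fun_eq_iff)
  then show ?thesis
    using exec_Act[of "\<lambda>j r. if j = n then (bit_symbol b, MRight) else (r, MStay)" C]
    unfolding runs_def out_def by auto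
qed

text \<open>Tape 0 holds the input, tape 1 the number of bits still to be written, tape 2 the index
  of the next bit, tape 3 its value; scratch tapes follow. The last tape \<open>N\<close> is not
  marked as a counter, since the output has to start on a blank tape, and its head always stands
  behind the bits already written.\<close>

theorem transducer:
  assumes "dfn 1 0 (\<lambda>xs e. L (xs ! 0))" "dfn 1 1 (\<lambda>xs e. of_bool (P (xs ! 0) (e 0)))"
  shows "poly_time_computable (\<lambda>x. map (P x) [0..<L x])"
proof -
  obtain B g where g: "pb g" "mono g" and L: "computes 1 0 (\<lambda>xs e. L (xs ! 0)) B g"
    and P: "computes 1 1 (\<lambda>xs e. of_bool (P (xs ! 0) (e 0))) B g"
    using assms by (rule dfn2E)
  have "layout 1 0 (\<lambda>_. 0) 1 4"
    by (simp add: layout_def)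
  with L obtain p where p: "wf_prog (4 + B) p"
    "\<And>xs e s C a. bounded 1 0 xs e s \<Longrightarrow> pre 1 0 (\<lambda>_. 0) 1 4 B xs e C a \<Longrightarrow>
       runs p C (g s) (C(1 := counter (a + L (xs ! 0))))"
    by (rule computesD) blast
  have "layout 1 1 (\<lambda>_. 2) 3 4"
    by (simp add: layout_def)
  with P obtain q where q: "wf_prog (4 + B) q"
    "\<And>xs e s C a. bounded 1 1 xs e s \<Longrightarrow> pre 1 1 (\<lambda>_. 2) 3 4 B xs e C a \<Longrightarrow>
       runs q C (g s) (C(3 := counter (a + of_bool (P (xs ! 0) (e 0)))))"
    by (rule computesD) blast
  define N where "N = 4 + B"
  define test where "test = Cond 3 {1} (out N False) (Seq (out N True) (mv (moves {3} {})))"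
  define loop where "loop = While 1 {0} (Seq (mv (moves {1} {})) (Seq q (Seq test (mv (moves {} {2})))))"
  define r where "r = Seq (marks 1 N) (Seq p loop)"
  have bs: "bit_symbol b < 3" for b
    by (cases b) auto
  have wf: "wf_prog (N + 1) r"
    using wf_prog_mono[OF p(1), of "N + 1"] wf_prog_mono[OF q(1), of "N + 1"] bs
    by (simp add: r_def loop_def test_def N_def marks_def out_def)
  obtain M e where "tape_machine (N + 1) r e M"
    by (rule machine_exists[OF _ wf]) simp_all
  then interpret tape_machine "N + 1" r e M .
  define h where "h s = g s * (g (s + g s) + 20) + g s + 10" for s
  have main: "\<exists>t\<le>h (length x). halted M (tm_run M [x] t) \<and>
      last (snd (tm_run M [x] t)) = (string_content (map (P x) [0..<L x]), int (L x))" for x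
  proof -
    let ?s = "length x"
    let ?C = "\<lambda>j. if 1 \<le> j \<and> j < N then counter 0 else init_store [x] j"
    define Cs where "Cs i = ?C(1 := counter (L x - i), 2 := counter i,
        N := (string_content (map (P x) [0..<i]), int i))" for i
    have b: "bounded 1 0 [x] (\<lambda>_. 0) ?s"
      by (auto simp: bounded_def)
    have Ls: "L x \<le> g ?s"
      using computes_bound[OF L b] by simp
    have [simp]: "string_content [] = (\<lambda>_. 0)"
      by (simp add: string_content_def fun_eq_iff)
    have "pre 1 0 (\<lambda>_. 0) 1 4 B [x] (\<lambda>_. 0) ?C 0"
      by (auto simp: pre_def N_def init_store_def)
    from p(2)[OF b this] have "runs p ?C (g ?s) (?C(1 := counter (L x)))"
      by simp
    moreover have "?C(1 := counter (L x)) = Cs 0"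
      by (auto simp: Cs_def fun_eq_iff N_def init_store_def)
    ultimately have 1: "runs p ?C (g ?s) (Cs 0)"
      by simp
    have 2: "runs loop (Cs 0) (L x * (g (?s + g ?s) + 9 + 1) + 1) (Cs (L x))"
      unfolding loop_def
    proof (rule runs_While)
      show "tape_read (Cs (L x) 1) \<notin> {0}"
        by (simp add: Cs_def N_def)
      fix i assume i: "i < L x"
      let ?C1 = "(Cs i)(1 := counter (L x - Suc i))"
      let ?C2 = "?C1(3 := counter (of_bool (P x i)))"
      let ?C3 = "?C1(N := (string_content (map (P x) [0..<i] @ [P x i]), int (i + 1)))"
      have s1: "runs (mv (moves {1} {})) (Cs i) 1 ?C1"
        by (rule runs_mv') (use i in \<open>auto simp: Cs_def N_def shift_def counter_def fun_eq_iff of_nat_diff\<close>)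
      have "bounded 1 1 [x] (\<lambda>_. i) (?s + g ?s)"
        using i Ls by (simp add: bounded_def)
      moreover have "pre 1 1 (\<lambda>_. 2) 3 4 B [x] (\<lambda>_. i) ?C1 0"
        by (auto simp: pre_def Cs_def N_def init_store_def)
      ultimately have "runs q ?C1 (g (?s + g ?s)) (?C1(3 := counter (0 + of_bool (P ([x] ! 0) i))))"
        by (rule q(2))
      then have s2: "runs q ?C1 (g (?s + g ?s)) ?C2"
        by (simp only: add_0 nth_Cons_0)
      have N2: "?C2 N = (string_content (map (P x) [0..<i]), int (length (map (P x) [0..<i])))"
        by (simp add: Cs_def N_def)
      have s3: "runs test ?C2 4 ?C3"
      proof (cases "P x i")
        case True
        have "runs (mv (moves {3} {})) (?C2(N := (string_content (map (P x) [0..<i] @ [True]), int (i + 1)))) 1 ?C3"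
          by (rule runs_mv') (use True in \<open>auto simp: shift_def Cs_def N_def counter_def fun_eq_iff\<close>)
        then have "runs test ?C2 (1 + 1 + 1 + 1) ?C3"
          unfolding test_def using runs_out[where C = ?C2 and n = N and b = True, OF N2] True
          by (intro runs_Cond_False runs_Seq) (simp_all add: Cs_def N_def)
        then show ?thesis
          by (rule runs_mono) simp
      next
        case False
        have "?C2(N := (string_content (map (P x) [0..<i] @ [False]), int (i + 1))) = ?C3"
          by (rule ext) (simp add: Cs_def N_def False)
        then have "runs test ?C2 (1 + 1) ?C3"
          unfolding test_def using runs_out[where C = ?C2 and n = N and b = False, OF N2] False
          by (intro runs_Cond_True) (simp_all add: Cs_def N_def)
        then show ?thesis
          by (rule runs_mono) simp
      qed
      have s4: "runs (mv (moves {} {2})) ?C3 1 (Cs (Suc i))"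
        by (rule runs_mv') (auto simp: shift_def Cs_def N_def counter_def fun_eq_iff)
      have "tape_read (Cs i 1) \<in> {0}"
        using i by (simp add: Cs_def N_def)
      then show "tape_read (Cs i 1) \<in> {0} \<and>
          runs (Seq (mv (moves {1} {})) (Seq q (Seq test (mv (moves {} {2}))))) (Cs i) (g (?s + g ?s) + 9) (Cs (Suc i))"
        using runs_mono[OF runs_Seq[OF s1 runs_Seq[OF s2 runs_Seq[OF s3 s4]]], of "g (?s + g ?s) + 9"] by simp
    qed
    have "runs r (init_store [x]) (L x * (g (?s + g ?s) + 9 + 1) + 1 + g ?s + 1 + 1 + 1) (Cs (L x))"
      unfolding r_def using runs_Seq[OF runs_marks[of "[x]" N] runs_Seq[OF _ 2]] 1 by simp
    moreover have "L x * (g (?s + g ?s) + 9 + 1) \<le> g ?s * (g (?s + g ?s) + 20)"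
      using Ls by (intro mult_le_mono) simp_all
    ultimately have "runs r (init_store [x]) (h ?s) (Cs (L x))"
      unfolding h_def by (elim runs_mono) linarith
    then obtain t where t: "t \<le> h ?s" "exec r (init_store [x]) t (Cs (L x))"
      unfolding runs_def by blast
    have "tm_run M [x] t = (e [], map (Cs (L x)) [0..<N + 1])"
      by (rule run_exec[OF _ t(2)]) simp
    then show ?thesis
      using t(1) halted_iff[OF special_states(1)]
      by (intro exI[of _ t]) (simp add: Cs_def)
  qed
  have "poly_time_tm 1 M"
  proof (rule poly_timeI[OF wf_machine])
    show "pb h"
      unfolding h_def by (intro pb_intros g pb_comp[OF g(1)])
    show "\<exists>t\<le>h (sum_list (map length xs)). halted M (tm_run M xs t)" if len: "length xs = 1" for xs
    proof -
      obtain x where "xs = [x]"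
        using len by (auto simp: length_Suc_conv)
      then show ?thesis
        using main[of x] by auto
    qed
  qed simp
  moreover have "tm_outputs M [x] (map (P x) [0..<L x])" for x
  proof -
    obtain t where "halted M (tm_run M [x] t)"
      "last (snd (tm_run M [x] t)) = (string_content (map (P x) [0..<L x]), int (L x))"
      using main[of x] by blast
    then show ?thesis
      unfolding tm_outputs_def by (intro exI[of _ t]) simp
  qed
  ultimately show ?thesis
    unfolding poly_time_computable_def by blast
qed

section \<open>Binary logarithms\<close>

definition clog :: "nat \<Rightarrow> nat" where
  "clog n = nat \<lceil>log 2 (real n)\<rceil>"

lemma clog_le_iff:
  assumes "1 \<le> n"
  shows "clog n \<le> t \<longleftrightarrow> n \<le> 2 ^ t"
proof -
  have "clog n \<le> t \<longleftrightarrow> log 2 (real n) \<le> real t"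
    unfolding clog_def by (simp add: ceiling_le_iff nat_le_iff)
  also have "\<dots> \<longleftrightarrow> real n \<le> 2 powr real t"
    using assms by (simp add: log_le_iff)
  also have "\<dots> \<longleftrightarrow> n \<le> 2 ^ t"
    by (simp add: powr_realpow)
  finally show ?thesis .
qed

lemma le_pow_clog: "1 \<le> n \<Longrightarrow> n \<le> 2 ^ clog n"
  using clog_le_iff by blast

lemma pow_less_iff: "1 \<le> n \<Longrightarrow> 2 ^ j < n \<longleftrightarrow> j < clog n"
  using clog_le_iff[of n j] by (simp flip: not_le)

lemma clog_le: "1 \<le> n \<Longrightarrow> clog n \<le> n"
  using clog_le_iff less_exp less_imp_le by metis

text \<open>Powers of two are the positive numbers whose only odd divisor is 1. In this form only
  remainders and bounded quantifiers occur, which programs can evaluate, whereas exponentiation is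
  not polynomially bounded.\<close>

definition is_pow2 :: "nat \<Rightarrow> bool" where
  "is_pow2 y \<longleftrightarrow> (0 < y \<and> (\<forall>z<Suc y. y mod z = 0 \<longrightarrow> z = 1 \<or> z mod 2 = 0))"

lemma is_pow2_iff: "is_pow2 y \<longleftrightarrow> (\<exists>j. y = 2 ^ j)"
proof
  assume "\<exists>j. y = 2 ^ j"
  then obtain j where j: "y = 2 ^ j" ..
  have "z = 1 \<or> z mod 2 = 0" if "y mod z = 0" for z
  proof -
    have "z dvd 2 ^ j"
      using that j by (simp add: mod_eq_0_iff_dvd)
    then obtain i where "z = 2 ^ i"
      using divides_primepow_nat[OF two_is_prime_nat] by blast
    then show ?thesis
      by (cases i) auto
  qed
  then show "is_pow2 y"
    unfolding is_pow2_def using j by simp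
next
  show "is_pow2 y \<Longrightarrow> \<exists>j. y = 2 ^ j"
  proof (induction y rule: less_induct)
    case (less y)
    show ?case
    proof (cases "y = 1")
      case True
      then have "y = 2 ^ 0"
        by simp
      then show ?thesis ..
    next
      case False
      then have "y mod 2 = 0"
        using less.prems by (auto simp: is_pow2_def)
      then obtain y' where y': "y = 2 * y'"
        by auto
      moreover have "is_pow2 y'"
        unfolding is_pow2_def
      proof (intro conjI allI impI)
        show "0 < y'"
          using y' less.prems by (auto simp: is_pow2_def)
        fix z assume "z < Suc y'" "y' mod z = 0"
        then have "z < Suc y" "y mod z = 0"
          unfolding y' by (auto simp: mod_eq_0_iff_dvd)
        then show "z = 1 \<or> z mod 2 = 0"
          using less.prems by (auto simp: is_pow2_def)
      qed
      ultimately obtain j where "y' = 2 ^ j"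
        using less.IH[of y'] by (auto simp: is_pow2_def)
      then have "y = 2 ^ Suc j"
        using y' by simp
      then show ?thesis ..
    qed
  qed
qed

lemma pow2_below: "1 \<le> n \<Longrightarrow> {y. y < n \<and> is_pow2 y} = (\<lambda>j. 2 ^ j) ` {..<clog n}"
  using pow_less_iff by (auto simp: is_pow2_iff)

text \<open>The powers of two below \<open>n\<close> are \<open>2 ^ j\<close> for
  \<open>j < clog n\<close>. Counting them gives \<open>clog n\<close>, and adding them up gives
  \<open>2 ^ clog n - 1\<close> by the geometric series.\<close>

lemma sum_pow2_below:
  assumes "1 \<le> n"
  shows "(\<Sum>y<n. of_bool (is_pow2 y) * f y) = (\<Sum>j<clog n. f (2 ^ j) :: nat)"
proof -
  have "(\<Sum>y<n. of_bool (is_pow2 y) * f y) = (\<Sum>y | y < n \<and> is_pow2 y. f y)"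
    by (rule sum.mono_neutral_cong_right) auto
  also have "\<dots> = (\<Sum>j<clog n. f (2 ^ j))"
    unfolding pow2_below[OF assms] by (subst sum.reindex) (auto intro: inj_onI)
  finally show ?thesis .
qed

lemma clog_eq_sum: "clog n = (\<Sum>y<n. of_bool (is_pow2 y))"
proof (cases "n = 0")
  case True
  then show ?thesis by (simp add: clog_def log_def)
next
  case False
  then show ?thesis
    using sum_pow2_below[of n "\<lambda>_. 1"] by simp
qed

lemma pow_clog_eq_sum: "1 \<le> n \<Longrightarrow> 2 ^ clog n = 1 + (\<Sum>y<n. of_bool (is_pow2 y) * y)"
proof -
  have "1 + (\<Sum>j<t. 2 ^ j) = (2 :: nat) ^ t" for t
    by (induction t) auto
  then show "1 \<le> n \<Longrightarrow> ?thesis"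
    using sum_pow2_below[of n "\<lambda>y. y"] by simp
qed

lemma dfn_is_pow2:
  assumes "dfn k m A"
  shows "dfn k m (\<lambda>xs e. of_bool (is_pow2 (A xs e)))"
proof (rule dfn_comp1[OF _ assms])
  show "dfn k 1 (\<lambda>xs e. of_bool (is_pow2 (e 0)))"
    unfolding is_pow2_def by (intro dfn_intros dfn_const) simp_all
qed

lemma dfn_clog:
  assumes "dfn k m A"
  shows "dfn k m (\<lambda>xs e. clog (A xs e))"
proof (rule dfn_comp1[OF _ assms])
  show "dfn k 1 (\<lambda>xs e. clog (e 0))"
    unfolding clog_eq_sum by (intro dfn_intros dfn_is_pow2) simp_all
qed

section \<open>Broadcast graphs\<close>

lemma pair_graphI:
  assumes fin: "finite (pverts G)" and arcs: "\<And>u v. (u, v) \<in> parcs G \<Longrightarrow> u \<in> pverts G \<and> v \<in> pverts G"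
    and loops: "\<And>u. (u, u) \<notin> parcs G" and symm: "\<And>u v. (u, v) \<in> parcs G \<Longrightarrow> (v, u) \<in> parcs G"
  shows "pair_graph G"
proof
  show "finite (parcs G)"
    by (rule finite_subset[of _ "pverts G \<times> pverts G"]) (use fin arcs in auto)
  show "fst e \<in> pverts G" "snd e \<in> pverts G" if "e \<in> parcs G" for e
    using that arcs[of "fst e" "snd e"] by simp_all
  show "fst e \<noteq> snd e" if "e \<in> parcs G" for e
    using that loops[of "fst e"] by (cases e) auto
  show "symmetric (with_proj G)"
    using symm by (auto simp: symmetric_def arcs_ends_conv sym_def)
qed (rule fin)

lemma broadcast_step_idle: "broadcast_step G I I"
  unfolding broadcast_step_def by (rule exI[of _ "\<lambda>_. None"]) simp

lemma card_calls: "finite I \<Longrightarrow> card {v. \<exists>u\<in>I. c u = Some v} \<le> card I \<and> finite {v. \<exists>u\<in>I. c u = Some v}"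
proof -
  assume "finite I"
  have "{v. \<exists>u\<in>I. c u = Some v} \<subseteq> (\<lambda>u. the (c u)) ` I"
    by force
  then show ?thesis
    using \<open>finite I\<close> by (meson card_image_le card_mono finite_imageI finite_subset order_trans)
qed

lemma card_broadcast_step:
  assumes "broadcast_step G I I'" "finite I"
  shows "card I' \<le> 2 * card I \<and> finite I'"
proof -
  obtain c where c: "\<forall>u v. c u = Some v \<longrightarrow> u \<in> I \<and> (u, v) \<in> parcs G" "I' = I \<union> {v. \<exists>u. c u = Some v}"
    using assms(1) by (auto simp: broadcast_step_def)
  have "{v. \<exists>u. c u = Some v} = {v. \<exists>u\<in>I. c u = Some v}"
    using c(1) by blast
  with c(2) card_calls[OF assms(2), of c] assms(2) show ?thesis
    using card_Un_le[of I "{v. \<exists>u. c u = Some v}"] by simp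
qed

lemma card_broadcast:
  "(broadcast_step G ^^ t) I I' \<Longrightarrow> finite I \<Longrightarrow> card I' \<le> 2 ^ t * card I \<and> finite I'"
proof (induction t arbitrary: I')
  case (Suc t)
  then obtain J where "(broadcast_step G ^^ t) I J" "broadcast_step G J I'"
    by auto
  then show ?case
    using Suc.IH[of J] Suc.prems(2) card_broadcast_step[of G J I'] by fastforce
qed auto

lemma broadcast_mono_time:
  assumes "(broadcast_step G ^^ t) I I'" "t \<le> t'"
  shows "(broadcast_step G ^^ t') I I'"
  using assms(2) by (induction t' rule: dec_induct) (auto intro: assms(1) broadcast_step_idle)

text \<open>Since the number of informed vertices at most doubles, \<open>clog\<close> is a lower
  bound for every originator, and only the upper bound is a condition on the graph. The infimum is
  attained unless it is \<open>\<infinity>\<close>, so the upper bound is witnessed by a broadcast,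
  and idle steps fill it up to exactly \<open>clog\<close> steps.\<close>

lemma is_broadcast_graph_iff:
  assumes "finite (pverts G)" "pverts G \<noteq> {}"
  shows "is_broadcast_graph G \<longleftrightarrow>
    (\<forall>v\<in>pverts G. (broadcast_step G ^^ clog (card (pverts G))) {v} (pverts G))"
proof -
  let ?V = "pverts G" and ?T = "clog (card (pverts G))"
  have n: "1 \<le> card ?V"
    using assms by (simp add: Suc_leI card_gt_0_iff)
  have lower: "enat ?T \<le> broadcast_time_from G v" for v
    unfolding broadcast_time_from_def
  proof (rule Inf_greatest)
    fix x assume "x \<in> {enat t | t. (broadcast_step G ^^ t) {v} ?V}"
    then obtain t where "x = enat t" "(broadcast_step G ^^ t) {v} ?V"
      by auto
    with card_broadcast[of t G "{v}" ?V] n show "enat ?T \<le> x"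
      by (simp add: clog_le_iff)
  qed
  have upper: "broadcast_time_from G v \<le> enat ?T \<longleftrightarrow> (broadcast_step G ^^ ?T) {v} ?V" for v
  proof
    let ?S = "{enat t | t. (broadcast_step G ^^ t) {v} ?V}"
    assume le: "broadcast_time_from G v \<le> enat ?T"
    have "Inf ?S \<noteq> \<infinity>"
    proof
      assume "Inf ?S = \<infinity>"
      with le show False
        by (simp only: broadcast_time_from_def) simp
    qed
    then have "?S \<noteq> {}"
      by (metis Inf_empty top_enat_def)
    note ne = this
    have mem: "Inf A \<in> A" if "A \<noteq> {}" for A :: "enat set"
      using that LeastI_ex[of "\<lambda>x. x \<in> A"] by (auto simp: Inf_enat_def)
    have "Inf ?S \<in> ?S"
      by (rule mem[OF ne])
    then obtain t where "broadcast_time_from G v = enat t" "(broadcast_step G ^^ t) {v} ?V"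
      unfolding broadcast_time_from_def mem_Collect_eq by blast
    with le show "(broadcast_step G ^^ ?T) {v} ?V"
      using broadcast_mono_time by fastforce
  next
    assume "(broadcast_step G ^^ ?T) {v} ?V"
    then show "broadcast_time_from G v \<le> enat ?T"
      unfolding broadcast_time_from_def by (intro Inf_lower) auto
  qed
  have "is_broadcast_graph G \<longleftrightarrow> broadcast_time G \<le> enat ?T"
    using lower assms unfolding is_broadcast_graph_def broadcast_time_def clog_def[symmetric]
    by (metis Max_ge_iff antisym ex_in_conv finite_imageI image_eqI image_is_empty order_refl)
  also have "\<dots> \<longleftrightarrow> (\<forall>v\<in>?V. broadcast_time_from G v \<le> enat ?T)"
    using assms by (simp add: broadcast_time_def)
  finally show ?thesis
    using upper by simp
qed

section \<open>Adjacency strings\<close>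

lemma concat_map_upt:
  "concat (map (\<lambda>i. map (f i) [0..<n]) [0..<m]) = map (\<lambda>j. f (j div n) (j mod n)) [0..<m * n]"
proof (induction m)
  case (Suc m)
  have "map (f m) [0..<n] = map (\<lambda>j. f (j div n) (j mod n)) [m * n..<m * n + n]"
    by (rule nth_equalityI) auto
  then show ?case
    using Suc upt_add_eq_append[of 0 "m * n" n] by (simp add: add.commute)
qed simp

lemma adjacency_string_eq:
  assumes "card (pverts G) = n"
  shows "adjacency_string G = map (\<lambda>j. (j div n, j mod n) \<in> parcs G) [0..<n * n]"
  using concat_map_upt[of "\<lambda>i j. (i, j) \<in> parcs G" n n] assms by (simp add: adjacency_string_def)

definition string_graph :: "nat \<Rightarrow> bool list \<Rightarrow> nat pair_pre_digraph" where
  "string_graph n x = \<lparr>pverts = {..<n}, parcs = {(i, j). i < n \<and> j < n \<and> x ! (i * n + j)}\<rparr>"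

lemma index_less: "i < m \<Longrightarrow> j < n \<Longrightarrow> i * n + j < m * (n :: nat)"
  by (metis add.commute add_less_cancel_left less_le_trans mult.commute mult_Suc_right mult_le_mono2 Suc_leI)

lemma string_graph_adjacency_string:
  assumes "pair_graph G" "pverts G = {..<n}"
  shows "string_graph n (adjacency_string G) = G"
proof -
  interpret pair_graph G by fact
  have "(i, j) \<in> parcs G \<Longrightarrow> i < n \<and> j < n" for i j
    using in_arcsD1 in_arcsD2 assms(2) by (metis fst_conv lessThan_iff snd_conv)
  moreover have "adjacency_string G ! (i * n + j) \<longleftrightarrow> (i, j) \<in> parcs G" if "i < n" "j < n" for i j
    using that index_less[OF that] assms(2) by (simp add: adjacency_string_eq[where n = n])
  ultimately show ?thesis
    unfolding string_graph_def using assms(2) by (cases G) auto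
qed

lemma adjacency_string_string_graph:
  assumes "length x = n * n"
  shows "adjacency_string (string_graph n x) = x"
proof (rule nth_equalityI)
  have eq: "adjacency_string (string_graph n x) =
      map (\<lambda>j. (j div n, j mod n) \<in> parcs (string_graph n x)) [0..<n * n]"
    by (rule adjacency_string_eq) (simp add: string_graph_def)
  show "length (adjacency_string (string_graph n x)) = length x"
    by (simp add: eq assms)
  fix j assume "j < length (adjacency_string (string_graph n x))"
  then have j: "j < n * n"
    by (simp add: eq)
  then have "0 < n"
    by (cases n) auto
  with j show "adjacency_string (string_graph n x) ! j = x ! j"
    unfolding eq by (simp add: string_graph_def less_mult_imp_div_less)
qed

text \<open>The length of the string is the square of the number of vertices, so two graphs with the
  same string have the same vertex set, and then the string determines the arcs.\<close>

lemma adjacency_string_in_BROADCAST_GRAPH: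
  assumes "pair_graph G" "pverts G = {..<n}" "1 \<le> n"
  shows "adjacency_string G \<in> BROADCAST_GRAPH \<longleftrightarrow> is_broadcast_graph G"
proof
  assume "adjacency_string G \<in> BROADCAST_GRAPH"
  then obtain G' n' where G': "adjacency_string G = adjacency_string G'" "pair_graph G'"
    "pverts G' = {..<n'}" "is_broadcast_graph G'"
    unfolding BROADCAST_GRAPH_def by auto
  then have "length (adjacency_string G) = length (adjacency_string G')"
    by simp
  then have "n * n = n' * n'"
    using adjacency_string_eq[of G n] adjacency_string_eq[of G' n'] assms(2) G'(3) by simp
  then have "n = n'"
    by (metis power2_eq_square power2_eq_iff_nonneg zero_le)
  then show "is_broadcast_graph G"
    using G' string_graph_adjacency_string assms(1,2) by metis
qed (use assms in \<open>auto simp: BROADCAST_GRAPH_def\<close>)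

section \<open>Membership in NP\<close>

text \<open>
  The certificate lists all calls of all broadcasts: its bit with index \<open>((v n + t) n + u) n + p\<close>
  says that in step \<open>t\<close> of the broadcast from \<open>v\<close>, vertex \<open>u\<close> calls vertex \<open>p\<close>.
\<close>

definition sym_at :: "bool list \<Rightarrow> nat \<Rightarrow> bool" where
  "sym_at x j \<longleftrightarrow> string_content x (int j) = 2"

lemma sym_at_iff: "sym_at x j \<longleftrightarrow> j < length x \<and> x ! j"
  by (cases "x ! j") (auto simp: sym_at_def string_content_def)

definition informed :: "(nat \<Rightarrow> bool) \<Rightarrow> nat \<Rightarrow> nat \<Rightarrow> nat \<Rightarrow> nat \<Rightarrow> bool" where
  "informed w n v t u \<longleftrightarrow> u = v \<or> (\<exists>t'<t. \<exists>p<n. w (((v * n + t') * n + p) * n + u))"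

definition checks :: "(nat \<Rightarrow> bool) \<Rightarrow> (nat \<Rightarrow> bool) \<Rightarrow> nat \<Rightarrow> bool" where
  "checks x w n \<longleftrightarrow>
     (\<forall>i<n. \<not> x (i * n + i)) \<and> (\<forall>i<n. \<forall>j<n. x (i * n + j) \<longrightarrow> x (j * n + i)) \<and>
     (\<forall>v<n. (\<forall>t<clog n. \<forall>u<n. \<forall>p<n. w (((v * n + t) * n + u) * n + p) \<longrightarrow>
          x (u * n + p) \<and> informed w n v t u \<and> (\<forall>q<n. w (((v * n + t) * n + u) * n + q) \<longrightarrow> q = p)) \<and>
        (\<forall>u<n. informed w n v (clog n) u))"

definition verifies :: "bool list \<Rightarrow> bool list \<Rightarrow> bool" where
  "verifies x w \<longleftrightarrow> (\<exists>n<Suc (length x). 0 < n \<and> length x = n * n \<and> checks (sym_at x) (sym_at w) n)"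

lemma dfn_verifies: "dfn 2 0 (\<lambda>xs e. of_bool (verifies (xs ! 0) (xs ! 1)))"
  unfolding verifies_def checks_def informed_def sym_at_def
  by (intro dfn_intros dfn_const dfn_clog dfn_symbol dfn_length) simp_all

lemma verifies_sound:
  assumes "verifies x w"
  shows "x \<in> BROADCAST_GRAPH"
proof -
  obtain n where n: "0 < n" "length x = n * n" and ch: "checks (sym_at x) (sym_at w) n"
    using assms by (auto simp: verifies_def)
  let ?G = "string_graph n x"
  have x: "sym_at x (i * n + j) \<longleftrightarrow> x ! (i * n + j)" if "i < n" "j < n" for i j
    using index_less[OF that] n by (simp add: sym_at_iff)
  have G: "pair_graph ?G"
  proof (rule pair_graphI)
    show "(j, i) \<in> parcs ?G" if "(i, j) \<in> parcs ?G" for i j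
      using that ch x by (simp add: string_graph_def checks_def)
    show "(i, i) \<notin> parcs ?G" for i
      using ch x[of i i] by (auto simp add: string_graph_def checks_def)
  qed (auto simp: string_graph_def)
  have "is_broadcast_graph ?G"
  proof (subst is_broadcast_graph_iff)
    show "\<forall>v\<in>pverts ?G. (broadcast_step ?G ^^ clog (card (pverts ?G))) {v} (pverts ?G)"
    proof
      fix v assume "v \<in> pverts ?G"
      then have v: "v < n"
        by (simp add: string_graph_def)
      define C where "C t u p \<longleftrightarrow> sym_at w (((v * n + t) * n + u) * n + p)" for t u p
      define I where "I t = {u. u < n \<and> informed (sym_at w) n v t u}" for t
      have cv: "\<forall>t<clog n. \<forall>u<n. \<forall>p<n. C t u p \<longrightarrow> sym_at x (u * n + p) \<and>
          informed (sym_at w) n v t u \<and> (\<forall>q<n. C t u q \<longrightarrow> q = p)"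
        using ch v unfolding checks_def C_def by simp
      have C: "x ! (u * n + p)" "informed (sym_at w) n v t u" "\<And>q. q < n \<Longrightarrow> C t u q \<Longrightarrow> q = p"
        if "t < clog n" "u < n" "p < n" "C t u p" for t u p
        using cv[rule_format, OF that] x[OF that(2,3)] by simp_all
      have "broadcast_step ?G (I t) (I (Suc t))" if t: "t < clog n" for t
      proof -
        define c where "c u = (if u < n \<and> (\<exists>p<n. C t u p) then Some (SOME p. p < n \<and> C t u p) else None)" for u
        have c: "c u = Some p \<longleftrightarrow> u < n \<and> p < n \<and> C t u p" for u p
        proof
          show "c u = Some p \<Longrightarrow> u < n \<and> p < n \<and> C t u p"
            unfolding c_def using someI_ex[of "\<lambda>p. p < n \<and> C t u p"] by (auto split: if_splits)
          assume *: "u < n \<and> p < n \<and> C t u p"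
          then have "(SOME p. p < n \<and> C t u p) = p"
            using C(3)[OF t, of u p] by (intro some_equality) auto
          then show "c u = Some p"
            using * unfolding c_def by auto
        qed
        have "I (Suc t) = I t \<union> {p. \<exists>u. c u = Some p}"
          unfolding I_def c informed_def C_def by (auto simp: less_Suc_eq)
        moreover have "u \<in> I t \<and> (u, p) \<in> parcs ?G" if "c u = Some p" for u p
          using that C(1,2)[OF t, of u p] unfolding c I_def by (simp add: string_graph_def)
        ultimately show ?thesis
          unfolding broadcast_step_def by blast
      qed
      then have "(broadcast_step ?G ^^ t) (I 0) (I t)" if "t \<le> clog n" for t
        using that by (induction t) auto
      then have "(broadcast_step ?G ^^ clog n) (I 0) (I (clog n))"
        by simp
      moreover have "I 0 = {v}" "I (clog n) = {..<n}"
        using v ch unfolding I_def checks_def informed_def by auto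
      ultimately show "(broadcast_step ?G ^^ clog (card (pverts ?G))) {v} (pverts ?G)"
        by (simp add: string_graph_def)
    qed
  qed (use n in \<open>auto simp: string_graph_def\<close>)
  then show ?thesis
    using adjacency_string_in_BROADCAST_GRAPH[OF G] adjacency_string_string_graph[OF n(2)] n(1)
    by (simp add: string_graph_def)
qed

lemma verifies_complete:
  assumes "x \<in> BROADCAST_GRAPH"
  shows "\<exists>w. length w \<le> poly [:0, 0, 1:] (length x) \<and> verifies x w"
proof -
  obtain G n where G: "x = adjacency_string G" "pair_graph G" "1 \<le> n" "pverts G = {..<n}"
    "is_broadcast_graph G"
    using assms by (auto simp: BROADCAST_GRAPH_def)
  interpret pair_graph G by fact
  have len: "length x = n * n"
    using G by (simp add: adjacency_string_eq)
  have x: "sym_at x (i * n + j) \<longleftrightarrow> (i, j) \<in> parcs G" if "i < n" "j < n" for i j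
    using index_less[OF that] that G(4) len by (simp add: sym_at_iff G(1) adjacency_string_eq)
  have "(broadcast_step G ^^ clog n) {v} {..<n}" if "v < n" for v
    using G is_broadcast_graph_iff[of G] that by (auto simp: lessThan_empty_iff)
  then have "\<forall>v. \<exists>I. v < n \<longrightarrow> I 0 = {v} \<and> I (clog n) = {..<n} \<and> (\<forall>t<clog n. broadcast_step G (I t) (I (Suc t)))"
    by (auto simp: relpowp_fun_conv)
  then obtain I where I: "\<And>v. v < n \<Longrightarrow> I v 0 = {v}" "\<And>v. v < n \<Longrightarrow> I v (clog n) = {..<n}"
    "\<And>v t. v < n \<Longrightarrow> t < clog n \<Longrightarrow> broadcast_step G (I v t) (I v (Suc t))"
    by metis
  define good where "good v t c \<longleftrightarrow> (\<forall>u p. c u = Some p \<longrightarrow> u \<in> I v t \<and> (u, p) \<in> parcs G) \<and>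
      I v (Suc t) = I v t \<union> {p. \<exists>u. c u = Some p}" for v t c
  define c where "c v t = (SOME c. good v t c)" for v t
  have good: "good v t (c v t)" if "v < n" "t < clog n" for v t
  proof -
    have "\<exists>c. good v t c"
      using I(3)[OF that] unfolding broadcast_step_def good_def by simp
    then show ?thesis
      unfolding c_def by (rule someI_ex)
  qed
  have c: "\<And>v t u p. v < n \<Longrightarrow> t < clog n \<Longrightarrow> c v t u = Some p \<Longrightarrow> u \<in> I v t \<and> (u, p) \<in> parcs G"
    "\<And>v t. v < n \<Longrightarrow> t < clog n \<Longrightarrow> I v (Suc t) = I v t \<union> {p. \<exists>u. c v t u = Some p}"
    using good unfolding good_def by simp_all
  \<comment> \<open>The four digits of an index to base \<open>n\<close> are originator, step,
    caller and callee; a step number is a digit because \<open>clog n \<le> n\<close>. The length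
    \<open>n ^ 4\<close> is the square of the input length, whence the polynomial
    \<open>[:0, 0, 1:]\<close>.\<close>
  define w where "w = map (\<lambda>j. let a = j div n; b = a div n in c (b div n) (b mod n) (a mod n) = Some (j mod n)) [0..<n * n * n * n]"
  have w: "sym_at w (((v * n + t) * n + u) * n + p) \<longleftrightarrow> c v t u = Some p"
    if "v < n" "t < n" "u < n" "p < n" for v t u p
    using that index_less[OF index_less[OF index_less[OF that(1,2)] that(3)] that(4)]
    by (simp add: sym_at_iff w_def Let_def)
  have arc: "u < n \<and> p < n" if "(u, p) \<in> parcs G" for u p
    using that in_arcsD1 in_arcsD2 G(4) by (metis fst_conv lessThan_iff snd_conv)
  have T: "clog n \<le> n"
    using clog_le G(3) by simp
  have inf: "informed (sym_at w) n v t u \<longleftrightarrow> u \<in> I v t" if v: "v < n" and "t \<le> clog n" "u < n" for v t u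
    using that(2,3)
  proof (induction t arbitrary: u)
    case 0
    then show ?case using I(1)[OF v] by (simp add: informed_def)
  next
    case (Suc t)
    have "informed (sym_at w) n v (Suc t) u \<longleftrightarrow> informed (sym_at w) n v t u \<or> (\<exists>p<n. c v t p = Some u)"
      using w[OF v, of t _ u] Suc.prems T unfolding informed_def by (auto simp: less_Suc_eq)
    moreover have "(\<exists>p<n. c v t p = Some u) \<longleftrightarrow> (\<exists>p. c v t p = Some u)"
      using c(1)[OF v, of t] arc Suc.prems by (metis Suc_le_lessD)
    ultimately show ?case
      using Suc c(2)[OF v, of t] by auto
  qed
  have "checks (sym_at x) (sym_at w) n"
    unfolding checks_def
  proof (intro conjI allI impI)
    show "\<not> sym_at x (i * n + i)" if "i < n" for i
      using x[OF that that] no_loops[of "(i, i)"] by auto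
    show "sym_at x (j * n + i)" if "i < n" "j < n" "sym_at x (i * n + j)" for i j
      using x that arcs_symmetric by auto
  next
    fix v t u p assume *: "v < n" "t < clog n" "u < n" "p < n" "sym_at w (((v * n + t) * n + u) * n + p)"
    then have t: "t < n" and cc: "c v t u = Some p"
      using T w by auto
    show "sym_at x (u * n + p)" "informed (sym_at w) n v t u"
      using c(1)[OF *(1,2) cc] x inf * by auto
    show "q = p" if "q < n" "sym_at w (((v * n + t) * n + u) * n + q)" for q
      using w[OF *(1) t *(3)] that cc by simp
  next
    fix v u assume "v < n" "u < n"
    then show "informed (sym_at w) n v (clog n) u"
      using inf I(2) by simp
  qed
  then have "verifies x w"
    unfolding verifies_def using G(3) len le_square[of n] by (intro exI[of _ n]) (auto simp: less_Suc_eq_le)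
  moreover have "length w \<le> poly [:0, 0, 1:] (length x)"
    by (simp add: w_def len mult.assoc)
  ultimately show ?thesis
    by blast
qed

theorem BROADCAST_GRAPH_in_NP: "BROADCAST_GRAPH \<in> NP"
proof -
  obtain M where M: "poly_time_tm 2 M" "\<And>xs. length xs = 2 \<Longrightarrow> tm_accepts M xs \<longleftrightarrow> verifies (xs ! 0) (xs ! 1)"
    using decider[OF dfn_verifies] by blast
  have "x \<in> BROADCAST_GRAPH \<longleftrightarrow> (\<exists>w. length w \<le> poly [:0, 0, 1:] (length x) \<and> tm_accepts M [x, w])" for x
    using verifies_sound verifies_complete[of x] M(2)[of "[x, _]"] by auto
  then show ?thesis
    unfolding NP_def using M(1) by blast
qed

section \<open>Perfect broadcasts\<close>

text \<open>
  A broadcast in which the number of informed vertices doubles in every step: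
  \<open>J t\<close> is the set of informed vertices, and each \<open>u \<in> J t\<close> calls the new vertex \<open>f t u\<close>.
\<close>

locale perfect_broadcast =
  fixes E :: "('a \<times> 'a) set" and K :: nat and J :: "nat \<Rightarrow> 'a set" and f :: "nat \<Rightarrow> 'a \<Rightarrow> 'a" and a :: 'a
  assumes J_0: "J 0 = {a}"
    and f_inj: "t < K \<Longrightarrow> inj_on (f t) (J t)"
    and f_new: "t < K \<Longrightarrow> u \<in> J t \<Longrightarrow> f t u \<notin> J t"
    and J_Suc: "t < K \<Longrightarrow> J (Suc t) = J t \<union> f t ` J t"
    and f_arc: "t < K \<Longrightarrow> u \<in> J t \<Longrightarrow> (u, f t u) \<in> E"
    and E_sym: "(u, v) \<in> E \<Longrightarrow> (v, u) \<in> E"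
begin

lemma J_mono: "t \<le> t' \<Longrightarrow> t' \<le> K \<Longrightarrow> J t \<subseteq> J t'"
  by (induction t' rule: dec_induct) (auto simp: J_Suc)

lemma finite_J: "t \<le> K \<Longrightarrow> finite (J t)"
  by (induction t) (auto simp: J_0 J_Suc)

lemma f_in: "t < K \<Longrightarrow> u \<in> J t \<Longrightarrow> f t u \<in> J (Suc t)"
  by (simp add: J_Suc)

lemma called_once:
  assumes "t < K" "t' < K" "u \<in> J t" "u' \<in> J t'" "f t u = f t' u'"
  shows "t = t' \<and> u = u'"
proof -
  have False if "s < s'" "s' < K" "v \<in> J s" "v' \<in> J s'" "f s v = f s' v'" for s s' v v'
    using that J_mono[of "Suc s" s'] f_in[of s v] f_new[of s' v'] by auto
  then have "t = t'"
    using assms by (metis linorder_neqE_nat)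
  then show ?thesis
    using f_inj assms by (auto dest: inj_onD)
qed

lemma caller:
  assumes "v \<in> J t'" "v \<notin> J t" "t \<le> t'" "t' \<le> K"
  obtains s u where "t \<le> s" "s < t'" "u \<in> J s" "f s u = v"
proof -
  have "\<exists>s u. t \<le> s \<and> s < t' \<and> u \<in> J s \<and> f s u = v"
    using assms(3,1,4)
  proof (induction t' rule: dec_induct)
    case base
    then show ?case
      using assms(2) by simp
  next
    case (step n)
    then consider "v \<in> J n" | u where "u \<in> J n" "f n u = v"
      using J_Suc[of n] by auto
    then show ?case
    proof cases
      case 1
      then show ?thesis
        using step.IH step.prems by (meson Suc_leD less_SucI)
    next
      case 2
      then show ?thesis
        using step.hyps by blast
    qed
  qed
  then show ?thesis
    using that by blast
qed

lemma card_J: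
  assumes "t \<le> K"
  shows "card (J t) = 2 ^ t"
  using assms
proof (induction t)
  case (Suc t)
  have "card (J (Suc t)) = card (J t) + card (f t ` J t)"
    using Suc.prems finite_J[of t] f_new[of t] by (subst J_Suc) (auto intro!: card_Un_disjoint)
  then show ?case
    using Suc f_inj[of t] by (simp add: card_image)
qed (simp add: J_0)

text \<open>In a perfect broadcast \<open>v\<close> calls a new vertex in each of the
  \<open>K - t\<close> remaining steps, and its own caller is yet another neighbour. Only the
  originator has no caller.\<close>

lemma degree:
  assumes "v \<in> J t" "t \<le> K" "v \<noteq> a" "finite {u. (v, u) \<in> E}"
  shows "K - t + 1 \<le> card {u. (v, u) \<in> E}"
proof -
  obtain s u where u: "s < t" "u \<in> J s" "f s u = v"
    using caller[of v t 0] assms J_0 by auto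
  have v: "v \<in> J r" if "r \<in> {t..<K}" for r
    using J_mono[of t r] that assms(1) by auto
  have "inj_on (\<lambda>r. f r v) {t..<K}"
  proof (rule inj_onI)
    fix r r' assume "r \<in> {t..<K}" "r' \<in> {t..<K}" "f r v = f r' v"
    then show "r = r'"
      using called_once[of r r' v v] v by simp
  qed
  then have "card ((\<lambda>r. f r v) ` {t..<K}) = K - t"
    by (simp add: card_image)
  moreover have "u \<notin> (\<lambda>r. f r v) ` {t..<K}"
  proof
    assume "u \<in> (\<lambda>r. f r v) ` {t..<K}"
    then obtain r where r: "t \<le> r" "r < K" "u = f r v"
      by auto
    then have "u \<in> J r"
      using J_mono[of s r] u by auto
    then show False
      using f_new[of r v] v[of r] r by simp
  qed
  ultimately have "card (insert u ((\<lambda>r. f r v) ` {t..<K})) = K - t + 1"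
    by simp
  moreover have "insert u ((\<lambda>r. f r v) ` {t..<K}) \<subseteq> {u. (v, u) \<in> E}"
    using f_arc v E_sym[OF f_arc[of s u]] u assms(2) by auto
  ultimately show ?thesis
    using card_mono[OF assms(4)] by metis
qed

text \<open>From step \<open>t0\<close> on, members of \<open>Q\<close> are called only by members
  of \<open>Q\<close>, so the informed part of \<open>Q\<close> at most doubles per step. If its
  final size requires doubling in every step, then no member can afford a call that leaves
  \<open>Q\<close> (\<open>closed_out\<close>).\<close>

context
  fixes Q :: "'a set" and t0 :: nat
  assumes t0: "t0 \<le> K"
    and closed: "\<And>s u. t0 \<le> s \<Longrightarrow> s < K \<Longrightarrow> u \<in> J s \<Longrightarrow> f s u \<in> Q \<Longrightarrow> u \<in> Q"
begin

lemma card_step: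
  assumes "t0 \<le> t" "t < K"
  shows "card (J (Suc t) \<inter> Q) = card (J t \<inter> Q) + card {u \<in> J t \<inter> Q. f t u \<in> Q}"
proof -
  have "J (Suc t) \<inter> Q = (J t \<inter> Q) \<union> f t ` {u \<in> J t \<inter> Q. f t u \<in> Q}"
    using J_Suc[OF assms(2)] closed[OF assms] by auto
  moreover have "(J t \<inter> Q) \<inter> f t ` {u \<in> J t \<inter> Q. f t u \<in> Q} = {}"
    using f_new[OF assms(2)] by auto
  moreover have "card (f t ` {u \<in> J t \<inter> Q. f t u \<in> Q}) = card {u \<in> J t \<inter> Q. f t u \<in> Q}"
    by (rule card_image) (rule inj_on_subset[OF f_inj[OF assms(2)]], auto)
  ultimately show ?thesis
    using finite_J[of t] assms by (simp add: card_Un_disjoint)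
qed

lemma card_step_le: "t0 \<le> t \<Longrightarrow> t < K \<Longrightarrow> card (J (Suc t) \<inter> Q) \<le> 2 * card (J t \<inter> Q)"
  using card_step[of t] card_mono[of "J t \<inter> Q" "{u \<in> J t \<inter> Q. f t u \<in> Q}"] finite_J[of t] by auto

lemma card_closed:
  assumes "t0 \<le> t" "t \<le> t'" "t' \<le> K"
  shows "card (J t' \<inter> Q) \<le> 2 ^ (t' - t) * card (J t \<inter> Q)"
  using assms(2,3)
proof (induction t' rule: dec_induct)
  case (step n)
  then have "card (J (Suc n) \<inter> Q) \<le> 2 * card (J n \<inter> Q)"
    using assms(1) by (intro card_step_le) auto
  also have "\<dots> \<le> 2 * (2 ^ (n - t) * card (J t \<inter> Q))"
    using step by simp
  finally show ?case
    using step(1) by (simp add: Suc_diff_le)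
qed simp

lemma closed_out:
  assumes "2 ^ (K - t0) * card (J t0 \<inter> Q) \<le> card (J K \<inter> Q)"
    and "t0 \<le> s" "s < K" "u \<in> J s" "u \<in> Q"
  shows "f s u \<in> Q"
proof (rule ccontr)
  assume "f s u \<notin> Q"
  then have "{u \<in> J s \<inter> Q. f s u \<in> Q} \<subset> J s \<inter> Q"
    using assms by auto
  then have "card {u \<in> J s \<inter> Q. f s u \<in> Q} < card (J s \<inter> Q)"
    using finite_J[of s] assms by (intro psubset_card_mono) auto
  then have less: "card (J (Suc s) \<inter> Q) < 2 * card (J s \<inter> Q)"
    using card_step[of s] assms by simp
  have "card (J K \<inter> Q) \<le> 2 ^ (K - Suc s) * card (J (Suc s) \<inter> Q)"
    using card_closed[of "Suc s" K] assms by simp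
  also have "\<dots> < 2 ^ (K - Suc s) * (2 * card (J s \<inter> Q))"
    using less by simp
  also have "\<dots> \<le> 2 ^ (K - Suc s) * (2 * (2 ^ (s - t0) * card (J t0 \<inter> Q)))"
    using card_closed[of t0 s] assms by simp
  also have "\<dots> = 2 ^ (K - Suc s + 1 + (s - t0)) * card (J t0 \<inter> Q)"
    by (simp add: power_add)
  also have "K - Suc s + 1 + (s - t0) = K - t0"
    using assms by simp
  finally show False
    using assms(1) by simp
qed

lemma card_closed_eq:
  assumes "\<And>s u. t0 \<le> s \<Longrightarrow> s < K \<Longrightarrow> u \<in> J s \<Longrightarrow> u \<in> Q \<Longrightarrow> f s u \<in> Q"
  shows "card (J K \<inter> Q) = 2 ^ (K - t0) * card (J t0 \<inter> Q)"
  using t0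
proof (induction rule: inc_induct)
  case (step n)
  have "{u \<in> J n \<inter> Q. f n u \<in> Q} = J n \<inter> Q"
    using assms step by auto
  then have "card (J (Suc n) \<inter> Q) = 2 * card (J n \<inter> Q)"
    using card_step[of n] step by simp
  then show ?case
    using step by (simp add: Suc_diff_Suc[symmetric] del: Suc_diff_Suc)
qed simp

end

text \<open>
  A set \<open>B\<close> of \<open>2 ^ j\<close> vertices that can be entered only at \<open>q\<close>, from \<open>h\<close>, must be entered
  exactly \<open>j\<close> steps before the last one: all later calls of its vertices stay inside.
\<close>

lemma block:
  assumes "t0 \<le> K" "card B = 2 ^ j" "q \<in> B" "h \<notin> B" "B \<inter> J t0 = {}" "B \<subseteq> J K"
    and hubs: "X \<subseteq> J t0" "\<And>s u. t0 \<le> s \<Longrightarrow> s < K \<Longrightarrow> u \<in> X \<Longrightarrow> f s u \<notin> B"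
    and nbr: "\<And>u v. v \<in> B \<Longrightarrow> (u, v) \<in> E \<Longrightarrow> u \<in> B \<or> u \<in> X \<or> (u = h \<and> v = q)"
  obtains s where "t0 \<le> s" "s + 1 + j = K" "h \<in> J s" "f s h = q"
proof -
  have "q \<in> J K" "q \<notin> J t0"
    using assms by auto
  then obtain s u where s: "t0 \<le> s" "s < K" "u \<in> J s" "f s u = q"
    using caller[OF _ _ assms(1) order_refl] by blast
  have entry: "u' = h \<and> f t u' = q" if "t0 \<le> t" "t < K" "u' \<in> J t" "f t u' \<in> B" "u' \<notin> B" for t u'
    using nbr[OF that(4) f_arc[OF that(2,3)]] hubs(2) that by auto
  have empty: "B \<inter> J t = {}" if "t0 \<le> t" "t \<le> s" for t
    using that
  proof (induction t rule: dec_induct)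
    case (step t)
    then have "B \<inter> J t = {}"
      by simp
    moreover have "f t u' \<notin> B" if u': "u' \<in> J t" for u'
    proof
      assume B: "f t u' \<in> B"
      have "f t u' = q"
        using entry[of t u'] step u' B s \<open>B \<inter> J t = {}\<close> by auto
      then show False
        using called_once[of t s u' u] s step u' by auto
    qed
    ultimately show ?case
      using J_Suc[of t] step s by auto
  qed (use assms in auto)
  have u: "u = h"
    using entry[of s u] s assms(3) empty[of s] by auto
  have first: "J (Suc s) \<inter> B = {q}"
  proof
    show "J (Suc s) \<inter> B \<subseteq> {q}"
    proof
      fix v assume v: "v \<in> J (Suc s) \<inter> B"
      then obtain u' where "u' \<in> J s" "f s u' = v"
        using J_Suc[of s] s empty[of s] by auto
      then show "v \<in> {q}"
        using entry[of s u'] v s empty[of s] by auto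
    qed
    show "{q} \<subseteq> J (Suc s) \<inter> B"
      using f_in[of s u] s assms(3) by auto
  qed
  have "card (J K \<inter> B) = 2 ^ (K - Suc s) * card (J (Suc s) \<inter> B)"
  proof (rule card_closed_eq)
    fix t v assume t: "Suc s \<le> t" "t < K" "v \<in> J t"
    show "v \<in> B" if "f t v \<in> B"
    proof (rule ccontr)
      assume "v \<notin> B"
      then have "f t v = q"
        using entry[of t v] t s that by auto
      then show False
        using called_once[of t s v u] t s by auto
    qed
    \<comment> \<open>Calls go to uninformed vertices, while \<open>h\<close> and \<open>X\<close>,
      the only neighbours of \<open>B\<close> outside \<open>B\<close>, are informed by now.\<close>
    show "f t v \<in> B" if "v \<in> B"
    proof -
      have "J t0 \<subseteq> J t" "J s \<subseteq> J t"
        using J_mono t s by auto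
      then have "f t v \<notin> X" "f t v \<noteq> h"
        using f_new[of t v] t hubs(1) s u by auto
      then show ?thesis
        using nbr[OF that E_sym[OF f_arc[OF t(2,3)]]] by auto
    qed
  qed (use s in auto)
  then have "card B = 2 ^ (K - Suc s)"
    using first Int_absorb1[OF assms(6)] by simp
  then have "K - Suc s = j"
    using assms(2) by simp
  then show ?thesis
    using that[of s] s u by auto
qed

end

text \<open>
  An originator \<open>p\<close> of degree 1 wastes all steps but the first, so a broadcast from \<open>p\<close> to
  \<open>2 ^ K + 1\<close> vertices in \<open>K + 1\<close> steps is perfect on the remaining vertices.
\<close>

lemma pendant_broadcast:
  fixes G :: "'a pair_pre_digraph"
  assumes "finite (pverts G)" "card (pverts G) = 2 ^ K + 1" "p \<in> pverts G"
    and arcs: "\<And>u v. (u, v) \<in> parcs G \<Longrightarrow> u \<in> pverts G \<and> v \<in> pverts G \<and> (v, u) \<in> parcs G"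
    and p: "\<And>v. (p, v) \<in> parcs G \<Longrightarrow> v = a" and "a \<noteq> p"
    and bc: "(broadcast_step G ^^ (K + 1)) {p} (pverts G)"
  obtains J f where "perfect_broadcast (parcs G) K J f a" "J K = pverts G - {p}"
proof -
  let ?V = "pverts G"
  obtain I where I: "I 0 = {p}" "I (K + 1) = ?V" "\<And>t. t < K + 1 \<Longrightarrow> broadcast_step G (I t) (I (Suc t))"
    using bc unfolding relpowp_fun_conv by auto
  define good where "good t c \<longleftrightarrow> (\<forall>u v. c u = Some v \<longrightarrow> u \<in> I t \<and> (u, v) \<in> parcs G) \<and>
      I (Suc t) = I t \<union> {v. \<exists>u. c u = Some v}" for t c
  define c where "c t = (SOME c. good t c)" for t
  have good: "good t (c t)" if "t < K + 1" for t
  proof -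
    have "\<exists>c. good t c"
      using I(3)[OF that] unfolding broadcast_step_def good_def by simp
    then show ?thesis
      unfolding c_def by (rule someI_ex)
  qed
  have c: "u \<in> I t" "(u, v) \<in> parcs G" if "t < K + 1" "c t u = Some v" for t u v
    using good that unfolding good_def by auto
  have I_Suc: "I (Suc t) = I t \<union> {v. \<exists>u. c t u = Some v}" if "t < K + 1" for t
    using good[OF that] unfolding good_def by auto
  have I_mono: "I t \<subseteq> I t'" if "t \<le> t'" "t' \<le> K + 1" for t t'
    using that by (induction t' rule: dec_induct) (auto simp: I_Suc)
  have fin: "finite (I t)" if "t \<le> K + 1" for t
    using I_mono[OF that order_refl] assms(1) I(2) finite_subset by auto
  define w where "w t = card (I t - {p})" for t
  have calls: "I (Suc t) - {p} \<subseteq> (I t - {p}) \<union> {v. \<exists>u\<in>I t - {p}. c t u = Some v} \<union> {a}" if "t < K + 1" for t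
    using I_Suc[OF that] c[OF that] p by auto
  have started: "I t = {p} \<or> a \<in> I t" if "t \<le> K + 1" for t
    using that
  proof (induction t)
    case (Suc t)
    then have "I t = {p} \<Longrightarrow> I (Suc t) \<subseteq> {p, a}"
      using calls[of t] by auto
    moreover have "I t \<subseteq> I (Suc t)" "p \<in> I (Suc t)"
      using I_mono Suc.prems I(1) by auto
    ultimately show ?case
      using Suc by auto
  qed (use I(1) in auto)
  have double: "w (Suc t) \<le> 2 * w t" if "t < K + 1" "a \<in> I t" for t
  proof -
    let ?N = "{v. \<exists>u\<in>I t - {p}. c t u = Some v}"
    have f: "finite (I t - {p})"
      using fin[of t] that by auto
    have "I (Suc t) - {p} \<subseteq> (I t - {p}) \<union> ?N"
      using calls[OF that(1)] that(2) assms(6) by auto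
    then have "w (Suc t) \<le> card ((I t - {p}) \<union> ?N)"
      unfolding w_def using f card_calls[OF f, of "c t"] by (intro card_mono) auto
    also have "\<dots> \<le> w t + card ?N"
      unfolding w_def by (rule card_Un_le)
    finally show ?thesis
      using card_calls[OF f, of "c t"] by (simp add: w_def)
  qed
  have first: "w (Suc t) \<le> 1" if "t < K + 1" "I t = {p}" for t
  proof -
    have "I (Suc t) - {p} \<subseteq> {a}"
      using calls[OF that(1)] that(2) by auto
    then show ?thesis
      unfolding w_def using card_mono[of "{a}"] by fastforce
  qed
  have w_end: "w (K + 1) = 2 ^ K"
    unfolding w_def I(2) using assms(1-3) by simp
  \<comment> \<open>A first step without a call to \<open>a\<close> would cost one doubling: at most
    \<open>2 ^ (K - 1)\<close> vertices besides \<open>p\<close> could be informed in the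
    end.\<close>
  have a1: "a \<in> I 1"
  proof (rule ccontr)
    assume "a \<notin> I 1"
    then have I1: "I 1 = {p}"
      using started[of 1] by simp
    have "w (t + 2) \<le> 2 ^ t" if "t + 2 \<le> K + 1" for t
      using that
    proof (induction t)
      case 0
      then show ?case
        using first[of 1] I1 by (simp add: numeral_2_eq_2)
    next
      case (Suc t)
      then have t: "t + 2 < K + 1" and IH: "w (t + 2) \<le> 2 ^ t"
        by simp_all
      have "w (Suc (t + 2)) \<le> 2 ^ Suc t"
      proof (cases "a \<in> I (t + 2)")
        case True
        then show ?thesis
          using double[OF t True] IH by simp
      next
        case False
        then have "w (Suc (t + 2)) \<le> 1"
          using started[of "t + 2"] first[OF t] t by simp
        then show ?thesis
          by (rule order_trans) simp
      qed
      then show ?case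
        by simp
    qed
    then have "K \<noteq> 0 \<Longrightarrow> w (K + 1) \<le> 2 ^ (K - 1)"
      by (metis Suc_diff_1 Suc_eq_plus1 add_2_eq_Suc' neq0_conv order_refl)
    moreover have "K \<noteq> 0 \<Longrightarrow> (2 :: nat) ^ (K - 1) < 2 ^ K"
      by simp
    moreover have "w 1 = 0"
      using I1 by (simp add: w_def)
    ultimately show False
      using w_end by (cases "K = 0") auto
  qed
  then have a: "a \<in> I (Suc t)" if "t \<le> K" for t
    using I_mono[of 1 "Suc t"] that by auto
  have upper: "w (Suc t) \<le> 2 ^ t" if "t \<le> K" for t
    using that
  proof (induction t)
    case 0
    then show ?case
      using first[of 0] I(1) by simp
  next
    case (Suc t)
    then show ?case
      using double[of "Suc t"] a[of t] by simp
  qed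
  \<comment> \<open>Backwards from the last step: as the count at most doubles, falling behind at
    any time could not be made up for.\<close>
  have lower: "2 ^ K \<le> 2 ^ (K - t) * w (Suc t)" if "t \<le> K" for t
    using that
  proof (induction rule: inc_induct)
    case base
    then show ?case
      using w_end by simp
  next
    case (step t)
    have "w (Suc (Suc t)) \<le> 2 * w (Suc t)"
      using double[of "Suc t"] a[of t] step by simp
    then have "2 ^ (K - Suc t) * w (Suc (Suc t)) \<le> 2 ^ (K - Suc t) * (2 * w (Suc t))"
      by (intro mult_le_mono) simp_all
    also have "\<dots> = 2 ^ (K - t) * w (Suc t)"
      using step(2) by (simp flip: Suc_diff_Suc)
    finally show ?case
      using step by simp
  qed
  have w: "w (Suc t) = 2 ^ t" if "t \<le> K" for t
  proof (rule antisym[OF upper[OF that]])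
    have "2 ^ (K - t) * (2 :: nat) ^ t = 2 ^ K"
      using that by (simp flip: power_add)
    then have "2 ^ (K - t) * 2 ^ t \<le> 2 ^ (K - t) * w (Suc t)"
      using lower[OF that] by simp
    then show "2 ^ t \<le> w (Suc t)"
      by simp
  qed
  define J where "J t = I (Suc t) - {p}" for t
  define f where "f t u = the (c (Suc t) u)" for t u
  have card_J: "card (J t) = 2 ^ t" if "t \<le> K" for t
    using w[OF that] by (simp add: w_def J_def)
  have fin_J: "finite (J t)" if "t \<le> K" for t
    using fin[of "Suc t"] that by (simp add: J_def)
  \<comment> \<open>There are as many new vertices as informed ones and each new vertex uses up a
    caller, so all informed vertices call and their callees are new and distinct.\<close>
  have step: "inj_on (f t) (J t) \<and> (\<forall>u\<in>J t. f t u \<notin> J t \<and> (u, f t u) \<in> parcs G) \<and> J (Suc t) = J t \<union> f t ` J t"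
    if t: "t < K" for t
  proof -
    let ?N = "J (Suc t) - J t"
    let ?D = "{u \<in> J t. \<exists>v\<in>?N. c (Suc t) u = Some v}"
    have sub: "J t \<subseteq> J (Suc t)"
      unfolding J_def using I_mono[of "Suc t" "Suc (Suc t)"] t by auto
    have "?N \<subseteq> f t ` ?D"
    proof
      fix v assume v: "v \<in> ?N"
      have "v \<noteq> a"
        using v a[of t] t assms(6) by (auto simp: J_def)
      then obtain u where "u \<in> J t" "c (Suc t) u = Some v"
        using calls[of "Suc t"] t v unfolding J_def by auto
      then show "v \<in> f t ` ?D"
        using v by (intro image_eqI[of _ _ u]) (auto simp: f_def)
    qed
    moreover have "f t ` ?D \<subseteq> ?N"
      by (auto simp: f_def)
    ultimately have N: "?N = f t ` ?D"
      by auto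
    have card_N: "card ?N = card (J t)"
      using card_Diff_subset[OF _ sub] fin_J[of t] card_J t by simp
    have fin_D: "finite ?D"
      by (rule finite_subset[OF _ fin_J[of t]]) (use t in auto)
    have "card (f t ` ?D) \<le> card ?D"
      by (rule card_image_le[OF fin_D])
    then have "card (J t) \<le> card ?D"
      using arg_cong[OF N, of card] card_N by linarith
    moreover have "card ?D \<le> card (J t)"
      by (rule card_mono) (use fin_J[of t] t in auto)
    ultimately have D: "?D = J t"
      by (intro card_subset_eq) (use fin_J[of t] t in auto)
    have N': "?N = f t ` J t"
      by (rule N[unfolded D])
    have "card (f t ` J t) = card (J t)"
      using card_N arg_cong[OF N', of card] by linarith
    then have "inj_on (f t) (J t)"
      using fin_J[of t] t by (intro eq_card_imp_inj_on) auto
    moreover have "f t u \<notin> J t \<and> (u, f t u) \<in> parcs G" if "u \<in> J t" for u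
    proof -
      have "u \<in> ?D"
        using that D by blast
      then obtain v where "v \<in> ?N" "c (Suc t) u = Some v"
        by auto
      then show ?thesis
        using c[of "Suc t" u v] t by (simp add: f_def)
    qed
    ultimately show ?thesis
      using N' sub by auto
  qed
  have "card (J 0) = 1" "a \<in> J 0"
    using card_J[of 0] a[of 0] assms(6) by (auto simp: J_def)
  then have "J 0 = {a}"
    by (auto simp: card_1_singleton_iff)
  then have "perfect_broadcast (parcs G) K J f a"
    using step arcs by unfold_locales auto
  moreover have "J K = ?V - {p}"
    using I(2) by (simp add: J_def)
  ultimately show ?thesis
    by (rule that)
qed

section \<open>The gadget graph\<close>

datatype vertex = Pendant | Cell nat nat nat | Extra nat nat

section \<open>Offsets and binomial trees\<close>

fun off :: "vertex \<Rightarrow> nat" where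
  "off Pendant = 0"
| "off (Cell i k x) = x"
| "off (Extra j x) = x"

definition core :: "vertex \<Rightarrow> bool" where
  "core v \<longleftrightarrow> v \<noteq> Pendant \<and> off v = 0"

lemma core_simps [simp]: "\<not> core Pendant" "core (Cell i k x) \<longleftrightarrow> x = 0" "core (Extra j x) \<longleftrightarrow> x = 0"
  by (auto simp: core_def)

text \<open>The binomial tree on the offsets below \<open>2 ^ d\<close>: the parent of
  \<open>y\<close> is \<open>y\<close> with its lowest set bit cleared. The subtree of an offset
  with lowest set bit \<open>b\<close> is the interval of \<open>2 ^ b\<close> offsets that starts
  there, and a tree edge that adds \<open>2 ^ b\<close> belongs to the step in which
  \<open>b\<close> further steps remain.\<close>

definition tree :: "nat \<Rightarrow> nat \<Rightarrow> nat \<Rightarrow> bool" where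
  "tree d x y \<longleftrightarrow> (\<exists>b<d. 2 ^ Suc b dvd x \<and> y = x + 2 ^ b)"

definition low :: "nat \<Rightarrow> nat \<Rightarrow> bool" where
  "low x j \<longleftrightarrow> 2 ^ j dvd x \<and> \<not> 2 ^ Suc j dvd x"

lemma low_unique: "low x j \<Longrightarrow> low x j' \<Longrightarrow> j = j'"
  unfolding low_def by (metis Suc_leI linorder_neqE_nat power_le_dvd)

lemma low_exists:
  assumes "0 < x"
  obtains j where "low x j"
proof -
  have "\<not> 2 ^ Suc x dvd x"
    using assms less_exp[of x] by (metis Suc_lessD dvd_imp_le less_exp not_le)
  then have "\<exists>j. \<not> 2 ^ Suc j dvd x"
    by blast
  define j where "j = (LEAST j. \<not> 2 ^ Suc j dvd x)"
  have "\<not> 2 ^ Suc j dvd x"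
    unfolding j_def using \<open>\<exists>j. \<not> 2 ^ Suc j dvd x\<close> by (rule LeastI_ex)
  moreover have "2 ^ j dvd x"
  proof (cases j)
    case (Suc i)
    then show ?thesis
      using not_less_Least[of i "\<lambda>j. \<not> 2 ^ Suc j dvd x"] by (fold j_def) auto
  qed simp
  ultimately show ?thesis
    using that by (auto simp: low_def)
qed

lemma low_add:
  assumes "2 ^ Suc b dvd x"
  shows "low (x + 2 ^ b) b"
proof -
  have "2 ^ b dvd x"
    using assms by (metis dvd_trans le_SucI order_refl le_imp_power_dvd)
  moreover have "\<not> 2 ^ Suc b dvd (2 :: nat) ^ b"
    by (simp add: dvd_imp_le nat_dvd_not_less)
  ultimately show ?thesis
    using assms unfolding low_def by (simp add: dvd_add_right_iff)
qed

lemma low_power: "low (2 ^ b) b"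
  using low_add[of b 0] by simp

lemma low_less: "low x j \<Longrightarrow> x < 2 ^ d \<Longrightarrow> j < d"
proof -
  assume l: "low x j" and x: "x < 2 ^ d"
  have "2 ^ j \<le> x"
    using l by (intro dvd_imp_le) (auto simp: low_def intro: gr0I)
  then have "(2 :: nat) ^ j < 2 ^ d"
    using x by (rule le_less_trans)
  then show "j < d"
    by (rule power_less_imp_less_exp[rotated]) simp
qed

lemma tree_parent: "tree d x y \<Longrightarrow> low y j \<Longrightarrow> x + 2 ^ j = y"
  using low_add low_unique unfolding tree_def by blast

lemma tree_child: "tree d x y \<Longrightarrow> low x j \<Longrightarrow> \<exists>b<j. y = x + 2 ^ b"
proof -
  assume "tree d x y" and l: "low x j"
  then obtain b where b: "2 ^ Suc b dvd x" "y = x + 2 ^ b"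
    by (auto simp: tree_def)
  have "b < j"
  proof (rule ccontr)
    assume "\<not> b < j"
    then have "2 ^ Suc j dvd x"
      using b(1) by (intro power_le_dvd[of 2 "Suc b" x "Suc j"]) auto
    then show False
      using l by (simp add: low_def)
  qed
  then show ?thesis
    using b(2) by blast
qed

lemma tree_pos: "tree d x y \<Longrightarrow> x < y"
  by (auto simp: tree_def)

lemma tree_0: "tree d 0 y \<longleftrightarrow> (\<exists>b<d. y = 2 ^ b)"
  by (simp add: tree_def)

lemma div_block: "b = 2 ^ j * q \<Longrightarrow> b \<le> x \<and> x < b + 2 ^ j \<longleftrightarrow> x div 2 ^ j = (q :: nat)"
proof -
  assume b: "b = 2 ^ j * q"
  have "x div 2 ^ j = q \<longleftrightarrow> q \<le> x div 2 ^ j \<and> x div 2 ^ j < Suc q"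
    by auto
  also have "\<dots> \<longleftrightarrow> q * 2 ^ j \<le> x \<and> x < Suc q * 2 ^ j"
    by (simp add: less_eq_div_iff_mult_less_eq div_less_iff_less_mult)
  finally show ?thesis
    by (simp add: b mult.commute add.commute)
qed

text \<open>Bit \<open>b\<close> of \<open>x\<close> and all bits below it are 0, so setting bit
  \<open>b\<close> causes no carry into the bits from \<open>j\<close> on.\<close>

lemma tree_div:
  assumes "2 ^ Suc b dvd x" "b < j"
  shows "(x + 2 ^ b) div 2 ^ j = x div (2 :: nat) ^ j"
proof -
  have "2 ^ Suc b dvd x mod 2 ^ j"
    using assms le_imp_power_dvd[of "Suc b" j "2 :: nat"] by (simp add: dvd_mod)
  then obtain r where r: "x mod 2 ^ j = 2 ^ Suc b * r"
    by (elim dvdE)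
  have "2 ^ Suc b dvd (2 :: nat) ^ j"
    using assms le_imp_power_dvd by (metis Suc_leI)
  then obtain m where m: "(2 :: nat) ^ j = 2 ^ Suc b * m"
    by (elim dvdE)
  have "2 ^ Suc b * r < 2 ^ Suc b * m"
    using r m mod_less_divisor[of "2 ^ j" x] by (metis zero_less_numeral zero_less_power)
  then have "Suc r \<le> m"
    by (simp add: Suc_le_eq)
  then have "2 ^ Suc b * Suc r \<le> 2 ^ Suc b * m"
    by (rule mult_le_mono2)
  moreover have "2 ^ Suc b * r + 2 ^ b < 2 ^ Suc b * Suc r"
    by simp
  ultimately have "x mod 2 ^ j + 2 ^ b < 2 ^ j"
    unfolding r using m by linarith
  then have "(x mod 2 ^ j + 2 ^ b) div 2 ^ j = 0"
    by simp
  then show ?thesis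
    by (metis add.right_neutral div_mult_mod_eq div_mult_self3 add.assoc power_not_zero zero_neq_numeral)
qed

text \<open>The block is the subtree of \<open>h + 2 ^ j\<close> and a fibre of division by
  \<open>2 ^ j\<close>. Edges that add less than \<open>2 ^ j\<close> stay inside a fibre; all other
  edges join multiples of \<open>2 ^ j\<close>, and the only such number in the block is its root,
  whose parent is \<open>h\<close>.\<close>

lemma tree_block:
  assumes h: "2 ^ Suc j dvd h" and x: "h + 2 ^ j \<le> x" "x < h + 2 ^ j + 2 ^ j"
    and t: "tree d y x \<or> tree d x y"
  shows "h + 2 ^ j \<le> y \<and> y < h + 2 ^ j + 2 ^ j \<or> y = h \<and> x = h + 2 ^ j"
proof -
  obtain p where p: "h = 2 ^ Suc j * p"
    using h by (elim dvdE)
  let ?q = "2 * p + 1"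
  have b: "h + 2 ^ j = 2 ^ j * ?q"
    by (simp add: p algebra_simps)
  have iff: "h + 2 ^ j \<le> w \<and> w < h + 2 ^ j + 2 ^ j \<longleftrightarrow> w div 2 ^ j = ?q" for w
    using div_block[OF b, of w] .
  have xq: "x div 2 ^ j = ?q"
    using iff x by blast
  have x_eq: "x = h + 2 ^ j" if "2 ^ j dvd x"
    using that xq b by (metis dvd_div_mult_self mult.commute)
  have low_b: "low (h + 2 ^ j) j"
    using low_add[OF h] .
  obtain c u where c: "2 ^ Suc c dvd u" "(u = y \<and> x = u + 2 ^ c) \<or> (u = x \<and> y = u + 2 ^ c)"
    using t by (auto simp: tree_def)
  show ?thesis
  proof (cases "c < j")
    case True
    then show ?thesis
      using c tree_div[OF c(1) True] xq iff[of y] by auto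
  next
    case False
    have "2 ^ j dvd u"
      using c(1) False by (metis le_SucI not_less power_le_dvd)
    moreover have "2 ^ j dvd (2 :: nat) ^ c"
      using False by (simp add: le_imp_power_dvd)
    ultimately have "2 ^ j dvd x"
      using c(2) by auto
    then have xb: "x = h + 2 ^ j"
      by (rule x_eq)
    from c(2) show ?thesis
    proof
      assume "u = y \<and> x = u + 2 ^ c"
      then have "c = j"
        using low_add[OF c(1)] low_b xb low_unique by metis
      then show ?thesis
        using \<open>u = y \<and> x = u + 2 ^ c\<close> xb by simp
    next
      assume u: "u = x \<and> y = u + 2 ^ c"
      have "2 ^ Suc j dvd u"
        using c(1) False by (meson Suc_le_mono not_less power_le_dvd)
      then show ?thesis
        using low_b u xb by (simp add: low_def)
    qed
  qed
qed

text \<open>Offset \<open>2 ^ D\<close> has the children \<open>2 ^ D + 2 ^ s\<close>, the elements,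
  and is called when \<open>D\<close> steps remain, whereas offset 1 is a leaf called in the last
  step. The chosen tile takes over the early slot and so has time for its \<open>D\<close> elements;
  all other tiles can wait.\<close>

definition tile_at :: "nat \<Rightarrow> nat \<Rightarrow> nat \<Rightarrow> nat option" where
  "tile_at D k x = (if k = 0 \<and> x = 2 ^ D then Some 0 else if k \<noteq> 0 \<and> x = 1 then Some k else None)"

text \<open>Large enough to exceed the degrees of tiles, at most \<open>2 ^ D + 2 * D + 3\<close>,
  and of elements, at most \<open>2 * 2 ^ D + D + 2\<close>. It also keeps the offsets of tiles and
  elements away from the exceptional offsets of \<open>hubbed\<close>.\<close>

definition depth :: "nat \<Rightarrow> nat" where
  "depth D = 3 * 2 ^ D + 2 * D + 6"

text \<open>A noncore vertex may have degree at most \<open>d\<close>. The tree degrees at the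
  offsets \<open>2 ^ (d - 1)\<close>, \<open>2 ^ (d - 2)\<close> and \<open>3 * 2 ^ (d - 2)\<close>
  are \<open>d\<close>, \<open>d - 1\<close> and \<open>d - 1\<close>, so there is no room for both
  hubs. The first two offsets are adjacent to the root of their tree, which is a core vertex; the
  third one is not and gets hub 0 instead.\<close>

definition hubbed :: "nat \<Rightarrow> nat \<Rightarrow> vertex \<Rightarrow> bool" where
  "hubbed d j v \<longleftrightarrow> off v \<noteq> 0 \<and> off v \<noteq> 2 ^ (d - 1) \<and> off v \<noteq> 2 ^ (d - 2) \<and>
     (off v = 3 * 2 ^ (d - 2) \<longrightarrow> j = 0)"

text \<open>
  A constraint system: node \<open>i < N\<close> chooses a tile, coded as a number below \<open>2 ^ D\<close> and allowed
  by \<open>A i\<close>, such that bit \<open>s\<close> agrees with bit \<open>s\<close> of the partner node \<open>\<pi> s i\<close>.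

  In the graph, \<open>Cell i k 0\<close> and \<open>Extra j 0\<close> form the core clique, and each core vertex carries a
  binomial tree on the offsets below \<open>2 ^ depth D\<close>. The tiles of node \<open>i\<close> are \<open>Cell i 0 (2 ^ D)\<close>
  and \<open>Cell i k 1\<close> for \<open>k \<noteq> 0\<close>. Tile \<open>k\<close> of node \<open>i\<close> can call the vertex
  \<open>Cell i' 0 (2 ^ D + 2 ^ s)\<close> of node \<open>i' = i\<close> if its bit \<open>s\<close> is 0, of node \<open>i' = \<pi> s i\<close> otherwise,
  so all these vertices are called once exactly if the chosen tiles are consistent.
  The hubs \<open>Extra 0 0\<close> and \<open>Extra 1 0\<close> only serve to bring all other originators close to the core.
\<close>

locale gadget =
  fixes N D Y z :: nat and \<pi> :: "nat \<Rightarrow> nat \<Rightarrow> nat" and A :: "nat \<Rightarrow> nat \<Rightarrow> bool"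
  assumes N: "1 \<le> N" and D: "1 \<le> D" and Y: "2 \<le> Y" and size: "N * 2 ^ D + Y = 2 ^ z" and z: "4 \<le> z"
    and partner: "\<And>s i. s < D \<Longrightarrow> i < N \<Longrightarrow> \<pi> s i < N" "\<And>s i. s < D \<Longrightarrow> i < N \<Longrightarrow> \<pi> s (\<pi> s i) = i"
begin

abbreviation E :: nat where "E \<equiv> 2 ^ D"
abbreviation d :: nat where "d \<equiv> depth D"
abbreviation H :: nat where "H \<equiv> 2 ^ d"

text \<open>Links are directed; \<open>graph\<close> symmetrises them. In place of the tree arc from
  \<open>Cell i 0 0\<close> to offset \<open>2 ^ D\<close>, core vertices of node \<open>i\<close>
  are joined to its tiles: all to all, except that \<open>Cell i 0 0\<close> sees only the tiles
  allowed by \<open>A i\<close>. Its call decides the choice of the node; the other core vertices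
  pick up the remaining tiles in the last step.\<close>

fun link :: "vertex \<Rightarrow> vertex \<Rightarrow> bool" where
  "link (Cell i k x) (Cell i' k' x') \<longleftrightarrow>
     (i = i' \<and> k = k' \<and> tree d x x' \<and> \<not> (k = 0 \<and> x = 0 \<and> x' = E)) \<or>
     (i = i' \<and> x = 0 \<and> (\<exists>\<tau>. tile_at D k' x' = Some \<tau> \<and> (k \<noteq> 0 \<or> A i \<tau>))) \<or>
     (\<exists>\<tau> s. tile_at D k x = Some \<tau> \<and> s < D \<and> k' = 0 \<and> x' = E + 2 ^ s \<and> i' = (if bit \<tau> s then \<pi> s i else i))"
| "link (Extra j x) (Extra j' x') \<longleftrightarrow> j = j' \<and> tree d x x'"
| "link (Cell i k x) Pendant \<longleftrightarrow> i = 0 \<and> k = 0 \<and> x = 0"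
| "link _ _ \<longleftrightarrow> False"

definition arc :: "vertex \<Rightarrow> vertex \<Rightarrow> bool" where
  "arc u v \<longleftrightarrow> core u \<and> core v \<and> u \<noteq> v \<or> link u v \<or> (\<exists>j<2. u = Extra j 0 \<and> hubbed d j v)"

fun vert :: "vertex \<Rightarrow> bool" where
  "vert Pendant \<longleftrightarrow> True"
| "vert (Cell i k x) \<longleftrightarrow> i < N \<and> k < E \<and> x < H"
| "vert (Extra j x) \<longleftrightarrow> j < Y \<and> x < H"

definition graph :: "vertex pair_pre_digraph" where
  "graph = \<lparr>pverts = {v. vert v}, parcs = {(u, v). vert u \<and> vert v \<and> (arc u v \<or> arc v u)}\<rparr>"

definition satisfiable :: bool where
  "satisfiable \<longleftrightarrow> (\<exists>\<kappa>. \<forall>i<N. \<kappa> i < E \<and> A i (\<kappa> i) \<and> (\<forall>s<D. bit (\<kappa> i) s = bit (\<kappa> (\<pi> s i)) s))"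

section \<open>Size, neighbourhoods and degrees of the gadget graph\<close>

lemma d_bounds: "3 * E + 2 * D + 6 \<le> d" "2 \<le> E" "D < d" "6 \<le> d"
  using D self_le_power[of 2 D] by (auto simp: depth_def)

lemma E_less_H: "2 * E < H"
proof -
  have "2 * E = 2 ^ Suc D"
    by simp
  also have "\<dots> < H"
    using d_bounds by (intro power_strict_increasing) auto
  finally show ?thesis .
qed

lemma H_split: "H = 4 * 2 ^ (d - 2)" "2 ^ (d - 1) = 2 * (2 :: nat) ^ (d - 2)"
proof -
  have "d = Suc (Suc (d - 2))" "d - 1 = Suc (d - 2)"
    using d_bounds by auto
  then have "H = 2 ^ Suc (Suc (d - 2))" "(2 :: nat) ^ (d - 1) = 2 ^ Suc (d - 2)"
    by (metis, metis)
  then show "H = 4 * 2 ^ (d - 2)" "2 ^ (d - 1) = 2 * (2 :: nat) ^ (d - 2)"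
    by simp_all
qed

lemma arcs_iff: "(u, v) \<in> parcs graph \<longleftrightarrow> vert u \<and> vert v \<and> (arc u v \<or> arc v u)"
  by (simp add: graph_def)

lemma verts_eq: "{v. vert v} = insert Pendant
    ((\<lambda>(i, k, x). Cell i k x) ` ({..<N} \<times> {..<E} \<times> {..<H}) \<union> (\<lambda>(j, x). Extra j x) ` ({..<Y} \<times> {..<H}))"
proof -
  have "vert v \<longleftrightarrow> v \<in> insert Pendant
    ((\<lambda>(i, k, x). Cell i k x) ` ({..<N} \<times> {..<E} \<times> {..<H}) \<union> (\<lambda>(j, x). Extra j x) ` ({..<Y} \<times> {..<H}))" for v
    by (cases v) (auto simp: image_iff)
  then show ?thesis
    by blast
qed

lemma finite_verts: "finite {v. vert v}"
  unfolding verts_eq by simp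

lemma card_verts: "card {v. vert v} = 2 ^ (z + d) + 1"
proof -
  have "card ((\<lambda>(i, k, x). Cell i k x) ` ({..<N} \<times> {..<E} \<times> {..<H})) = N * E * H"
    by (subst card_image) (auto simp: inj_on_def)
  moreover have "card ((\<lambda>(j, x). Extra j x) ` ({..<Y} \<times> {..<H})) = Y * H"
    by (subst card_image) (auto simp: inj_on_def)
  ultimately have "card {v. vert v} = N * E * H + Y * H + 1"
    unfolding verts_eq by (subst card_insert_disjoint) (auto intro!: card_Un_disjoint[THEN trans])
  also have "N * E * H + Y * H = (N * E + Y) * H"
    by (simp add: algebra_simps)
  finally show ?thesis
    by (simp add: size power_add)
qed

definition cores :: "vertex set" where
  "cores = {v. vert v \<and> core v}"

lemma cores_eq: "cores = (\<lambda>(i, k). Cell i k 0) ` ({..<N} \<times> {..<E}) \<union> (\<lambda>j. Extra j 0) ` {..<Y}"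
proof -
  have "v \<in> cores \<longleftrightarrow> v \<in> (\<lambda>(i, k). Cell i k 0) ` ({..<N} \<times> {..<E}) \<union> (\<lambda>j. Extra j 0) ` {..<Y}" for v
    by (cases v) (auto simp: cores_def)
  then show ?thesis
    by blast
qed

lemma card_cores: "card cores = 2 ^ z"
proof -
  have "card ((\<lambda>(i, k). Cell i k 0) ` ({..<N} \<times> {..<E})) = N * E"
    by (subst card_image) (auto simp: inj_on_def)
  moreover have "card ((\<lambda>j. Extra j 0) ` {..<Y}) = Y"
    by (subst card_image) (auto simp: inj_on_def)
  ultimately show ?thesis
    unfolding cores_eq using size by (subst card_Un_disjoint) auto
qed

lemma finite_cores: "finite cores"
  unfolding cores_eq by simp

lemma tile_at_iff:
  "tile_at D k x = Some \<tau> \<longleftrightarrow> \<tau> = 0 \<and> k = 0 \<and> x = E \<or> \<tau> \<noteq> 0 \<and> k = \<tau> \<and> x = 1"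
  by (auto simp: tile_at_def)

definition tile :: "nat \<Rightarrow> nat \<Rightarrow> vertex" where
  "tile i \<tau> = (if \<tau> = 0 then Cell i 0 E else Cell i \<tau> 1)"

lemma tile_at_tile: "tile_at D k x = Some \<tau> \<longleftrightarrow> Cell i k x = tile i \<tau>"
  by (auto simp: tile_at_iff tile_def)

lemma vert_tile: "i < N \<Longrightarrow> \<tau> < E \<Longrightarrow> vert (tile i \<tau>)"
  using E_less_H d_bounds by (auto simp: tile_def)

lemma elem_less_H:
  assumes "s < D"
  shows "E + 2 ^ s < H"
proof -
  have "(2 :: nat) ^ s < E"
    using assms by (intro power_strict_increasing) auto
  then show ?thesis
    using E_less_H by linarith
qed

lemma Cell_nbr:
  assumes "(u, Cell i k x) \<in> parcs graph" "x \<noteq> 0"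
  obtains (hub) j where "j < 2" "u = Extra j 0" "hubbed d j (Cell i k x)"
    | (tree) y where "u = Cell i k y" "tree d y x \<or> tree d x y"
    | (core) k' \<tau> where "tile_at D k x = Some \<tau>" "k' < E" "u = Cell i k' 0"
    | (elem) \<tau> s where "tile_at D k x = Some \<tau>" "s < D" "u = Cell (if bit \<tau> s then \<pi> s i else i) 0 (E + 2 ^ s)"
    | (tile) i' \<tau> s where "k = 0" "x = E + 2 ^ s" "s < D" "i' < N" "\<tau> < E" "u = tile i' \<tau>"
        "i = (if bit \<tau> s then \<pi> s i' else i')"
proof (cases u)
  case Pendant
  then show ?thesis
    using assms by (auto simp: arcs_iff arc_def)
next
  case (Extra j y)
  then show ?thesis
    using assms hub by (auto simp: arcs_iff arc_def)
next
  case (Cell i' k' y)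
  have u: "vert u" and "link u (Cell i k x) \<or> link (Cell i k x) u"
    using assms Cell by (auto simp: arcs_iff arc_def)
  then consider (1) "link (Cell i' k' y) (Cell i k x)" | (2) "link (Cell i k x) (Cell i' k' y)"
    using Cell by auto
  then show ?thesis
  proof cases
    case 1
    then consider "i' = i \<and> k' = k \<and> tree d y x"
      | \<tau> where "i' = i" "y = 0" "tile_at D k x = Some \<tau>"
      | \<tau> s where "tile_at D k' y = Some \<tau>" "s < D" "k = 0" "x = E + 2 ^ s" "i = (if bit \<tau> s then \<pi> s i' else i')"
      by auto
    then show ?thesis
    proof cases
      case 1
      then show ?thesis using tree Cell by auto
    next
      case 2
      then show ?thesis using core Cell u by auto
    next
      case 3
      moreover have "i' < N" "\<tau> < E"
        using u Cell 3(1) by (auto simp: tile_at_iff)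
      moreover have "u = tile i' \<tau>"
        using 3(1) Cell tile_at_tile by simp
      ultimately show ?thesis
        using tile by blast
    qed
  next
    case 2
    then consider "i' = i \<and> k' = k \<and> tree d x y"
      | \<tau> s where "tile_at D k x = Some \<tau>" "s < D" "k' = 0" "y = E + 2 ^ s" "i' = (if bit \<tau> s then \<pi> s i else i)"
      using assms(2) by auto
    then show ?thesis
    proof cases
      case 1
      then show ?thesis using tree Cell by auto
    next
      case 2
      then show ?thesis using elem Cell by auto
    qed
  qed
qed

lemma Extra_nbr:
  assumes "(u, Extra j x) \<in> parcs graph" "x \<noteq> 0"
  obtains (hub) j' where "j' < 2" "u = Extra j' 0" "hubbed d j' (Extra j x)"
    | (tree) y where "u = Extra j y" "tree d y x \<or> tree d x y"
  using assms by (cases u) (auto simp: arcs_iff arc_def)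

definition hubs :: "nat \<Rightarrow> vertex set" where
  "hubs x = {u. \<exists>j<2. u = Extra j 0 \<and> hubbed d j (Extra 0 x)}"

lemma card_hubs:
  shows "finite (hubs x)" "card (hubs x) \<le> 2" "x = 2 ^ (d - 1) \<Longrightarrow> card (hubs x) = 0"
    "x = 2 ^ (d - 2) \<Longrightarrow> card (hubs x) = 0" "x = 3 * 2 ^ (d - 2) \<Longrightarrow> card (hubs x) \<le> 1"
proof -
  have sub: "hubs x \<subseteq> {Extra 0 0, Extra 1 0}"
    by (auto simp: hubs_def numeral_2_eq_2 less_Suc_eq)
  then show "finite (hubs x)"
    using finite_subset by blast
  show "card (hubs x) \<le> 2"
    using card_mono[OF _ sub] by simp
  show "x = 2 ^ (d - 1) \<Longrightarrow> card (hubs x) = 0" "x = 2 ^ (d - 2) \<Longrightarrow> card (hubs x) = 0"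
    by (simp_all add: hubs_def hubbed_def)
  have "x = 3 * 2 ^ (d - 2) \<Longrightarrow> hubs x \<subseteq> {Extra 0 0}"
    by (auto simp: hubs_def hubbed_def)
  then show "x = 3 * 2 ^ (d - 2) \<Longrightarrow> card (hubs x) \<le> 1"
    using card_mono[of "{Extra 0 0}" "hubs x"] by simp
qed

lemma card_tree_nbrs:
  assumes "low x j"
  shows "finite {y. tree d y x \<or> tree d x y}" "card {y. tree d y x \<or> tree d x y} \<le> j + 1"
proof -
  have sub: "{y. tree d y x \<or> tree d x y} \<subseteq> insert (x - 2 ^ j) ((\<lambda>b. x + 2 ^ b) ` {..<j})"
    using tree_parent[OF _ assms] tree_child[OF _ assms] by fastforce
  then show "finite {y. tree d y x \<or> tree d x y}"
    using finite_subset by blast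
  have "card {y. tree d y x \<or> tree d x y} \<le> card (insert (x - 2 ^ j) ((\<lambda>b. x + 2 ^ b) ` {..<j}))"
    using sub by (intro card_mono) auto
  also have "\<dots> \<le> Suc (card ((\<lambda>b. x + 2 ^ b) ` {..<j}))"
    by (simp add: card_insert_if)
  also have "\<dots> \<le> j + 1"
    using card_image_le[of "{..<j}" "\<lambda>b. x + 2 ^ b"] by simp
  finally show "card {y. tree d y x \<or> tree d x y} \<le> j + 1" .
qed

lemma plain_degree:
  assumes "0 < x" "x < H" "low x j"
  shows "j + 1 + card (hubs x) \<le> d"
proof -
  obtain q where q: "x = 2 ^ j * q"
    using assms(3) unfolding low_def by (elim conjE dvdE)
  have j: "j < d"
    using low_less assms by blast
  consider "j + 3 \<le> d" | "j = d - 1" | "j = d - 2"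
    using j by linarith
  then show ?thesis
  proof cases
    case 1
    then show ?thesis
      using card_hubs(2)[of x] by simp
  next
    case 2
    have "2 ^ (d - 1) * q < 2 ^ (d - 1) * 2"
      using assms(2) q 2 H_split by simp
    then have "q < 2"
      by simp
    moreover have "q \<noteq> 0"
      using q assms(1) by auto
    ultimately have "x = 2 ^ (d - 1)"
      using q 2 by (simp add: less_2_cases_iff)
    then show ?thesis
      using card_hubs(3) j by simp
  next
    case 3
    have "2 ^ (d - 2) * q < 2 ^ (d - 2) * 4"
      using assms(2) q 3 H_split by simp
    then have "q < 4"
      by simp
    moreover have "odd q"
      using assms(3) q by (auto simp: low_def)
    ultimately have "q = 1 \<or> q = 3"
      by (cases q rule: nat.exhaust) (auto simp: numeral_eq_Suc less_Suc_eq)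
    then have "x = 2 ^ (d - 2) \<or> x = 3 * 2 ^ (d - 2)"
      using q 3 by auto
    then show ?thesis
      using card_hubs(4,5)[of x] 3 d_bounds(4) by auto
  qed
qed

text \<open>A vertex informed within \<open>z\<close> of \<open>z + d\<close> steps of a perfect
  broadcast must have at least \<open>d + 1\<close> neighbours unless it is the originator; this
  bound thus excludes all noncore vertices from the first \<open>z\<close> steps. Tiles and elements
  have many extra neighbours but small tree degree, plain vertices have at most the two hubs in
  addition to the tree.\<close>

lemma degree_le:
  assumes "vert v" "v \<noteq> Pendant" "\<not> core v"
  shows "finite {u. (v, u) \<in> parcs graph}" "card {u. (v, u) \<in> parcs graph} \<le> d"
proof -
  show fin: "finite {u. (v, u) \<in> parcs graph}"
    by (rule finite_subset[OF _ finite_verts]) (auto simp: arcs_iff)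
  have sym: "(v, u) \<in> parcs graph \<longleftrightarrow> (u, v) \<in> parcs graph" for u
    by (auto simp: arcs_iff)
  show "card {u. (v, u) \<in> parcs graph} \<le> d"
  proof (cases v)
    case (Extra j x)
    then have x: "0 < x" "x < H" and x0: "x \<noteq> 0"
      using assms by auto
    obtain l where l: "low x l"
      using low_exists[OF x(1)] .
    let ?T = "{y. tree d y x \<or> tree d x y}"
    have "{u. (v, u) \<in> parcs graph} \<subseteq> Extra j ` ?T \<union> hubs x"
    proof
      fix u assume "u \<in> {u. (v, u) \<in> parcs graph}"
      then have "(u, Extra j x) \<in> parcs graph"
        using sym Extra by simp
      then show "u \<in> Extra j ` ?T \<union> hubs x"
        using x0 by (cases rule: Extra_nbr) (auto simp: hubs_def hubbed_def)
    qed
    then have "card {u. (v, u) \<in> parcs graph} \<le> card (Extra j ` ?T \<union> hubs x)"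
      using card_tree_nbrs(1)[OF l] card_hubs(1) by (intro card_mono) auto
    also have "\<dots> \<le> card (Extra j ` ?T) + card (hubs x)"
      by (rule card_Un_le)
    also have "\<dots> \<le> l + 1 + card (hubs x)"
      using card_image_le[OF card_tree_nbrs(1)[OF l], of "Extra j"] card_tree_nbrs(2)[OF l] by simp
    also have "\<dots> \<le> d"
      by (rule plain_degree[OF x l])
    finally show ?thesis .
  next
    case (Cell i k x)
    then have x: "0 < x" "x < H" and x0: "x \<noteq> 0" and ik: "i < N" "k < E"
      using assms by auto
    obtain l where l: "low x l"
      using low_exists[OF x(1)] .
    let ?T = "{y. tree d y x \<or> tree d x y}"
    let ?TH = "Cell i k ` ?T \<union> hubs x"
    have TH: "finite ?TH" "card ?TH \<le> l + 1 + card (hubs x)"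
      using card_tree_nbrs(1)[OF l] card_hubs(1)[of x] card_Un_le[of "Cell i k ` ?T" "hubs x"]
        card_image_le[OF card_tree_nbrs(1)[OF l], of "Cell i k"] card_tree_nbrs(2)[OF l] by auto
    have nbr: "(u, Cell i k x) \<in> parcs graph" if "(v, u) \<in> parcs graph" for u
      using that sym Cell by simp
    consider (tile) \<tau> where "tile_at D k x = Some \<tau>"
      | (elem) s where "k = 0" "s < D" "x = E + 2 ^ s" "tile_at D k x = None"
      | (plain) "tile_at D k x = None" "\<not> (k = 0 \<and> (\<exists>s<D. x = E + 2 ^ s))"
      by (cases "tile_at D k x") blast+
    then show ?thesis
    proof cases
      case tile
      let ?C = "(\<lambda>k. Cell i k 0) ` {..<E}"
      let ?L = "(\<lambda>s. Cell (if bit \<tau> s then \<pi> s i else i) 0 (E + 2 ^ s)) ` {..<D}"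
      have nle: "\<not> (k = 0 \<and> (\<exists>s<D. x = E + 2 ^ s))"
        using tile by (auto simp: tile_at_iff)
      have "{u. (v, u) \<in> parcs graph} \<subseteq> ?TH \<union> ?C \<union> ?L"
      proof
        fix u assume "u \<in> {u. (v, u) \<in> parcs graph}"
        then have "(u, Cell i k x) \<in> parcs graph"
          using nbr by simp
        then show "u \<in> ?TH \<union> ?C \<union> ?L"
          using x0 by (cases rule: Cell_nbr) (use tile nle in \<open>auto simp: hubs_def hubbed_def\<close>)
      qed
      then have "card {u. (v, u) \<in> parcs graph} \<le> card (?TH \<union> ?C \<union> ?L)"
        using TH(1) by (intro card_mono) auto
      also have "\<dots> \<le> card ?TH + card ?C + card ?L"
        using card_Un_le[of "?TH \<union> ?C" ?L] card_Un_le[of ?TH ?C] by linarith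
      also have "\<dots> \<le> (l + 1 + 2) + E + D"
        using TH(2) card_hubs(2)[of x] card_image_le[of "{..<E}" "\<lambda>k. Cell i k 0"]
          card_image_le[of "{..<D}" "\<lambda>s. Cell (if bit \<tau> s then \<pi> s i else i) 0 (E + 2 ^ s)"] by simp
      also have "l \<le> D"
        using tile low_unique[of x l D] low_unique[of x l 0] l low_power[of D] low_power[of 0]
        by (auto simp: tile_at_iff)
      finally show ?thesis
        using d_bounds(1) by simp
    next
      case elem
      let ?L = "tile i ` {..<E} \<union> tile (\<pi> s i) ` {..<E}"
      have "{u. (v, u) \<in> parcs graph} \<subseteq> ?TH \<union> ?L"
      proof
        fix u assume "u \<in> {u. (v, u) \<in> parcs graph}"
        then have "(u, Cell i k x) \<in> parcs graph"
          using nbr by simp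
        then show "u \<in> ?TH \<union> ?L"
          using x0
        proof (cases rule: Cell_nbr)
          case (tile i' \<tau> s')
          then have "s' = s"
            using elem(3) by simp
          then show ?thesis
            using tile partner elem(2) by (auto split: if_splits)
        qed (use elem in \<open>auto simp: hubs_def hubbed_def\<close>)
      qed
      then have "card {u. (v, u) \<in> parcs graph} \<le> card (?TH \<union> ?L)"
        using TH(1) by (intro card_mono) auto
      also have "\<dots> \<le> card ?TH + (card (tile i ` {..<E}) + card (tile (\<pi> s i) ` {..<E}))"
        using card_Un_le[of ?TH ?L] card_Un_le[of "tile i ` {..<E}" "tile (\<pi> s i) ` {..<E}"] by linarith
      also have "\<dots> \<le> (l + 1 + 2) + (E + E)"
        using TH(2) card_hubs(2)[of x] card_image_le[of "{..<E}" "tile i"]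
          card_image_le[of "{..<E}" "tile (\<pi> s i)"] by simp
      also have "l = s"
      proof (rule low_unique[OF l])
        show "low x s"
          unfolding elem(3) using elem(2) by (intro low_add le_imp_power_dvd) simp
      qed
      finally show ?thesis
        using d_bounds(1) elem(2) by simp
    next
      case plain
      have "{u. (v, u) \<in> parcs graph} \<subseteq> ?TH"
      proof
        fix u assume "u \<in> {u. (v, u) \<in> parcs graph}"
        then have "(u, Cell i k x) \<in> parcs graph"
          using nbr by simp
        then show "u \<in> ?TH"
          using x0 by (cases rule: Cell_nbr) (use plain in \<open>auto simp: hubs_def hubbed_def\<close>)
      qed
      then have "card {u. (v, u) \<in> parcs graph} \<le> card ?TH"
        using TH(1) by (intro card_mono) auto
      then show ?thesis
        using TH(2) plain_degree[OF x l] by simp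
    qed
  qed (use assms in simp)
qed

end

lemma tree_low: "tree d x y \<Longrightarrow> low y j \<Longrightarrow> x = y - 2 ^ j"
  using tree_parent by fastforce

section \<open>Forced calls in a perfect broadcast of the gadget graph\<close>

context gadget
begin

text \<open>The two elements of \<open>i\<close> and \<open>\<pi> s i\<close> can be covered by
  these two nodes only. If one node covered its own element and the other crossed over, the same
  element would be covered twice and the other one never.\<close>

lemma partner_surj:
  assumes s: "s < D" and i: "i < N"
    and surj: "\<And>i. i < N \<Longrightarrow> \<exists>i'<N. i = (if P i' then \<pi> s i' else i')"
  shows "P i = P (\<pi> s i)"
proof -
  obtain i1 where i1: "i1 < N" "i = (if P i1 then \<pi> s i1 else i1)"
    using surj[OF i] by auto
  obtain i2 where i2: "i2 < N" "\<pi> s i = (if P i2 then \<pi> s i2 else i2)"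
    using surj[OF partner(1)[OF s i]] by auto
  have "i1 = (if P i1 then \<pi> s i else i)"
    using i1 partner(2)[OF s i1(1)] by auto
  moreover have "i2 = (if P i2 then i else \<pi> s i)"
    using i2 partner(2)[OF s i2(1)] partner(2)[OF s i] by (auto split: if_splits)
  ultimately show ?thesis
    by (auto split: if_splits)
qed

lemma core_nbr:
  assumes "(Cell i k 0, y) \<in> parcs graph" "off y \<noteq> 0"
  obtains (tree) x where "y = Cell i k x" "tree d 0 x" "\<not> (k = 0 \<and> x = E)"
    | (tile) \<tau> where "y = tile i \<tau>" "k \<noteq> 0 \<or> A i \<tau>"
proof (cases y)
  case (Cell i' k' x)
  have [simp]: "tile_at D k 0 = None"
    by (simp add: tile_at_def)
  have "\<not> link (Cell i' k' x) (Cell i k 0)"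
    using assms(2) Cell by (auto dest: tree_pos)
  then have "link (Cell i k 0) (Cell i' k' x)"
    using assms unfolding Cell arcs_iff arc_def by (simp add: hubbed_def del: link.simps)
  then consider "i' = i" "k' = k" "tree d 0 x" "\<not> (k = 0 \<and> x = E)"
    | \<tau> where "i' = i" "tile_at D k' x = Some \<tau>" "k \<noteq> 0 \<or> A i \<tau>"
    by auto
  then show ?thesis
    by cases (use tree tile Cell tile_at_tile in blast)+
qed (use assms in \<open>auto simp: arcs_iff arc_def hubbed_def\<close>)

context
  fixes J :: "nat \<Rightarrow> vertex set" and f :: "nat \<Rightarrow> vertex \<Rightarrow> vertex" and K :: nat
  assumes K: "K = z + d"
    and pb: "perfect_broadcast (parcs graph) K J f (Cell 0 0 0)" and J_K: "J K = {v. vert v} - {Pendant}"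
begin

interpretation pb: perfect_broadcast "parcs graph" K J f "Cell 0 0 0"
  by (rule pb)

text \<open>By the degree bound nothing outside the core is informed after \<open>z\<close> steps,
  and both sets have \<open>2 ^ z\<close> elements.\<close>

lemma J_z: "J z = cores"
proof -
  have "J z \<subseteq> cores"
  proof
    fix v assume v: "v \<in> J z"
    then have "v \<in> J K"
      using pb.J_mono[of z K] K by auto
    then have vv: "vert v" "v \<noteq> Pendant"
      using J_K by auto
    have "core v"
    proof (rule ccontr)
      assume "\<not> core v"
      moreover from this have "v \<noteq> Cell 0 0 0"
        by auto
      ultimately show False
        using pb.degree[OF v] degree_le[OF vv] K by auto
    qed
    then show "v \<in> cores"
      using vv by (simp add: cores_def)
  qed
  then show ?thesis
    using pb.card_J[of z] K card_cores finite_cores by (intro card_subset_eq) auto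
qed

lemma J_verts: "t \<le> K \<Longrightarrow> v \<in> J t \<Longrightarrow> vert v \<and> v \<noteq> Pendant"
  using pb.J_mono[of t K] J_K by auto

lemma f_late:
  assumes "z \<le> t" "t < K" "u \<in> J t"
  shows "vert (f t u)" "f t u \<noteq> Pendant" "off (f t u) \<noteq> 0" "(u, f t u) \<in> parcs graph" "(f t u, u) \<in> parcs graph"
proof -
  show f: "vert (f t u)" "f t u \<noteq> Pendant"
    using J_verts[of "Suc t" "f t u"] pb.f_in[OF assms(2,3)] assms(2) by auto
  have "f t u \<notin> cores"
    using pb.f_new[OF assms(2,3)] pb.J_mono[of z t] J_z assms by auto
  then show "off (f t u) \<noteq> 0"
    using f by (simp add: cores_def core_def)
  show "(u, f t u) \<in> parcs graph" "(f t u, u) \<in> parcs graph"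
    using pb.f_arc[OF assms(2,3)] pb.E_sym by auto
qed

lemma hub_calls:
  assumes "z \<le> t" "t < K" "j < 2"
  shows "\<exists>j' x. f t (Extra j 0) = Extra j' x"
proof -
  define Q where "Q = (\<lambda>(j, x). Extra j x) ` ({..<2} \<times> {..<H})"
  have Q_iff: "v \<in> Q \<longleftrightarrow> (\<exists>j x. v = Extra j x \<and> j < 2 \<and> x < H)" for v
    by (auto simp: Q_def)
  have "card Q = 2 * H"
    unfolding Q_def by (subst card_image) (auto simp: inj_on_def)
  moreover have "J K \<inter> Q = Q"
  proof (rule Int_absorb1, rule subsetI)
    fix v assume "v \<in> Q"
    then have "vert v \<and> v \<noteq> Pendant"
      using Y by (auto simp: Q_def)
    then show "v \<in> J K"
      unfolding J_K by simp
  qed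
  moreover have "J z \<inter> Q = {Extra 0 0, Extra 1 0}"
  proof -
    have "v \<in> cores \<and> v \<in> Q \<longleftrightarrow> v = Extra 0 0 \<or> v = Extra 1 0" for v
      using Y by (cases v) (auto simp: Q_iff less_2_cases_iff cores_def)
    then show ?thesis
      unfolding J_z by blast
  qed
  ultimately have size: "2 ^ (K - z) * card (J z \<inter> Q) \<le> card (J K \<inter> Q)"
    by (simp add: K)
  have closed: "u \<in> Q" if t: "z \<le> t" "t < K" "u \<in> J t" and Q: "f t u \<in> Q" for t u
  proof -
    obtain j x where jx: "f t u = Extra j x" "j < 2" "x < H"
      using Q by (auto simp: Q_iff)
    have "(u, Extra j x) \<in> parcs graph" "x \<noteq> 0"
      using f_late[OF t] jx by auto
    then show ?thesis
    proof (cases rule: Extra_nbr)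
      case (tree y)
      then show ?thesis
        using J_verts[of t u] t jx by (auto simp: Q_iff)
    qed (auto simp: Q_iff)
  qed
  have "z \<le> K"
    using K by simp
  note zK = this
  have "Extra j 0 \<in> J t"
    using assms Y pb.J_mono[of z t] by (auto simp: J_z cores_def)
  moreover have "Extra j 0 \<in> Q"
    using assms by (simp add: Q_iff)
  ultimately have "f t (Extra j 0) \<in> Q"
    using pb.closed_out[OF zK _ size assms(1,2)] closed by blast
  then show ?thesis
    by (auto simp: Q_iff)
qed

text \<open>A subtree without tiles and elements is adjacent only to its parent and to the hubs. As
  the hubs do not call it, it has to be entered from the parent, at the latest and only possible
  moment.\<close>

lemma block_call:
  assumes i: "i < N" "k < E" and j: "2 ^ Suc j dvd h" "h + 2 ^ j + 2 ^ j \<le> H"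
    and plain: "\<And>x. h + 2 ^ j \<le> x \<Longrightarrow> x < h + 2 ^ j + 2 ^ j \<Longrightarrow>
      tile_at D k x = None \<and> \<not> (k = 0 \<and> (\<exists>s<D. x = E + 2 ^ s))"
  obtains t where "z \<le> t" "t + 1 + j = K" "Cell i k h \<in> J t" "f t (Cell i k h) = Cell i k (h + 2 ^ j)"
proof (rule pb.block[where ?t0.0 = z and j = j and B = "Cell i k ` {h + 2 ^ j..<h + 2 ^ j + 2 ^ j}"
      and q = "Cell i k (h + 2 ^ j)" and h = "Cell i k h" and X = "{Extra 0 0, Extra 1 0}"])
  let ?B = "Cell i k ` {h + 2 ^ j..<h + 2 ^ j + 2 ^ j}"
  show "z \<le> K"
    using K by simp
  show "card ?B = 2 ^ j"
    by (subst card_image) (auto simp: inj_on_def)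
  show "?B \<inter> J z = {}"
    unfolding J_z by (auto simp: cores_def)
  show "?B \<subseteq> J K"
    using i j(2) by (auto simp: J_K)
  show "{Extra 0 0, Extra 1 0} \<subseteq> J z"
    using Y by (auto simp: J_z cores_def)
  show "f t u \<notin> ?B" if "z \<le> t" "t < K" "u \<in> {Extra 0 0, Extra 1 0}" for t u
    using hub_calls[OF that(1,2), of 0] hub_calls[OF that(1,2), of 1] that(3) by auto
  show "u \<in> ?B \<or> u \<in> {Extra 0 0, Extra 1 0} \<or> (u = Cell i k h \<and> v = Cell i k (h + 2 ^ j))"
    if uv: "v \<in> ?B" "(u, v) \<in> parcs graph" for u v
  proof -
    obtain x where x: "v = Cell i k x" "h + 2 ^ j \<le> x" "x < h + 2 ^ j + 2 ^ j"
      using uv(1) by auto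
    have pl: "tile_at D k x = None" "\<not> (k = 0 \<and> (\<exists>s<D. x = E + 2 ^ s))"
      using plain[OF x(2,3)] by auto
    have "(u, Cell i k x) \<in> parcs graph" "x \<noteq> 0"
      using uv(2) x by auto
    then show ?thesis
    proof (cases rule: Cell_nbr)
      case (hub j')
      then show ?thesis by (auto simp: less_2_cases_iff)
    next
      case (tree y)
      then show ?thesis
        using tree_block[OF j(1) x(2,3) tree(2)] x(1) by auto
    qed (use pl in auto)
  qed
qed (use that in auto)

text \<open>The subtree of offset \<open>2 ^ b\<close> contains no tile or element for these
  \<open>b\<close>: tiles and elements of cell 0 lie between \<open>2 ^ D\<close> and
  \<open>2 ^ Suc D\<close>, and the tile of any other cell is the leaf 1.\<close>

lemma core_call:
  assumes i: "i < N" "k < E" and b: "b < d" "b \<noteq> (if k = 0 then D else 0)"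
  shows "f (K - 1 - b) (Cell i k 0) = Cell i k (2 ^ b)"
proof -
  have plain: "tile_at D k x = None \<and> \<not> (k = 0 \<and> (\<exists>s<D. x = E + 2 ^ s))"
    if x: "0 + 2 ^ b \<le> x" "x < 0 + 2 ^ b + 2 ^ b" for x
  proof (cases "k = 0")
    case True
    have *: False if "E \<le> x" "x < 2 * E"
    proof -
      have "(2 :: nat) ^ b < 2 ^ Suc D" "(2 :: nat) ^ D < 2 ^ Suc b"
        using x that by simp_all
      then have "b < Suc D" "D < Suc b"
        using power_less_imp_less_exp[of "2 :: nat"] by (metis one_less_numeral_iff semiring_norm(76))+
      then show False
        using b(2) True by simp
    qed
    have "x \<noteq> E"
      using * d_bounds(2) by auto
    moreover have "x \<noteq> E + 2 ^ s" if "s < D" for s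
    proof
      assume "x = E + 2 ^ s"
      moreover have "(2 :: nat) ^ s < E"
        using that by (intro power_strict_increasing) auto
      ultimately show False
        using * by simp
    qed
    ultimately show ?thesis
      using True by (auto simp: tile_at_def)
  next
    case False
    then have "(2 :: nat) ^ 1 \<le> 2 ^ b"
      using b(2) by (intro power_increasing) auto
    then show ?thesis
      using False x by (auto simp: tile_at_def)
  qed
  have H: "0 + 2 ^ b + 2 ^ b \<le> H"
  proof -
    have "(2 :: nat) ^ Suc b \<le> H"
      using b(1) by (intro power_increasing) auto
    then show ?thesis
      by simp
  qed
  obtain t where "t + 1 + b = K" "f t (Cell i k 0) = Cell i k (0 + 2 ^ b)"
    by (rule block_call[OF i _ H plain]) auto
  then show ?thesis
    by auto
qed

text \<open>The one step among the last \<open>d\<close> that \<open>core_call\<close> leaves open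
  for the core vertex of cell \<open>k\<close>.\<close>

definition free_time :: "nat \<Rightarrow> nat" where
  "free_time k = (if k = 0 then K - 1 - D else K - 1)"

lemma free_time_bounds: "z \<le> free_time k" "free_time k < K"
  unfolding free_time_def using K d_bounds by auto

lemma core_in_J: "i < N \<Longrightarrow> k < E \<Longrightarrow> z \<le> t \<Longrightarrow> t \<le> K \<Longrightarrow> Cell i k 0 \<in> J t"
  using pb.J_mono[of z t] by (auto simp: J_z cores_def)

text \<open>The other children are called at their own times and nobody is called twice, so only a
  tile is left. For \<open>k \<noteq> 0\<close> the child at offset 1 is itself tile
  \<open>k\<close>.\<close>

lemma free_call:
  assumes i: "i < N" "k < E"
  shows "\<exists>\<tau><E. f (free_time k) (Cell i k 0) = tile i \<tau> \<and> (k = 0 \<longrightarrow> A i \<tau>)"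
proof -
  let ?t = "free_time k" and ?c = "Cell i k 0"
  have c: "?c \<in> J ?t"
    using core_in_J[OF i, of ?t] free_time_bounds by (simp add: less_imp_le)
  note y = f_late[OF free_time_bounds c]
  let ?y = "f ?t ?c"
  from y(4,3) show ?thesis
  proof (cases rule: core_nbr)
    case (tree x)
    then obtain b where b: "b < d" "x = 2 ^ b"
      by (auto simp: tree_0)
    show ?thesis
    proof (cases "b = (if k = 0 then D else 0)")
      case True
      then have "k \<noteq> 0" "x = 1"
        using tree(3) b by (auto split: if_splits)
      then have "?y = tile i k"
        using tree(1) by (simp add: tile_def)
      then show ?thesis
        using i \<open>k \<noteq> 0\<close> by auto
    next
      case False
      have bK: "K - 1 - b < K" "z \<le> K - 1 - b"
        using K b(1) by auto
      have fy: "f (K - 1 - b) ?c = ?y"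
        using core_call[OF i b(1) False] tree(1) b(2) by simp
      have "?c \<in> J (K - 1 - b)"
        using core_in_J[OF i bK(2)] by simp
      then have "K - 1 - b = ?t"
        using pb.called_once[OF bK(1) free_time_bounds(2) _ c fy] by simp
      then have "b = (if k = 0 then D else 0)"
        using b(1) K d_bounds(3) unfolding free_time_def by (simp split: if_splits)
      then show ?thesis
        using False by simp
    qed
  next
    case (tile \<tau>)
    moreover have "\<tau> < E"
      using y(1) tile(1) d_bounds(2) by (auto simp: tile_def split: if_splits)
    ultimately show ?thesis
      by auto
  qed
qed

definition choice :: "nat \<Rightarrow> nat \<Rightarrow> nat" where
  "choice i k = (SOME \<tau>. \<tau> < E \<and> f (free_time k) (Cell i k 0) = tile i \<tau> \<and> (k = 0 \<longrightarrow> A i \<tau>))"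

lemma choice:
  assumes "i < N" "k < E"
  shows "choice i k < E" "f (free_time k) (Cell i k 0) = tile i (choice i k)" "k = 0 \<Longrightarrow> A i (choice i k)"
proof -
  have "choice i k < E \<and> f (free_time k) (Cell i k 0) = tile i (choice i k) \<and> (k = 0 \<longrightarrow> A i (choice i k))"
    unfolding choice_def using free_call[OF assms] by (rule someI_ex)
  then show "choice i k < E" "f (free_time k) (Cell i k 0) = tile i (choice i k)" "k = 0 \<Longrightarrow> A i (choice i k)"
    by auto
qed

text \<open>The \<open>2 ^ D\<close> core vertices of a node call distinct tiles of the node in
  their free steps, and there are \<open>2 ^ D\<close> tiles, so each tile is accounted for.\<close>

lemma tile_called:
  assumes i: "i < N" and \<tau>: "\<tau> < E"
  obtains k where "k < E" "f (free_time k) (Cell i k 0) = tile i \<tau>" "\<tau> = choice i k"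
proof -
  have "inj_on (choice i) {..<E}"
  proof (rule inj_onI)
    fix k k' assume k: "k \<in> {..<E}" "k' \<in> {..<E}" "choice i k = choice i k'"
    then have "f (free_time k) (Cell i k 0) = f (free_time k') (Cell i k' 0)"
      using choice(2)[OF i, of k] choice(2)[OF i, of k'] by simp
    then show "k = k'"
      using pb.called_once[OF free_time_bounds(2) free_time_bounds(2), of "Cell i k 0" k "Cell i k' 0" k']
        core_in_J[OF i] free_time_bounds k by (auto simp: less_imp_le)
  qed
  moreover have "choice i ` {..<E} \<subseteq> {..<E}"
    using choice(1)[OF i] by auto
  ultimately have "choice i ` {..<E} = {..<E}"
    by (intro card_subset_eq) (auto simp: card_image)
  then obtain k where "k < E" "\<tau> = choice i k"
    using \<tau> by (auto simp: set_eq_iff image_iff)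
  then show ?thesis
    using choice(2)[OF i] that by auto
qed

text \<open>A tile called by a core vertex other than \<open>Cell i 0 0\<close> is called in the
  last step and cannot make a call any more.\<close>

lemma early_tile:
  assumes i: "i < N" and \<tau>: "\<tau> < E" and t: "t < K" "tile i \<tau> \<in> J t"
  shows "\<tau> = choice i 0"
proof -
  obtain k where k: "k < E" "f (free_time k) (Cell i k 0) = tile i \<tau>" "\<tau> = choice i k"
    by (rule tile_called[OF i \<tau>])
  have "k = 0"
  proof (rule ccontr)
    assume "k \<noteq> 0"
    then have "free_time k = K - 1"
      by (simp add: free_time_def)
    moreover have "tile i \<tau> \<in> J (K - 1)"
    proof (rule subsetD[OF pb.J_mono t(2)])
      show "t \<le> K - 1" "K - 1 \<le> K"
        using t(1) by simp_all
    qed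
    ultimately show False
      using pb.f_new[OF free_time_bounds(2), of "Cell i k 0" k] k
        core_in_J[OF i k(1), of "free_time k"] free_time_bounds[of k] by (simp add: less_imp_le)
  qed
  then show ?thesis
    using k by simp
qed

text \<open>Every element has a caller, and this must be a tile informed before the last step, hence
  the choice of its node. The tree parent of an element is tile 0, all of whose bits are 0.\<close>

lemma elem_called:
  assumes i: "i < N" and s: "s < D"
  shows "\<exists>i'<N. i = (if bit (choice i' 0) s then \<pi> s i' else i')"
proof -
  let ?e = "Cell i 0 (E + 2 ^ s)"
  have low: "low (E + 2 ^ s) s"
    using s by (intro low_add le_imp_power_dvd) simp
  have e: "?e \<in> J K"
    using i elem_less_H[OF s] d_bounds(2) J_K by simp
  have "?e \<notin> J z"
    by (simp add: J_z cores_def)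
  then obtain t u where t: "z \<le> t" "t < K" "u \<in> J t" "f t u = ?e"
    using pb.caller[OF e] K by (metis le_add1 order_refl)
  have u: "(u, ?e) \<in> parcs graph"
    using pb.f_arc[OF t(2,3)] t(4) by simp
  have x0: "E + 2 ^ s \<noteq> 0"
    by simp
  from u x0 show ?thesis
  proof (cases rule: Cell_nbr)
    case (hub j)
    then show ?thesis
      using hub_calls[OF t(1,2), of j] t(4) by auto
  next
    case (tree y)
    show ?thesis
    proof (cases "tree d y (E + 2 ^ s)")
      case True
      then have "y = E"
        using tree_low[OF True low] by simp
      then have "u = tile i 0"
        using tree by (simp add: tile_def)
      then have "choice i 0 = 0"
        using early_tile[OF i, of 0 t] t d_bounds(2) by simp
      then show ?thesis
        using i by (intro exI[of _ i]) simp
    next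
      case False
      \<comment> \<open>A child of the element roots a plain block, which can be entered only from
        the element itself; so the child is informed later than the element and is not its
        caller.\<close>
      then have child: "tree d (E + 2 ^ s) y"
        using tree by simp
      then obtain b where b: "b < s" "y = E + 2 ^ s + 2 ^ b"
        using tree_child[OF child low] by auto
      have s2: "2 * (2 :: nat) ^ b \<le> 2 ^ s"
        using power_increasing[of "Suc b" s "2 :: nat"] b(1) by simp
      have D2: "2 * (2 :: nat) ^ s \<le> E"
        using power_increasing[of "Suc s" D "2 :: nat"] s by simp
      have dvd: "2 ^ Suc b dvd E + 2 ^ s"
        using b(1) s by (intro dvd_add le_imp_power_dvd) auto
      have le: "E + 2 ^ s + 2 ^ b + 2 ^ b \<le> H"
        using s2 D2 E_less_H by linarith
      have plain: "tile_at D 0 x = None \<and> \<not> ((0 :: nat) = 0 \<and> (\<exists>s<D. x = E + 2 ^ s))"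
        if x: "E + 2 ^ s + 2 ^ b \<le> x" "x < E + 2 ^ s + 2 ^ b + 2 ^ b" for x
      proof -
        have "x \<noteq> E + 2 ^ s'" for s'
        proof
          assume "x = E + 2 ^ s'"
          then have "2 ^ s + 2 ^ b \<le> (2 :: nat) ^ s'" "(2 :: nat) ^ s' < 2 ^ s + 2 ^ b + 2 ^ b"
            using x by simp_all
          then have "(2 :: nat) ^ s < 2 ^ s'" "(2 :: nat) ^ s' < 2 ^ Suc s"
            using s2 zero_less_power[of "2 :: nat" b] unfolding power_Suc by linarith+
          then have "s < s'" "s' < Suc s"
            using power_less_imp_less_exp[of "2 :: nat"] by (metis one_less_numeral_iff semiring_norm(76))+
          then show False
            by simp
        qed
        moreover have "x \<noteq> E"
          using x by (metis add_is_0 le_add1 le_antisym nat_add_left_cancel_le add.assoc power_not_zero zero_neq_numeral add_left_cancel add_cancel_right_right)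
        ultimately show ?thesis
          by (auto simp: tile_at_def)
      qed
      have E0: "(0 :: nat) < E"
        by simp
      obtain t' where t': "z \<le> t'" "t' + 1 + b = K" "?e \<in> J t'" "f t' ?e = Cell i 0 (E + 2 ^ s + 2 ^ b)"
        by (rule block_call[OF i E0 dvd le plain]) blast+
      have fe: "f t' ?e = u"
        using t'(4) tree(1) b(2) by simp
      have "t < t'"
      proof (rule ccontr)
        assume "\<not> t < t'"
        then have "?e \<in> J t"
          using pb.J_mono[of t' t] t'(3) t(2) by auto
        then show False
          using pb.f_new[OF t(2,3)] t(4) by simp
      qed
      then have "u \<in> J t'"
        using pb.J_mono[of t t'] t(3) t'(2) by auto
      then show ?thesis
        using pb.f_new[of t' ?e] t' fe by simp
    qed
  next
    case (core k' \<tau>)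
    then show ?thesis
      by (simp add: tile_at_iff)
  next
    case (elem \<tau> s')
    then show ?thesis
      by (simp add: tile_at_iff)
  next
    case (tile i' \<tau> s')
    then have "s' = s"
      by simp
    moreover have "\<tau> = choice i' 0"
      using early_tile[of i' \<tau> t] tile t by simp
    ultimately show ?thesis
      using tile by (intro exI[of _ i']) simp
  qed
qed

lemma satisfiable_if_perfect: "satisfiable"
  unfolding satisfiable_def
proof (intro exI[of _ "\<lambda>i. choice i 0"] allI impI conjI)
  fix i assume i: "i < N"
  show "choice i 0 < E" "A i (choice i 0)"
    using choice[OF i, of 0] by simp_all
  fix s assume s: "s < D"
  show "bit (choice i 0) s = bit (choice (\<pi> s i) 0) s"
    by (rule partner_surj[OF s i]) (rule elem_called[OF _ s])
qed

end

lemma broadcast_graph_imp_satisfiable: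
  assumes "is_broadcast_graph graph"
  shows "satisfiable"
proof -
  have pv: "pverts graph = {v. vert v}"
    by (simp add: graph_def)
  have K: "clog (2 ^ (z + d) + 1) = z + d + 1"
  proof (rule antisym)
    show "clog (2 ^ (z + d) + 1) \<le> z + d + 1"
      by (subst clog_le_iff) auto
    have "\<not> clog (2 ^ (z + d) + 1) \<le> z + d"
      by (subst clog_le_iff) auto
    then show "z + d + 1 \<le> clog (2 ^ (z + d) + 1)"
      by simp
  qed
  have "(broadcast_step graph ^^ clog (card {v. vert v})) {Pendant} {v. vert v}"
    using assms finite_verts by (subst (asm) is_broadcast_graph_iff) (auto simp: pv intro!: exI[of _ Pendant])
  then have bc: "(broadcast_step graph ^^ (z + d + 1)) {Pendant} (pverts graph)"
    unfolding card_verts K pv .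
  show ?thesis
  proof (rule pendant_broadcast[OF _ _ _ _ _ _ bc])
    show "finite (pverts graph)" "card (pverts graph) = 2 ^ (z + d) + 1" "Pendant \<in> pverts graph"
      using finite_verts card_verts by (auto simp: pv)
    show "u \<in> pverts graph \<and> v \<in> pverts graph \<and> (v, u) \<in> parcs graph" if "(u, v) \<in> parcs graph" for u v
      using that by (auto simp: graph_def)
    show "v = Cell 0 0 0" if "(Pendant, v) \<in> parcs graph" for v
      using that by (cases v) (auto simp: arcs_iff arc_def hubbed_def)
    show "Cell 0 0 0 \<noteq> Pendant"
      by simp
    show satisfiable if "perfect_broadcast (parcs graph) (z + d) J f (Cell 0 0 0)" "J (z + d) = pverts graph - {Pendant}" for J f
      using satisfiable_if_perfect[OF refl that(1)] that(2) pv by simp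
  qed
qed

end

section \<open>Broadcasting from arbitrary originators\<close>

text \<open>Informing more than \<open>J\<close> does no harm. Schedules therefore mention only the
  vertices they rely on, and compose without keeping track of all others.\<close>

definition reaches :: "'a pair_pre_digraph \<Rightarrow> 'a set \<Rightarrow> nat \<Rightarrow> 'a set \<Rightarrow> bool" where
  "reaches G I t J \<longleftrightarrow> (\<exists>J'. (broadcast_step G ^^ t) I J' \<and> J \<subseteq> J')"

lemma broadcast_step_mono:
  assumes "broadcast_step G I I'" "I \<subseteq> X"
  shows "\<exists>X'. broadcast_step G X X' \<and> I' \<union> X \<subseteq> X'"
proof -
  obtain c where "\<forall>u v. c u = Some v \<longrightarrow> u \<in> I \<and> (u, v) \<in> parcs G" "I' = I \<union> {v. \<exists>u. c u = Some v}"
    using assms(1) by (auto simp: broadcast_step_def)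
  then have "broadcast_step G X (X \<union> {v. \<exists>u. c u = Some v})" "I' \<subseteq> X \<union> {v. \<exists>u. c u = Some v}"
    using assms(2) unfolding broadcast_step_def by blast+
  then show ?thesis
    by blast
qed

lemma broadcast_mono:
  "(broadcast_step G ^^ t) I J \<Longrightarrow> I \<subseteq> X \<Longrightarrow> \<exists>Y. (broadcast_step G ^^ t) X Y \<and> J \<union> X \<subseteq> Y"
proof (induction t arbitrary: J)
  case (Suc t)
  then obtain L where L: "(broadcast_step G ^^ t) I L" "broadcast_step G L J"
    by auto
  then obtain Y where Y: "(broadcast_step G ^^ t) X Y" "L \<union> X \<subseteq> Y"
    using Suc by blast
  then obtain Y' where "broadcast_step G Y Y'" "J \<union> Y \<subseteq> Y'"
    using broadcast_step_mono[OF L(2), of Y] by auto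
  then show ?case
    using Y by (intro exI[of _ Y']) auto
qed auto

lemma reaches_trans:
  assumes "reaches G I s J" "reaches G J t L"
  shows "reaches G I (s + t) (J \<union> L)"
proof -
  obtain J' where J': "(broadcast_step G ^^ s) I J'" "J \<subseteq> J'"
    using assms(1) by (auto simp: reaches_def)
  obtain L' where L': "(broadcast_step G ^^ t) J L'" "L \<subseteq> L'"
    using assms(2) by (auto simp: reaches_def)
  obtain Y where "(broadcast_step G ^^ t) J' Y" "L' \<union> J' \<subseteq> Y"
    using broadcast_mono[OF L'(1) J'(2)] by auto
  then show ?thesis
    using J' L' unfolding reaches_def relpowp_add by blast
qed

lemma reaches_mono: "reaches G I t J \<Longrightarrow> J' \<subseteq> J \<Longrightarrow> reaches G I t J'"
  unfolding reaches_def by blast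

lemma reaches_mono_left:
  assumes "reaches G I t J" "I \<subseteq> X"
  shows "reaches G X t J"
proof -
  obtain J' where J': "(broadcast_step G ^^ t) I J'" "J \<subseteq> J'"
    using assms(1) by (auto simp: reaches_def)
  then show ?thesis
    using broadcast_mono[OF J'(1) assms(2)] unfolding reaches_def by (meson le_sup_iff subset_trans)
qed

lemma reaches_trans': "reaches G I s J \<Longrightarrow> reaches G J t L \<Longrightarrow> reaches G I (s + t) L"
  using reaches_trans reaches_mono by (metis Un_upper2)

lemma reaches_0: "J \<subseteq> I \<Longrightarrow> reaches G I 0 J"
  unfolding reaches_def by auto

lemma reaches_calls:
  assumes "single_valued P" "\<And>u v. (u, v) \<in> P \<Longrightarrow> u \<in> I \<and> (u, v) \<in> parcs G" "J \<subseteq> I \<union> snd ` P"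
  shows "reaches G I 1 J"
proof -
  define c where "c u = (if \<exists>v. (u, v) \<in> P then Some (THE v. (u, v) \<in> P) else None)" for u
  have c: "c u = Some v \<longleftrightarrow> (u, v) \<in> P" for u v
  proof -
    have "(THE v. (u, v) \<in> P) = v" if "(u, v) \<in> P" for v
      using that assms(1) by (auto dest: single_valuedD)
    then show ?thesis
      by (auto simp: c_def)
  qed
  have "{v. \<exists>u. c u = Some v} = snd ` P"
    by (force simp: c)
  then have "broadcast_step G I (I \<union> snd ` P)"
    unfolding broadcast_step_def using assms(2) by (intro exI[of _ c]) (auto simp: c)
  then show ?thesis
    using assms(3) by (auto simp: reaches_def)
qed

lemma reaches_all:
  assumes "finite (pverts G)" "\<And>u v. (u, v) \<in> parcs G \<Longrightarrow> v \<in> pverts G" "reaches G I t (pverts G)" "I \<subseteq> pverts G"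
  shows "(broadcast_step G ^^ t) I (pverts G)"
proof -
  have "J \<subseteq> pverts G" if "(broadcast_step G ^^ t) I J" for J
    using that
  proof (induction t arbitrary: J)
    case (Suc t)
    then obtain L where "(broadcast_step G ^^ t) I L" "broadcast_step G L J"
      by auto
    moreover from this have "L \<subseteq> pverts G"
      by (intro Suc.IH)
    ultimately show ?case
      using assms(2) unfolding broadcast_step_def by blast
  qed (use assms(4) in auto)
  moreover obtain J where "(broadcast_step G ^^ t) I J" "pverts G \<subseteq> J"
    using assms(3) by (auto simp: reaches_def)
  ultimately show ?thesis
    by (metis subset_antisym)
qed

section \<open>Flooding the core from any originator\<close>

context gadget
begin

lemma pow2_lessD: "(2 :: nat) ^ a < 2 ^ b \<Longrightarrow> a < b"
  by simp

lemma core_arc: "u \<in> cores \<Longrightarrow> v \<in> cores \<Longrightarrow> u \<noteq> v \<Longrightarrow> (u, v) \<in> parcs graph"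
  by (simp add: arcs_iff arc_def cores_def)

lemma core_injection:
  assumes X: "X \<subseteq> cores" and R: "R \<subseteq> cores" "R \<inter> X = {}" "card R \<le> card X"
  obtains P where "single_valued P" "\<And>u v. (u, v) \<in> P \<Longrightarrow> u \<in> X \<and> v \<in> R \<and> (u, v) \<in> parcs graph" "snd ` P = R"
proof -
  obtain h where h: "h ` R \<subseteq> X" "inj_on h R"
    using card_le_inj[of R X] finite_subset[OF _ finite_cores] X R by auto
  define P where "P = (\<lambda>v. (h v, v)) ` R"
  show ?thesis
  proof
    show "single_valued P"
      using h(2) by (auto simp: P_def single_valued_def dest: inj_onD)
    show "snd ` P = R"
      by (force simp: P_def)
    show "u \<in> X \<and> v \<in> R \<and> (u, v) \<in> parcs graph" if "(u, v) \<in> P" for u v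
    proof -
      have uv: "u \<in> X" "v \<in> R"
        using that h(1) by (auto simp: P_def)
      then show ?thesis
        using core_arc[of u v] X R by blast
    qed
  qed
qed

text \<open>In a clique any larger set of at most twice the size can be informed in one step;
  \<open>X'\<close> prescribes vertices that have to be included.\<close>

lemma core_step:
  assumes X: "X \<subseteq> cores" "X' \<subseteq> cores" and n: "n \<le> 2 * card X" "card (X \<union> X') \<le> n" "n \<le> 2 ^ z"
  obtains S where "X \<union> X' \<subseteq> S" "S \<subseteq> cores" "card S = n" "reaches graph X 1 S"
proof -
  obtain S where S: "X \<union> X' \<subseteq> S" "S \<subseteq> cores" "card S = n"
    using exists_subset_between[of "X \<union> X'" n cores] X n card_cores finite_cores by auto
  have fin: "finite X" "finite S"
    using X S finite_subset[OF _ finite_cores] by auto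
  have "card (S - X) = n - card X"
    using S fin by (subst card_Diff_subset) auto
  then have "card (S - X) \<le> card X"
    using n by simp
  note le = this
  obtain P where P: "single_valued P" "\<And>u v. (u, v) \<in> P \<Longrightarrow> u \<in> X \<and> v \<in> S - X \<and> (u, v) \<in> parcs graph"
    "snd ` P = S - X"
    by (rule core_injection[OF X(1) _ _ le]) (use S(2) in auto)
  have "reaches graph X 1 S"
    by (rule reaches_calls[OF P(1)]) (use P in auto)
  then show ?thesis
    using that S by blast
qed

lemma core_grow:
  assumes "X \<subseteq> cores"
  shows "\<exists>S. X \<subseteq> S \<and> S \<subseteq> cores \<and> card S = min (2 ^ r * card X) (2 ^ z) \<and> reaches graph X r S"
proof (induction r)
  case 0
  have "card X \<le> 2 ^ z"
    using card_mono[OF finite_cores assms] card_cores by simp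
  then show ?case
    using assms by (intro exI[of _ X]) (simp add: reaches_0)
next
  case (Suc r)
  then obtain S where S: "X \<subseteq> S" "S \<subseteq> cores" "card S = min (2 ^ r * card X) (2 ^ z)" "reaches graph X r S"
    by auto
  obtain S' where S': "S \<subseteq> S'" "S' \<subseteq> cores" "card S' = min (2 ^ Suc r * card X) (2 ^ z)" "reaches graph S 1 S'"
    by (rule core_step[OF S(2) empty_subsetI, of "min (2 ^ Suc r * card X) (2 ^ z)"]) (use S(3) in auto)
  then show ?case
    using S reaches_trans'[OF S(4) S'(4)] by (intro exI[of _ S']) auto
qed

lemma pick_core:
  assumes "finite F" "card F < 16"
  obtains y where "y \<in> cores" "y \<notin> F"
proof -
  have "(2 :: nat) ^ 4 \<le> 2 ^ z"
    using z by (intro power_increasing) auto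
  then have "\<not> cores \<subseteq> F"
    using card_mono[OF assms(1), of cores] assms(2) card_cores by auto
  then show ?thesis
    using that by blast
qed

lemma many_cores: "16 \<le> (2 :: nat) ^ z"
  using power_increasing[of 4 z "2 :: nat"] z by simp

definition near :: "vertex \<Rightarrow> bool" where
  "near u \<longleftrightarrow> (u, Extra 0 0) \<in> parcs graph \<and> (u, Extra 1 0) \<in> parcs graph"

lemma hub_cores: "Extra 0 0 \<in> cores" "Extra 1 0 \<in> cores"
  using Y by (auto simp: cores_def)

lemma nearI:
  assumes "vert u" "off u \<noteq> 0" "off u \<noteq> 2 ^ (d - 1)" "off u \<noteq> 2 ^ (d - 2)" "off u \<noteq> 3 * 2 ^ (d - 2)"
  shows "near u"
proof -
  have "hubbed d j u" for j
    using assms by (simp add: hubbed_def)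
  then show ?thesis
    using assms(1) Y unfolding near_def arcs_iff arc_def by auto
qed

fun shifted :: "vertex \<Rightarrow> nat \<Rightarrow> vertex" where
  "shifted Pendant n = Pendant"
| "shifted (Cell i k x) n = Cell i k (x + n)"
| "shifted (Extra j x) n = Extra j (x + n)"

text \<open>The exceptional offsets are even, so the child at the next offset is odd and adjacent to
  both hubs. The vertex itself has a core neighbour: the root of its tree, or hub 0 for the offset
  \<open>3 * 2 ^ (d - 2)\<close>.\<close>

lemma near_or:
  assumes u: "vert u" "u \<noteq> Pendant" "off u \<noteq> 0"
  shows "near u \<or> (\<exists>s w. s \<in> cores \<and> (u, s) \<in> parcs graph \<and> (u, w) \<in> parcs graph \<and> near w \<and> \<not> core w)"
proof (cases "near u")
  case False
  let ?h = "2 ^ (d - 2)"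
  have h: "even (?h :: nat)" "2 ^ (d - 1) = 2 * (?h :: nat)" "H = 4 * ?h"
    using H_split d_bounds(4) by auto
  have Eh: "2 * E \<le> ?h"
    using power_increasing[of "Suc D" "d - 2" "2 :: nat"] d_bounds by auto
  have special: "off u = 2 * ?h \<or> off u = ?h \<or> off u = 3 * ?h"
    using nearI[OF u(1,3)] False h(2) by auto
  then have ev: "even (off u)" "off u + 1 < H"
    using h Eh d_bounds(2) by auto
  let ?w = "shifted u 1"
  have w: "vert ?w" "off ?w = off u + 1"
    using u ev(2) by (cases u; simp)+
  have odd: "off ?w \<noteq> m" if "even m" for m
    using that w(2) ev(1) by auto
  have "near ?w"
    by (rule nearI[OF w(1)]; rule odd) (use h d_bounds(4) in auto)
  moreover have "tree d (off u) (off u + 1)"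
    unfolding tree_def using ev(1) d_bounds(4) by (intro exI[of _ 0]) auto
  then have "link u ?w"
    using u(2,3) by (cases u) auto
  then have "(u, ?w) \<in> parcs graph"
    using u(1) w(1) by (simp add: arcs_iff arc_def)
  moreover have "\<exists>s. s \<in> cores \<and> (u, s) \<in> parcs graph"
  proof (cases "off u = 3 * ?h")
    case True
    then have "hubbed d 0 u"
      using h d_bounds(4) by (auto simp: hubbed_def)
    then have "(u, Extra 0 0) \<in> parcs graph"
      using u(1) Y by (auto simp: arcs_iff arc_def)
    then show ?thesis
      using hub_cores by blast
  next
    case False
    have t: "tree d 0 (off u)"
    proof -
      have "off u = 2 ^ (d - 1) \<or> off u = 2 ^ (d - 2)"
        using False special h(2) by auto
      then show ?thesis
        unfolding tree_0 using d_bounds(4) by (metis diff_less less_le_trans pos2 zero_less_one zero_less_numeral)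
    qed
    have "off u \<noteq> E"
      using special Eh d_bounds(2) by auto
    then show ?thesis
    proof (cases u)
      case (Cell i k x)
      then have "(u, Cell i k 0) \<in> parcs graph" "Cell i k 0 \<in> cores"
        using u t \<open>off u \<noteq> E\<close> by (auto simp: arcs_iff arc_def cores_def)
      then show ?thesis
        by blast
    next
      case (Extra j x)
      then have "(u, Extra j 0) \<in> parcs graph" "Extra j 0 \<in> cores"
        using u t by (auto simp: arcs_iff arc_def cores_def)
      then show ?thesis
        by blast
    qed (use u in simp)
  qed
  moreover have "\<not> core ?w"
    using w by (simp add: core_def)
  ultimately show ?thesis
    by blast
qed simp

text \<open>Four core vertices after three steps would fill the core exactly in step
  \<open>z + 1\<close>, with no call left for \<open>Pendant\<close>; the fifth one provides the
  slack. From a noncore vertex, two calls to hubs, or one call to the core and one to a neighbour of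
  both hubs, are just enough.\<close>

lemma five_cores:
  assumes u: "vert u" "u \<noteq> Pendant"
  shows "\<exists>X\<subseteq>cores. card X = 5 \<and> reaches graph {u} 3 X"
proof (cases "core u")
  case True
  then have c: "{u} \<subseteq> cores"
    using u by (simp add: cores_def)
  obtain X where X: "X \<subseteq> cores" "card X = 4" "reaches graph {u} 2 X"
    using core_grow[OF c, of 2] many_cores by auto
  obtain S where "X \<subseteq> S" "S \<subseteq> cores" "card S = 5" "reaches graph X 1 S"
    by (rule core_step[OF X(1) empty_subsetI, of 5]) (use X(2) many_cores in auto)
  then show ?thesis
    using reaches_trans'[OF X(3), of 1 S] by auto
next
  case False
  then have off: "off u \<noteq> 0"
    using u by (simp add: core_def)
  have nc: "u \<notin> cores"
    using False by (simp add: cores_def)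
  from near_or[OF u off] consider (near) "near u"
    | (far) s w where "s \<in> cores" "(u, s) \<in> parcs graph" "(u, w) \<in> parcs graph" "near w" "\<not> core w"
    by blast
  then show ?thesis
  proof cases
    case near
    let ?h0 = "Extra 0 0" and ?h1 = "Extra 1 0"
    obtain y where y: "y \<in> cores" "y \<notin> {?h0, ?h1}"
      by (rule pick_core[of "{?h0, ?h1}"]) auto
    have "reaches graph {u} 1 {u, ?h0}"
      by (rule reaches_calls[of "{(u, ?h0)}"]) (use near in \<open>auto simp: near_def single_valued_def\<close>)
    moreover have "reaches graph {u, ?h0} 1 {?h0, ?h1, y}"
      by (rule reaches_calls[of "{(u, ?h1), (?h0, y)}"])
        (use near nc y hub_cores core_arc[of ?h0 y] in \<open>auto simp: near_def single_valued_def\<close>)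
    ultimately have 2: "reaches graph {u} (1 + 1) {?h0, ?h1, y}"
      by (rule reaches_trans')
    have X: "{?h0, ?h1, y} \<subseteq> cores" "card {?h0, ?h1, y} = 3"
      using y hub_cores by auto
    obtain S where "S \<subseteq> cores" "card S = 5" "reaches graph {?h0, ?h1, y} 1 S"
      by (rule core_step[OF X(1) empty_subsetI, of 5]) (use X(2) many_cores in auto)
    then show ?thesis
      using reaches_trans'[OF 2, of 1 S] by (auto simp: numeral_3_eq_3)
  next
    case far
    define g where "g = (if s = Extra 0 0 then Extra 1 0 else Extra 0 0)"
    have g: "g \<in> cores" "(w, g) \<in> parcs graph" "g \<noteq> s"
      using hub_cores far(4) by (auto simp: g_def near_def)
    obtain y where y: "y \<in> cores" "y \<notin> {s, g}"
      by (rule pick_core[of "{s, g}"]) (auto simp: card_insert_if)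
    obtain y1 where y1: "y1 \<in> cores" "y1 \<notin> {s, g, y}"
      by (rule pick_core[of "{s, g, y}"]) (auto simp: card_insert_if)
    obtain y2 where y2: "y2 \<in> cores" "y2 \<notin> {s, g, y, y1}"
      by (rule pick_core[of "{s, g, y, y1}"]) (auto simp: card_insert_if)
    have w: "w \<notin> cores"
      using far(5) by (simp add: cores_def)
    have "reaches graph {u} 1 {u, s}"
      by (rule reaches_calls[of "{(u, s)}"]) (use far in \<open>auto simp: single_valued_def\<close>)
    moreover have "reaches graph {u, s} 1 {s, w, y}"
      by (rule reaches_calls[of "{(u, w), (s, y)}"])
        (use far nc y core_arc[of s y] in \<open>auto simp: single_valued_def\<close>)
    ultimately have 2: "reaches graph {u} (1 + 1) {s, w, y}"
      by (rule reaches_trans')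
    have "reaches graph {s, w, y} 1 {s, g, y, y1, y2}"
      by (rule reaches_calls[of "{(w, g), (s, y1), (y, y2)}"])
        (use far(1) w y y1 y2 g core_arc[of s y1] core_arc[of y y2] in \<open>auto simp: single_valued_def\<close>)
    from reaches_trans'[OF 2 this] have "reaches graph {u} 3 {s, g, y, y1, y2}"
      by (simp add: numeral_3_eq_3)
    moreover have "{s, g, y, y1, y2} \<subseteq> cores" "card {s, g, y, y1, y2} = 5"
      using far(1) g y y1 y2 by auto
    ultimately show ?thesis
      by blast
  qed
qed

text \<open>After \<open>z\<close> steps \<open>10 * 2 ^ (z - 4)\<close> core vertices are informed,
  among them the neighbour \<open>?a\<close> of \<open>Pendant\<close>. In the next step the others
  of them call the missing \<open>6 * 2 ^ (z - 4)\<close> core vertices, while \<open>?a\<close>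
  calls \<open>Pendant\<close>.\<close>

lemma cores_and_pendant:
  assumes u: "vert u"
  shows "reaches graph {u} (z + 1) (insert Pendant cores)"
proof -
  let ?a = "Cell 0 0 0"
  have a: "?a \<in> cores" "(?a, Pendant) \<in> parcs graph" "(Pendant, ?a) \<in> parcs graph"
    using N d_bounds(2) by (auto simp: cores_def arcs_iff arc_def)
  show ?thesis
  proof (cases "u = Pendant")
    case True
    obtain S where S: "S \<subseteq> cores" "card S = 2 ^ z" "reaches graph {?a} z S"
      using core_grow[of "{?a}" z] a(1) by auto
    have "S = cores"
      using S card_cores finite_cores by (intro card_subset_eq) auto
    moreover have "reaches graph {Pendant} 1 {?a, Pendant}"
      by (rule reaches_calls[of "{(Pendant, ?a)}"]) (use a in \<open>auto simp: single_valued_def\<close>)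
    moreover have "reaches graph {?a, Pendant} z cores"
      using S(3) \<open>S = cores\<close> by (auto intro: reaches_mono_left)
    ultimately have "reaches graph {Pendant} (1 + z) ({?a, Pendant} \<union> cores)"
      by (intro reaches_trans)
    then have "reaches graph {Pendant} (z + 1) ({?a, Pendant} \<union> cores)"
      by (simp add: add.commute)
    then show ?thesis
      unfolding True by (rule reaches_mono) blast
  next
    case False
    obtain X where X: "X \<subseteq> cores" "card X = 5" "reaches graph {u} 3 X"
      using five_cores[OF u False] by blast
    obtain X' where X': "X \<union> {?a} \<subseteq> X'" "X' \<subseteq> cores" "card X' = 10" "reaches graph X 1 X'"
    proof (rule core_step[OF X(1), of "{?a}" 10])
      show "card (X \<union> {?a}) \<le> 10"
        using card_Un_le[of X "{?a}"] X(2) by simp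
    qed (use a X(2) many_cores in auto)
    define m where "m = z - 4"
    have zm1: "z = m + 4"
      using z by (simp add: m_def)
    then have zm: "z = m + 4" "(2 :: nat) ^ z = 16 * 2 ^ m"
      by (simp_all add: power_add)
    obtain W where W: "X' \<subseteq> W" "W \<subseteq> cores" "card W = 10 * 2 ^ m" "reaches graph X' m W"
      using core_grow[OF X'(2), of m] X'(3) zm(2) by auto
    have aW: "?a \<in> W"
      using X' W by auto
    have finW: "finite W"
      using W finite_subset[OF _ finite_cores] by auto
    have "card (cores - W) = 6 * 2 ^ m"
      using card_Diff_subset[OF finW W(2)] W(3) card_cores zm(2) by simp
    moreover have "card (W - {?a}) = 10 * 2 ^ m - 1"
      using aW W(3) finW by simp
    moreover have "6 * 2 ^ m \<le> 10 * 2 ^ m - (1 :: nat)"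
      using one_le_power[of "2 :: nat" m] by linarith
    ultimately have le: "card (cores - W) \<le> card (W - {?a})"
      by simp
    obtain P where P: "single_valued P" "\<And>u v. (u, v) \<in> P \<Longrightarrow> u \<in> W - {?a} \<and> v \<in> cores - W \<and> (u, v) \<in> parcs graph"
      "snd ` P = cores - W"
      by (rule core_injection[OF _ _ _ le]) (use W(2) in auto)
    have "reaches graph W 1 (insert Pendant cores)"
    proof (rule reaches_calls[of "insert (?a, Pendant) P"])
      show "single_valued (insert (?a, Pendant) P)"
        using P(1,2) unfolding single_valued_def by blast
    qed (use P(2,3) a aW W(2) in auto)
    then have "reaches graph {u} (3 + (1 + (m + 1))) (insert Pendant cores)"
      using X(3) X'(4) W(4) by (intro reaches_trans')
    moreover have eq: "3 + (1 + (m + 1)) = z + 1"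
      by (simp add: zm(1))
    ultimately show ?thesis
      unfolding eq by blast
  qed
qed

text \<open>The integer part of the binary logarithm. For \<open>0 < n < E\<close> the offset
  \<open>E + n\<close> lies in the subtree of the element \<open>E + 2 ^ lg n\<close>.\<close>

definition lg :: "nat \<Rightarrow> nat" where
  "lg n = (LEAST s. n < 2 ^ Suc s)"

lemma lg_eq:
  assumes "2 ^ s \<le> n" "n < 2 ^ Suc s"
  shows "lg n = s"
  unfolding lg_def
proof (rule Least_equality)
  show "n < 2 ^ Suc s"
    by (rule assms(2))
  fix s' assume "n < 2 ^ Suc s'"
  then have "(2 :: nat) ^ s < 2 ^ Suc s'"
    using assms(1) by simp
  then have "s < Suc s'"
    by (rule power_less_imp_less_exp[rotated]) simp
  then show "s \<le> s'"
    by simp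
qed

lemma lg_bounds:
  assumes "0 < n"
  shows "2 ^ lg n \<le> n" "n < 2 ^ Suc (lg n)"
proof -
  have "n < 2 ^ Suc n"
    using less_exp[of n] unfolding power_Suc by linarith
  then show "n < 2 ^ Suc (lg n)"
    unfolding lg_def by (rule LeastI)
  show "2 ^ lg n \<le> n"
  proof (cases "lg n")
    case (Suc s)
    then have "\<not> n < 2 ^ Suc s"
      using not_less_Least[of s "\<lambda>s. n < 2 ^ Suc s"] by (simp add: lg_def)
    then show ?thesis
      using Suc by simp
  qed (use assms in simp)
qed

section \<open>The last \<open>d\<close> steps for a satisfying choice of tiles\<close>

context
  fixes \<kappa> :: "nat \<Rightarrow> nat"
  assumes \<kappa>: "\<And>i. i < N \<Longrightarrow> \<kappa> i < E" "\<And>i. i < N \<Longrightarrow> A i (\<kappa> i)"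
    "\<And>i s. i < N \<Longrightarrow> s < D \<Longrightarrow> bit (\<kappa> (\<pi> s i)) s = bit (\<kappa> i) s"
begin

text \<open>
  The broadcast in the last \<open>d\<close> steps is the standard one on the binomial trees, transported along
  an involution that exchanges the default tile 0 with the chosen one and, for the bits that are
  set in the chosen tiles, the subtrees of partner nodes.
\<close>

fun \<rho> :: "vertex \<Rightarrow> vertex" where
  "\<rho> (Cell i k x) =
     (if k = 0 \<and> x = E then tile i (\<kappa> i)
      else if \<kappa> i \<noteq> 0 \<and> k = \<kappa> i \<and> x = 1 then Cell i 0 E
      else if k = 0 \<and> E < x \<and> x < 2 * E \<and> bit (\<kappa> i) (lg (x - E)) then Cell (\<pi> (lg (x - E)) i) 0 x
      else Cell i k x)"
| "\<rho> v = v"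

lemma lg_less:
  assumes "E < x" "x < 2 * E"
  shows "lg (x - E) < D"
proof -
  have "(2 :: nat) ^ lg (x - E) < 2 ^ D"
    using lg_bounds(1)[of "x - E"] assms by linarith
  then show ?thesis
    by (rule power_less_imp_less_exp[rotated]) simp
qed

lemma \<rho>_vert: "vert v \<Longrightarrow> vert (\<rho> v)"
  using \<kappa>(1) partner(1)[OF lg_less] vert_tile E_less_H d_bounds by (cases v) auto

lemma \<rho>_\<rho>: "vert v \<Longrightarrow> \<rho> (\<rho> v) = v"
proof (cases v)
  case (Cell i k x)
  assume v: "vert v"
  then have i: "i < N" "k < E"
    using Cell by auto
  have E: "E \<noteq> 1" "E \<noteq> 0"
    using D by auto
  consider "k = 0" "x = E" | "\<kappa> i \<noteq> 0" "k = \<kappa> i" "x = 1" "\<not> (k = 0 \<and> x = E)"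
    | "k = 0" "E < x" "x < 2 * E" "bit (\<kappa> i) (lg (x - E))"
    | "\<not> (k = 0 \<and> x = E)" "\<not> (\<kappa> i \<noteq> 0 \<and> k = \<kappa> i \<and> x = 1)"
      "\<not> (k = 0 \<and> E < x \<and> x < 2 * E \<and> bit (\<kappa> i) (lg (x - E)))"
    by blast
  then show ?thesis
  proof cases
    case 3
    have s: "lg (x - E) < D"
      using lg_less 3 by blast
    have "bit (\<kappa> (\<pi> (lg (x - E)) i)) (lg (x - E))"
      using \<kappa>(3)[OF i(1) s] 3 by simp
    then show ?thesis
      using 3 Cell partner(2)[OF s i(1)] E by simp
  next
    case 4
    then have "\<rho> v = v"
      unfolding Cell \<rho>.simps by (simp only: if_False)
    then show ?thesis
      by simp
  qed (use Cell E in \<open>auto simp: tile_def\<close>)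
qed auto

lemma \<rho>_core: "core v \<Longrightarrow> \<rho> v = v"
  using d_bounds(2) by (cases v) auto

text \<open>The missing tree arc from \<open>Cell i 0 0\<close> to offset \<open>2 ^ D\<close>
  becomes the arc to the chosen tile, which is allowed; the arc to the chosen tile at offset 1
  becomes one to tile 0. Arcs from tile 0 to its elements become arcs from the chosen tile, bit by
  bit; all remaining tree arcs are kept or moved as a whole.\<close>

lemma \<rho>_arc:
  assumes v: "vert v" "v \<noteq> Pendant" "2 ^ Suc b dvd off v" "b < d" and w: "vert (shifted v (2 ^ b))"
  shows "(\<rho> v, \<rho> (shifted v (2 ^ b))) \<in> parcs graph"
proof -
  have "link (\<rho> v) (\<rho> (shifted v (2 ^ b)))"
  proof (cases v)
    case (Extra j x)
    then show ?thesis
      using v by (auto simp: tree_def)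
  next
    case (Cell i k x)
    then have i: "i < N" "k < E" "x + 2 ^ b < H" and dvd: "2 ^ Suc b dvd x"
      using v w by auto
    have t: "tree d x (x + 2 ^ b)"
      using dvd v(4) unfolding tree_def by blast
    have E1: "E \<noteq> 1" "E \<noteq> 0"
      using D by auto
    have b1: "(1 :: nat) \<le> 2 ^ b"
      by simp
    have not1: "x \<noteq> 1"
      using dvd by auto
    consider (core) "x = 0" | (tile) "x = E" "k = 0" | (elem) "E < x" "x < 2 * E" "k = 0"
      | (plain) "x \<noteq> 0" "\<not> (k = 0 \<and> E \<le> x \<and> x < 2 * E)"
      by linarith
    then show ?thesis
    proof cases
      case core
      then have \<rho>v: "\<rho> v = Cell i k 0"
        using Cell E1 by simp
      have not_elem: "\<not> (E < 2 ^ b \<and> 2 ^ b < 2 * E)"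
      proof
        assume "E < 2 ^ b \<and> 2 ^ b < 2 * E"
        then have "(2 :: nat) ^ D < 2 ^ b" "(2 :: nat) ^ b < 2 ^ Suc D"
          by simp_all
        then have "D < b" "b < Suc D"
          using pow2_lessD by blast+
        then show False
          by simp
      qed
      consider "k = 0" "2 ^ b = E" | "\<kappa> i \<noteq> 0" "k = \<kappa> i" "(2 :: nat) ^ b = 1" "k \<noteq> 0"
        | "\<not> (k = 0 \<and> 2 ^ b = E)" "\<not> (\<kappa> i \<noteq> 0 \<and> k = \<kappa> i \<and> (2 :: nat) ^ b = 1)"
        by metis
      then show ?thesis
      proof cases
        case 1
        then have "\<rho> (shifted v (2 ^ b)) = tile i (\<kappa> i)"
          using Cell core by simp
        then show ?thesis
          unfolding \<rho>v using 1(1) \<kappa>(2)[OF i(1)] by (auto simp: tile_def tile_at_def)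
      next
        case 2
        then have "\<rho> (shifted v (2 ^ b)) = Cell i 0 E"
          using Cell core E1 by simp
        then show ?thesis
          unfolding \<rho>v using 2(4) by (auto simp: tile_at_def)
      next
        case 3
        moreover have "\<not> (k = 0 \<and> E < 2 ^ b \<and> 2 ^ b < 2 * E \<and> bit (\<kappa> i) (lg (2 ^ b - E)))"
          using not_elem by blast
        ultimately have "\<rho> (Cell i k (2 ^ b)) = Cell i k (2 ^ b)"
          unfolding \<rho>.simps by (simp only: if_False)
        then show ?thesis
          unfolding \<rho>v using Cell core t 3(1) by simp
      qed
    next
      case tile
      have "b < D"
      proof (rule ccontr)
        assume "\<not> b < D"
        then have "2 ^ Suc D dvd (2 :: nat) ^ D"
          using dvd tile power_le_dvd[of "2 :: nat" "Suc b" "2 ^ D" "Suc D"] by simp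
        then show False
          by (simp add: nat_dvd_not_less)
      qed
      then have bD: "(2 :: nat) ^ b < E"
        by (intro power_strict_increasing) auto
      have "lg (2 ^ b) = b"
        by (rule lg_eq) auto
      then have "\<rho> (shifted v (2 ^ b)) = Cell (if bit (\<kappa> i) b then \<pi> b i else i) 0 (E + 2 ^ b)"
        using Cell tile bD by simp
      moreover have "\<rho> v = tile i (\<kappa> i)"
        using Cell tile by simp
      moreover obtain k' x' where kx: "tile i (\<kappa> i) = Cell i k' x'"
        by (cases "tile i (\<kappa> i)") (auto simp: tile_def split: if_splits)
      moreover have "tile_at D k' x' = Some (\<kappa> i)"
        using tile_at_tile[of k' x' "\<kappa> i" i] kx by simp
      ultimately show ?thesis
        using \<open>b < D\<close> by auto
    next
      case elem
      \<comment> \<open>Both ends lie in the subtree of the same element: adding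
        \<open>2 ^ b\<close> with \<open>b < s\<close> keeps the leading bit \<open>s\<close> of
        \<open>x - E\<close>. Hence both are moved to the same node.\<close>
      define s where "s = lg (x - E)"
      have m: "2 ^ s \<le> x - E" "x - E < 2 ^ Suc s"
        using lg_bounds[of "x - E"] elem by (simp_all add: s_def)
      have "Suc b \<le> D"
      proof (rule ccontr)
        assume "\<not> Suc b \<le> D"
        then have "2 ^ Suc D dvd x"
          using dvd power_le_dvd[of 2 "Suc b" x "Suc D"] by simp
        then have "2 ^ Suc D \<le> x"
          using elem by (intro dvd_imp_le) auto
        then show False
          using elem by simp
      qed
      then have dvdE: "2 ^ Suc b dvd E"
        by (rule le_imp_power_dvd)
      then have dvdm: "2 ^ Suc b dvd x - E"
        using dvd by (rule dvd_diff_nat[rotated])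
      then have "(2 :: nat) ^ Suc b < 2 ^ Suc s"
        using m elem dvd_imp_le[of "2 ^ Suc b" "x - E"] by linarith
      then have "Suc b < Suc s"
        by (rule power_less_imp_less_exp[rotated]) simp
      then have bs: "b < s"
        by simp
      have "(x - E) div 2 ^ s = 1"
        using m by (intro div_nat_eqI) auto
      then have "(x - E + 2 ^ b) div 2 ^ s = 1"
        using tree_div[OF dvdm bs] by simp
      then have m': "2 ^ s \<le> x - E + 2 ^ b" "x - E + 2 ^ b < 2 ^ Suc s"
        using div_block[of "2 ^ s" s 1 "x - E + 2 ^ b"] by simp_all
      have lg': "lg (x + 2 ^ b - E) = s"
        using lg_eq[OF m'] elem by simp
      have sD: "s < D"
        using lg_less elem by (simp add: s_def)
      then have "(2 :: nat) ^ Suc s \<le> E"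
        by (intro power_increasing) auto
      then have x': "x + 2 ^ b < 2 * E"
        using m' elem by linarith
      let ?i = "if bit (\<kappa> i) s then \<pi> s i else i"
      have "\<rho> v = Cell ?i 0 x" "\<rho> (shifted v (2 ^ b)) = Cell ?i 0 (x + 2 ^ b)"
        using Cell elem x' lg' E1 by (auto simp flip: s_def)
      then show ?thesis
        using t elem by simp
    next
      case plain
      have x2: "2 ^ Suc b \<le> x"
        using dvd plain(1) by (intro dvd_imp_le) auto
      \<comment> \<open>From a positive offset below \<open>2 ^ D\<close> no tree edge leads to
        \<open>2 ^ D\<close> or beyond, because the gap is a multiple of
        \<open>2 ^ Suc b\<close>.\<close>
      have "\<not> (k = 0 \<and> E \<le> x + 2 ^ b \<and> x + 2 ^ b < 2 * E)"
      proof
        assume *: "k = 0 \<and> E \<le> x + 2 ^ b \<and> x + 2 ^ b < 2 * E"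
        then have xE: "x < E"
          using plain by auto
        then have "(2 :: nat) ^ Suc b < 2 ^ D"
          using x2 by simp
        then have "Suc b < D"
          by (rule power_less_imp_less_exp[rotated]) simp
        then have "2 ^ Suc b dvd E"
          by (intro le_imp_power_dvd) simp
        then have "2 ^ Suc b dvd E - x"
          using dvd by (rule dvd_diff_nat)
        then have "2 ^ Suc b \<le> E - x"
          using xE by (intro dvd_imp_le) auto
        then show False
          using * b1 xE unfolding power_Suc by linarith
      qed
      moreover have "x + 2 ^ b \<noteq> 1"
        using b1 plain(1) by linarith
      ultimately have "\<rho> (Cell i k (x + 2 ^ b)) = Cell i k (x + 2 ^ b)"
        by auto
      moreover have "\<rho> v = Cell i k x"
        using Cell plain not1 by auto
      ultimately show ?thesis
        using Cell t plain(1) by simp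
    qed
  qed (use v in simp)
  then show ?thesis
    using \<rho>_vert[OF v(1)] \<rho>_vert[OF w] by (simp add: arcs_iff arc_def)
qed

definition level :: "nat \<Rightarrow> vertex set" where
  "level b = {v. vert v \<and> v \<noteq> Pendant \<and> 2 ^ b dvd off v}"

text \<open>In the standard broadcast the informed offsets are the multiples of a power of two that
  is halved in each step: an odd multiple of \<open>2 ^ b\<close> is called by the multiple of
  \<open>2 ^ Suc b\<close> just below it.\<close>

lemma level_step:
  assumes b: "b < d"
  shows "reaches graph (\<rho> ` level (Suc b)) 1 (\<rho> ` level b)"
proof -
  let ?S = "{v \<in> level (Suc b). vert (shifted v (2 ^ b))}"
  define P where "P = (\<lambda>v. (\<rho> v, \<rho> (shifted v (2 ^ b)))) ` ?S"
  have inj: "v = v'" if "\<rho> v = \<rho> v'" "vert v" "vert v'" for v v'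
    using that \<rho>_\<rho> by metis
  have P: "p \<in> P \<Longrightarrow> fst p \<in> \<rho> ` level (Suc b) \<and> p \<in> parcs graph" for p
    unfolding P_def using \<rho>_arc[OF _ _ _ b] by (auto simp: level_def)
  have "\<rho> v \<in> \<rho> ` level (Suc b) \<union> snd ` P" if v: "v \<in> level b" for v
  proof (cases "2 ^ Suc b dvd off v")
    case True
    then have "v \<in> level (Suc b)"
      using v by (simp add: level_def)
    then show ?thesis
      by blast
  next
    case False
    obtain q where q: "off v = 2 ^ b * q"
      using v by (auto simp: level_def elim: dvdE)
    then have "odd q"
      using False by auto
    then obtain r where r: "q = 2 * r + 1"
      by (elim oddE)
    then have x: "off v = 2 ^ Suc b * r + 2 ^ b"
      using q by (simp add: algebra_simps)
    define u where "u = (case v of Cell i k x \<Rightarrow> Cell i k (2 ^ Suc b * r) | Extra j x \<Rightarrow> Extra j (2 ^ Suc b * r) | Pendant \<Rightarrow> Pendant)"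
    have "u \<in> ?S" "shifted u (2 ^ b) = v"
      using v x by (cases v; simp add: u_def level_def)+
    then have "(\<rho> u, \<rho> v) \<in> P"
      unfolding P_def by (metis (mono_tags, lifting) image_eqI)
    then show ?thesis
      by force
  qed
  then show ?thesis
  proof (intro reaches_calls[of P])
    show "single_valued P"
      using inj unfolding single_valued_def P_def by (auto simp: level_def)
  qed (use P in force)+
qed

lemma reaches_all_levels: "reaches graph cores d ({v. vert v} - {Pendant})"
proof -
  have "reaches graph (\<rho> ` level d) r (\<rho> ` level (d - r))" if "r \<le> d" for r
    using that
  proof (induction r)
    case 0
    then show ?case
      by (simp add: reaches_0)
  next
    case (Suc r)
    then have "reaches graph (\<rho> ` level (d - r)) 1 (\<rho> ` level (d - Suc r))"
      using level_step[of "d - Suc r"] by (simp add: Suc_diff_Suc)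
    from reaches_trans'[OF _ this] Suc show ?case
      by simp
  qed
  from this[of d] have "reaches graph (\<rho> ` level d) d (\<rho> ` level 0)"
    by simp
  moreover have "\<rho> ` level d = cores"
  proof -
    have "v \<in> level d \<longleftrightarrow> v \<in> cores" for v
      by (cases v) (auto simp: level_def cores_def dest: dvd_imp_le)
    then have "level d = cores"
      by blast
    then show ?thesis
      using \<rho>_core by (simp add: cores_def)
  qed
  moreover have "{v. vert v} - {Pendant} \<subseteq> \<rho> ` level 0"
  proof
    fix v assume v: "v \<in> {v. vert v} - {Pendant}"
    then have "\<rho> v \<noteq> Pendant"
      by (cases v) (auto simp: tile_def)
    then have "\<rho> v \<in> level 0"
      using v \<rho>_vert by (simp add: level_def)
    then show "v \<in> \<rho> ` level 0"
      using v \<rho>_\<rho> by (metis DiffD1 image_eqI mem_Collect_eq)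
  qed
  ultimately show ?thesis
    using reaches_mono by simp
qed

end

lemma graph_pair_graph: "pair_graph graph"
proof (rule pair_graphI)
  have tree_irrefl: "\<not> tree d x x" for x
    using tree_pos by blast
  have "\<not> link u u" for u
    using tree_irrefl by (cases u) (auto simp: tile_at_def)
  then show "(u, u) \<notin> parcs graph" for u
    by (auto simp: arcs_iff arc_def hubbed_def)
qed (use finite_verts in \<open>auto simp: graph_def\<close>)

theorem broadcast_graph_iff_satisfiable: "is_broadcast_graph graph \<longleftrightarrow> satisfiable"
proof
  assume satisfiable
  then obtain \<kappa> where \<kappa>: "\<And>i. i < N \<Longrightarrow> \<kappa> i < E" "\<And>i. i < N \<Longrightarrow> A i (\<kappa> i)"
    "\<And>i s. i < N \<Longrightarrow> s < D \<Longrightarrow> bit (\<kappa> (\<pi> s i)) s = bit (\<kappa> i) s"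
    unfolding satisfiable_def by auto
  have pv: "pverts graph = {v. vert v}"
    by (simp add: graph_def)
  have "(broadcast_step graph ^^ clog (card (pverts graph))) {u} (pverts graph)" if u: "u \<in> pverts graph" for u
  proof (rule broadcast_mono_time)
    have "reaches graph {u} (z + 1 + d) (insert Pendant cores \<union> ({v. vert v} - {Pendant}))"
    proof (rule reaches_trans)
      show "reaches graph {u} (z + 1) (insert Pendant cores)"
        using cores_and_pendant u pv by simp
      show "reaches graph (insert Pendant cores) d ({v. vert v} - {Pendant})"
        by (rule reaches_mono_left[OF reaches_all_levels[OF \<kappa>]]) auto
    qed
    then have "reaches graph {u} (z + 1 + d) (pverts graph)"
      by (rule reaches_mono) (auto simp: pv)
    then show "(broadcast_step graph ^^ (z + 1 + d)) {u} (pverts graph)"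
      using finite_verts u by (intro reaches_all) (auto simp: graph_def)
    have "\<not> clog (2 ^ (z + d) + 1) \<le> z + d"
      by (subst clog_le_iff) auto
    then show "z + 1 + d \<le> clog (card (pverts graph))"
      unfolding pv card_verts by simp
  qed
  then show "is_broadcast_graph graph"
    using finite_verts by (subst is_broadcast_graph_iff) (auto simp: pv intro!: exI[of _ Pendant])
qed (rule broadcast_graph_imp_satisfiable)

end

section \<open>Turing machine computations as constraint systems\<close>

lemma exists_bits: "\<exists>n :: nat. n < 2 ^ D \<and> (\<forall>s<D. bit n s = f s)"
proof (induction D arbitrary: f)
  case 0
  then show ?case by auto
next
  case (Suc D)
  obtain n :: nat where n: "n < 2 ^ D" "\<forall>s<D. bit n s = f (Suc s)"
    using Suc[of "\<lambda>s. f (Suc s)"] by auto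
  let ?n = "of_bool (f 0) + 2 * n"
  have "bit ?n s = f s" if "s < Suc D" for s
    using that n(2) by (cases s) (auto simp: bit_Suc bit_0)
  moreover have "?n < 2 ^ Suc D"
    using n(1) by auto
  ultimately show ?case
    by blast
qed

text \<open>Digit \<open>r\<close> of \<open>n\<close> to the base \<open>2 ^ m\<close>.\<close>

definition part :: "nat \<Rightarrow> nat \<Rightarrow> nat \<Rightarrow> nat" where
  "part m r n = take_bit m (drop_bit (m * r) n)"

lemma bit_part: "bit (part m r n) b \<longleftrightarrow> b < m \<and> bit n (m * r + b)"
  by (simp add: part_def bit_take_bit_iff bit_drop_bit_eq)

lemma part_less: "part m r n < 2 ^ m"
  by (simp add: part_def)

lemma part_eqI:
  assumes "v < 2 ^ m" "\<And>b. b < m \<Longrightarrow> bit n (m * r + b) = bit v b"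
  shows "part m r n = v"
proof -
  have "v = take_bit m v"
    using assms(1) by (simp add: take_bit_nat_eq_self)
  then have "bit v b \<Longrightarrow> b < m" for b
    by (metis bit_take_bit_iff)
  then show ?thesis
    using assms(2) by (intro bit_eqI) (auto simp: bit_part)
qed

text \<open>
  The tableau of a computation, in which every tape is shifted such that its head always stands in
  column \<open>B\<close>. A cell holds the state, the symbols read by all heads (both constant along a row) and
  the symbols of all tapes in its column. Node \<open>2 c\<close> of the constraint system holds the contents
  of the four cells \<open>c\<close>, \<open>c + 1\<close>, \<open>c + 2\<close> and \<open>c + W + 1\<close> to which the local rule applies; node
  \<open>2 c + 1\<close> holds four copies of the content of cell \<open>c\<close>.
\<close>

type_synonym content = "nat \<times> nat list \<times> nat list"

definition cell_shift :: "nat \<Rightarrow> nat \<Rightarrow> nat" where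
  "cell_shift W r = (if r = 0 then 0 else if r = 1 then 1 else if r = 2 then 2 else W + 1)"

text \<open>Bit \<open>s\<close> belongs to part \<open>s div m\<close>; the partner of the node for
  cell \<open>c\<close> is the copy node of the cell shown in that part. A node whose partner would
  lie outside the tableau is its own partner, which makes the constraint void and keeps the map an
  involution.\<close>

definition cell_partner :: "nat \<Rightarrow> nat \<Rightarrow> nat \<Rightarrow> nat \<Rightarrow> nat \<Rightarrow> nat" where
  "cell_partner m W C s i =
     (if i mod 2 = 0
      then if i div 2 + cell_shift W (s div m) < C then 2 * (i div 2 + cell_shift W (s div m)) + 1 else i
      else if cell_shift W (s div m) \<le> i div 2 then 2 * (i div 2 - cell_shift W (s div m)) else i)"

lemma cell_partner:
  assumes "i < 2 * C"
  shows "cell_partner m W C s i < 2 * C" "cell_partner m W C s (cell_partner m W C s i) = i"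
proof -
  have i: "i = 2 * (i div 2) + i mod 2" "i mod 2 = 0 \<or> i mod 2 = 1"
    by auto
  show "cell_partner m W C s i < 2 * C"
    using assms i unfolding cell_partner_def by (auto; linarith)
  show "cell_partner m W C s (cell_partner m W C s i) = i"
    using assms i unfolding cell_partner_def by (auto; linarith)
qed

text \<open>With the heads fixed in one column the tapes move instead: if a head moves left, column
  \<open>p + 1\<close> of the next row shows the old column \<open>p\<close>, and so on. The flags
  tell which of the columns \<open>p\<close>, \<open>p + 1\<close>, \<open>p + 2\<close> is the head
  column, where the old symbol has been overwritten by \<open>s\<close>.\<close>

definition transition :: "tm \<Rightarrow> bool \<Rightarrow> bool \<Rightarrow> bool \<Rightarrow> content \<Rightarrow> content \<Rightarrow> content \<Rightarrow> nat \<times> nat list" where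
  "transition M a0 a1 a2 c0 c1 c2 =
     (case (c0, c1, c2) of ((_, _, ss0), (q, rs, ss1), (_, _, ss2)) \<Rightarrow>
        if q = tm_acc M \<or> q = tm_rej M then (q, ss1)
        else case tm_delta M q rs of (q', as) \<Rightarrow>
          (q', map (\<lambda>j. case as ! j of (s, d) \<Rightarrow>
             (case d of
                MLeft \<Rightarrow> if a0 then s else ss0 ! j
              | MStay \<Rightarrow> if a1 then s else ss1 ! j
              | MRight \<Rightarrow> if a2 then s else ss2 ! j)) [0..<tm_tapes M]))"

text \<open>Tape 1 is the nondeterministic one: its row 0 is any word of bits that starts in the
  head column, has length at most \<open>l\<close>, and is followed by blanks only. The latter is
  enforced locally by letting a blank at or right of the head column be followed by a blank.\<close>

definition initial :: "tm \<Rightarrow> bool list \<Rightarrow> nat \<Rightarrow> nat \<Rightarrow> nat \<Rightarrow> content \<Rightarrow> content \<Rightarrow> bool" where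
  "initial M x l T p c0 c1 \<longleftrightarrow>
     (case (c0, c1) of ((q, _, ss0), (_, _, ss1)) \<Rightarrow>
        q = tm_start M \<and>
        ss0 ! 0 = (if p < T + 1 then 0 else string_content x (int (p - (T + 1)))) \<and>
        ss0 ! 1 < 3 \<and> (p < T + 1 \<or> T + 1 + l \<le> p \<longrightarrow> ss0 ! 1 = 0) \<and>
        (T + 1 \<le> p \<and> p + 1 < 2 * T + 3 \<and> ss0 ! 1 = 0 \<longrightarrow> ss1 ! 1 = 0) \<and>
        (\<forall>j<tm_tapes M. 2 \<le> j \<longrightarrow> ss0 ! j = 0))"

text \<open>Cells are numbered row by row, so the conditions on the column prevent the rule from
  looking across the end of a row. The columns known to be correct shrink by one on either side per
  row; with \<open>2 * T + 3\<close> columns the head column \<open>T + 1\<close> is still among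
  them in row \<open>T\<close>.\<close>

definition rule :: "tm \<Rightarrow> bool list \<Rightarrow> nat \<Rightarrow> nat \<Rightarrow> nat \<Rightarrow> content \<Rightarrow> content \<Rightarrow> content \<Rightarrow> content \<Rightarrow> bool" where
  "rule M x l T c c0 c1 c2 c3 \<longleftrightarrow>
     (c < 2 * T + 3 \<longrightarrow> initial M x l T (c mod (2 * T + 3)) c0 c1) \<and>
     (c div (2 * T + 3) = T \<longrightarrow> fst c0 = tm_acc M) \<and>
     (c mod (2 * T + 3) + 1 < 2 * T + 3 \<longrightarrow> fst c0 = fst c1 \<and> fst (snd c0) = fst (snd c1)) \<and>
     (c mod (2 * T + 3) = T + 1 \<longrightarrow> fst (snd c0) = snd (snd c0)) \<and>
     (c div (2 * T + 3) < T \<and> c mod (2 * T + 3) + 2 < 2 * T + 3 \<longrightarrow>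
        (fst c3, snd (snd c3)) =
          transition M (c mod (2 * T + 3) = T + 1) (c mod (2 * T + 3) + 1 = T + 1)
            (c mod (2 * T + 3) + 2 = T + 1) c0 c1 c2)"

definition contents :: "tm \<Rightarrow> content set" where
  "contents M = {..<tm_states M} \<times> {rs. set rs \<subseteq> {..<tm_symbols M} \<and> length rs = tm_tapes M} \<times>
     {ss. set ss \<subseteq> {..<tm_symbols M} \<and> length ss = tm_tapes M}"

lemma finite_contents: "finite (contents M)"
  unfolding contents_def by (intro finite_cartesian_product finite_lists_length_eq) auto

definition allowed :: "tm \<Rightarrow> nat \<Rightarrow> (content \<Rightarrow> nat) \<Rightarrow> bool list \<Rightarrow> nat \<Rightarrow> nat \<Rightarrow> nat \<Rightarrow> nat \<Rightarrow> bool" where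
  "allowed M m e x l T i n \<longleftrightarrow>
     (if i mod 2 = 0
      then part m 0 n \<in> e ` contents M \<and>
        rule M x l T (i div 2) (inv_into (contents M) e (part m 0 n)) (inv_into (contents M) e (part m 1 n))
          (inv_into (contents M) e (part m 2 n)) (inv_into (contents M) e (part m 3 n))
      else part m 1 n = part m 0 n \<and> part m 2 n = part m 0 n \<and> part m 3 n = part m 0 n)"

definition config_ok :: "tm \<Rightarrow> config \<Rightarrow> bool" where
  "config_ok M c \<longleftrightarrow> fst c < tm_states M \<and> length (snd c) = tm_tapes M \<and>
     (\<forall>j<tm_tapes M. \<forall>i. fst (snd c ! j) i < tm_symbols M)"

lemma wf_delta:
  assumes "wf_tm M" "q < tm_states M" "length rs = tm_tapes M" "\<forall>r\<in>set rs. r < tm_symbols M"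
    and d: "tm_delta M q rs = (q', as)"
  shows "q' < tm_states M" "length as = tm_tapes M" "\<forall>(s, d)\<in>set as. s < tm_symbols M"
proof -
  have all: "\<forall>q rs. q < tm_states M \<and> length rs = tm_tapes M \<and> (\<forall>r\<in>set rs. r < tm_symbols M) \<longrightarrow>
      (case tm_delta M q rs of (q', as) \<Rightarrow>
        q' < tm_states M \<and> length as = tm_tapes M \<and> (\<forall>(s, d)\<in>set as. s < tm_symbols M))"
    using assms(1) unfolding wf_tm_def by (elim conjE)
  have "case tm_delta M q rs of (q', as) \<Rightarrow>
      q' < tm_states M \<and> length as = tm_tapes M \<and> (\<forall>(s, d)\<in>set as. s < tm_symbols M)"
    by (rule all[THEN spec, THEN spec, THEN mp, OF conjI[OF assms(2) conjI[OF assms(3,4)]]])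
  then show "q' < tm_states M" "length as = tm_tapes M" "\<forall>(s, d)\<in>set as. s < tm_symbols M"
    unfolding d by simp_all
qed

lemma config_ok_step:
  assumes "wf_tm M" "config_ok M c"
  shows "config_ok M (tm_step M c)"
proof (cases "halted M c")
  case False
  obtain q ts where c: "c = (q, ts)"
    by force
  obtain q' as where d: "tm_delta M q (map tape_read ts) = (q', as)"
    by force
  have ok: "q < tm_states M" "length ts = tm_tapes M" "\<And>j i. j < tm_tapes M \<Longrightarrow> fst (ts ! j) i < tm_symbols M"
    using assms(2) by (auto simp: config_ok_def c)
  have "tape_read (ts ! j) < tm_symbols M" if "j < tm_tapes M" for j
    using ok(3)[OF that] by (cases "ts ! j") (metis fst_conv tape_read.simps)
  note reads_ok = this
  have "\<forall>r\<in>set (map tape_read ts). r < tm_symbols M"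
  proof
    fix r assume "r \<in> set (map tape_read ts)"
    then obtain j where "j < length (map tape_read ts)" "map tape_read ts ! j = r"
      unfolding in_set_conv_nth by blast
    then show "r < tm_symbols M"
      using reads_ok[of j] ok(2) by simp
  qed
  note d' = wf_delta[OF assms(1) ok(1) _ this d, unfolded length_map, OF ok(2)]
  have "fst (tape_act (ts ! j) (as ! j)) i < tm_symbols M" if "j < tm_tapes M" for i j
  proof -
    obtain f h s m where "ts ! j = (f, h)" "as ! j = (s, m)"
      by (metis surj_pair)
    moreover have "s < tm_symbols M"
      using d'(2,3) that \<open>as ! j = (s, m)\<close> nth_mem[of j as] by auto
    ultimately show ?thesis
      using ok(3)[OF that, of i] by simp
  qed
  then show ?thesis
    using False d d' ok by (simp add: config_ok_def tm_step_def c)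
qed (use assms in \<open>simp add: tm_step_def\<close>)

section \<open>Correctness of the tableau\<close>

locale tableau =
  fixes M :: tm and m :: nat and e :: "content \<Rightarrow> nat" and x :: "bool list" and l T :: nat
  assumes wf: "wf_tm M" and two: "2 \<le> tm_tapes M"
    and e: "inj_on e (contents M)" "e ` contents M \<subseteq> {..<2 ^ m}" and m: "1 \<le> m"
begin

abbreviation B :: nat where "B \<equiv> T + 1"
abbreviation W :: nat where "W \<equiv> 2 * T + 3"
abbreviation C :: nat where "C \<equiv> (T + 1) * W"
abbreviation D :: nat where "D \<equiv> 4 * m"
abbreviation dec :: "nat \<Rightarrow> content" where "dec \<equiv> inv_into (contents M) e"

definition solvable :: bool where
  "solvable \<longleftrightarrow> (\<exists>\<kappa>. \<forall>i<2 * C. \<kappa> i < 2 ^ D \<and> allowed M m e x l T i (\<kappa> i) \<and>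
     (\<forall>s<D. bit (\<kappa> i) s = bit (\<kappa> (cell_partner m W C s i)) s))"

lemma dec_e: "c \<in> contents M \<Longrightarrow> dec (e c) = c"
  using e(1) by simp

lemma cell_index:
  assumes "t \<le> T" "p < W"
  shows "t * W + p < C" "(t * W + p) div W = t" "(t * W + p) mod W = p"
proof -
  have "Suc t * W \<le> C"
    using assms(1) by (intro mult_le_mono1) simp
  moreover have "t * W + p < Suc t * W"
    using assms(2) by simp
  ultimately show "t * W + p < C"
    by (rule less_le_trans[rotated])
  show "(t * W + p) div W = t" "(t * W + p) mod W = p"
    using assms(2) by simp_all
qed

definition row_symbols :: "bool list \<Rightarrow> nat \<Rightarrow> nat \<Rightarrow> nat list" where
  "row_symbols w t p = map (\<lambda>(f, h). f (h + int p - int B)) (snd (tm_run M [x, w] t))"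

definition cell :: "bool list \<Rightarrow> nat \<Rightarrow> nat \<Rightarrow> content" where
  "cell w t p = (fst (tm_run M [x, w] t), map tape_read (snd (tm_run M [x, w] t)), row_symbols w t p)"

lemma run_ok: "config_ok M (tm_run M [x, w] t)"
proof (induction t)
  case 0
  have "bit_symbol b < 3" for b
    by (cases b) auto
  then have sc: "string_content y i < 3" for y i
    by (simp add: string_content_def)
  then have "string_content y i < tm_symbols M" for y i
    using wf less_le_trans[of _ 3] by (auto simp: wf_tm_def)
  moreover have "fst (snd (tm_init M [x, w]) ! j) = string_content (([x, w] @ replicate (tm_tapes M - 2) []) ! j)"
    if "j < tm_tapes M" for j
  proof -
    have "j < length ([x, w] @ replicate (tm_tapes M - 2) [])"
      using that two by simp
    from nth_map[OF this, of "\<lambda>x. (string_content x, 0 :: int)"] show ?thesis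
      by (simp add: tm_init_def numeral_2_eq_2)
  qed
  ultimately have "fst (snd (tm_init M [x, w]) ! j) i < tm_symbols M" if "j < tm_tapes M" for i j
    using that by simp
  moreover have "length (snd (tm_init M [x, w])) = tm_tapes M"
    using two by (simp add: tm_init_def)
  moreover have "fst (tm_init M [x, w]) < tm_states M"
    using wf by (simp add: tm_init_def wf_tm_def)
  ultimately show ?case
    by (simp add: tm_run_def config_ok_def)
next
  case (Suc t)
  then show ?case
    using config_ok_step[OF wf] by (simp add: run_Suc)
qed

lemma row_length: "length (snd (tm_run M [x, w] t)) = tm_tapes M"
  using run_ok by (simp add: config_ok_def)

lemma cell_contents: "cell w t p \<in> contents M"
proof -
  note ok = run_ok[of w t]
  have "f i < tm_symbols M" if "(f, h) \<in> set (snd (tm_run M [x, w] t))" for f h i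
    using ok that unfolding config_ok_def by (metis fst_conv in_set_conv_nth)
  then show ?thesis
    using ok unfolding cell_def contents_def row_symbols_def config_ok_def by auto
qed

lemma read_row: "row_symbols w t B = map tape_read (snd (tm_run M [x, w] t))"
  unfolding row_symbols_def by auto

lemma transition_cell:
  "transition M (p = B) (p + 1 = B) (p + 2 = B) (q0, rs0, row_symbols w t p)
     (fst (tm_run M [x, w] t), map tape_read (snd (tm_run M [x, w] t)), row_symbols w t (p + 1))
     (q2, rs2, row_symbols w t (p + 2)) =
   (fst (tm_run M [x, w] (Suc t)), row_symbols w (Suc t) (p + 1))"
proof (cases "halted M (tm_run M [x, w] t)")
  case True
  then show ?thesis
    unfolding run_Suc row_symbols_def by (simp add: transition_def tm_step_def halted_def)
next
  case False
  obtain q ts where c: "tm_run M [x, w] t = (q, ts)"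
    by force
  obtain q' as where d: "tm_delta M q (map tape_read ts) = (q', as)"
    by force
  have len: "length ts = tm_tapes M"
    using row_length[of w t] c by simp
  have "\<forall>r\<in>set (map tape_read ts). r < tm_symbols M"
    using cell_contents[of w t 0] c by (auto simp: cell_def contents_def)
  then have las: "length as = tm_tapes M"
    using wf_delta(2)[OF wf _ _ _ d] len run_ok[of w t] c by (simp add: config_ok_def)
  have next_run: "tm_run M [x, w] (Suc t) = (q', map2 tape_act ts as)"
    using False d by (simp add: run_Suc tm_step_def c)
  have "map (\<lambda>j. case as ! j of (s, d) \<Rightarrow> (case d of
            MLeft \<Rightarrow> if p = B then s else row_symbols w t p ! j
          | MStay \<Rightarrow> if p + 1 = B then s else row_symbols w t (p + 1) ! j
          | MRight \<Rightarrow> if p + 2 = B then s else row_symbols w t (p + 2) ! j)) [0..<tm_tapes M] =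
      row_symbols w (Suc t) (p + 1)"
  proof (rule nth_equalityI)
    fix j assume "j < length (map (\<lambda>j. case as ! j of (s, d) \<Rightarrow> (case d of
            MLeft \<Rightarrow> if p = B then s else row_symbols w t p ! j
          | MStay \<Rightarrow> if p + 1 = B then s else row_symbols w t (p + 1) ! j
          | MRight \<Rightarrow> if p + 2 = B then s else row_symbols w t (p + 2) ! j)) [0..<tm_tapes M])"
    then have j: "j < tm_tapes M"
      by simp
    obtain f h where ts: "ts ! j = (f, h)"
      by force
    obtain s d where as: "as ! j = (s, d)"
      by force
    have row: "row_symbols w t r ! j = f (h + int r - int B)" for r
      using j len ts by (simp add: row_symbols_def c)
    have "row_symbols w (Suc t) (p + 1) ! j = (f(h := s)) (h + move_offset d + int (p + 1) - int B)"
      using j len las ts as by (simp add: row_symbols_def next_run add.assoc)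
    then show "map (\<lambda>j. case as ! j of (s, d) \<Rightarrow> (case d of
            MLeft \<Rightarrow> if p = B then s else row_symbols w t p ! j
          | MStay \<Rightarrow> if p + 1 = B then s else row_symbols w t (p + 1) ! j
          | MRight \<Rightarrow> if p + 2 = B then s else row_symbols w t (p + 2) ! j)) [0..<tm_tapes M] ! j =
        row_symbols w (Suc t) (p + 1) ! j"
      using j as row by (cases d) (auto simp: algebra_simps)
  qed (simp add: row_symbols_def next_run len las)
  note map_eq = this
  have nh: "(q = tm_acc M \<or> q = tm_rej M) = False"
    using False c by (simp add: halted_def)
  show ?thesis
    unfolding transition_def c fst_conv snd_conv prod.case nh if_False d map_eq
    by (simp add: next_run)
qed

lemma row_0: "row_symbols w 0 p = map (\<lambda>y. string_content y (int p - int B)) ([x, w] @ replicate (tm_tapes M - 2) [])"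
  by (simp add: row_symbols_def tm_run_def tm_init_def)

lemma fst_run_0: "fst (tm_run M [x, w] 0) = tm_start M"
  by (simp add: tm_run_def tm_init_def)

lemma row_0_nth: "j < tm_tapes M \<Longrightarrow> row_symbols w 0 p ! j =
    string_content (if j = 0 then x else if j = 1 then w else []) (int p - int B)"
  using two unfolding row_0 by (cases j; cases "j - 1") (auto simp: nth_Cons')

lemma solvable_if_accepting:
  assumes w: "length w \<le> l" and acc: "fst (tm_run M [x, w] T) = tm_acc M"
  shows solvable
proof -
  \<comment> \<open>Cells outside the tableau get the default code 0; the rule never inspects
    them.\<close>
  define v where "v c = (if c < C then e (cell w (c div W) (c mod W)) else 0)" for c
  have "e (cell w t p) < 2 ^ m" for t p
    using subsetD[OF e(2) imageI[OF cell_contents]] by simp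
  then have v_less: "v c < 2 ^ m" for c
    by (simp add: v_def)
  have v_dec: "dec (v c) = cell w (c div W) (c mod W)" if "c < C" for c
    using that dec_e[OF cell_contents] by (simp add: v_def)
  define g where "g i r = v (i div 2 + (if i mod 2 = 0 then cell_shift W r else 0))" for i r
  define \<kappa> where "\<kappa> i = (SOME n :: nat. n < 2 ^ D \<and> (\<forall>s<D. bit n s = bit (g i (s div m)) (s mod m)))" for i
  have \<kappa>: "\<kappa> i < 2 ^ D" "s < D \<Longrightarrow> bit (\<kappa> i) s = bit (g i (s div m)) (s mod m)" for i s
    using someI_ex[OF exists_bits[of D "\<lambda>s. bit (g i (s div m)) (s mod m)"]] unfolding \<kappa>_def[symmetric] by auto
  have part: "part m r (\<kappa> i) = g i r" if "r < 4" for i r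
  proof (rule part_eqI)
    show "g i r < 2 ^ m"
      by (simp add: g_def v_less)
    fix b assume b: "b < m"
    have "m * Suc r \<le> m * 4"
      using that by (intro mult_le_mono2) simp
    then have "m * r + b < D"
      using b unfolding mult_Suc_right by linarith
    then show "bit (\<kappa> i) (m * r + b) = bit (g i r) b"
      using \<kappa>(2)[of "m * r + b"] b by simp
  qed
  have allowed: "allowed M m e x l T i (\<kappa> i)" if i: "i < 2 * C" for i
  proof (cases "i mod 2 = 0")
    case False
    then show ?thesis
      by (simp add: allowed_def part g_def)
  next
    case True
    define c where "c = i div 2"
    define t where "t = c div W"
    define p where "p = c mod W"
    have c: "c < C" "c = t * W + p"
    proof -
      show "c < C"
        using i by (simp add: c_def)
      show "c = t * W + p"
        unfolding t_def p_def by (rule div_mult_mod_eq[symmetric])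
    qed
    have p: "p < W"
      by (simp add: p_def)
    have t: "t \<le> T"
      using c(1) unfolding t_def by (metis less_Suc_eq_le less_mult_imp_div_less Suc_eq_plus1)
    have parts: "part m r (\<kappa> i) = v (c + cell_shift W r)" if "r < 4" for r
      using part[OF that, of i] True by (simp add: g_def c_def)
    have c0: "dec (part m 0 (\<kappa> i)) = cell w t p" "part m 0 (\<kappa> i) \<in> e ` contents M"
      using parts[of 0] v_dec[OF c(1)] c(1) cell_contents by (auto simp: cell_shift_def v_def t_def p_def)
    have c1: "dec (part m 1 (\<kappa> i)) = cell w t (p + 1)" if "p + 1 < W"
      using parts[of 1] v_dec[of "c + 1"] cell_index[OF t that] by (simp add: cell_shift_def c(2) add.assoc)
    have c2: "dec (part m 2 (\<kappa> i)) = cell w t (p + 2)" if "p + 2 < W"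
      using parts[of 2] v_dec[of "c + 2"] cell_index[OF t that] by (simp add: cell_shift_def c(2) add.assoc)
    have c3: "dec (part m 3 (\<kappa> i)) = cell w (Suc t) (p + 1)" if "p + 1 < W" "t < T"
    proof -
      have eq: "c + cell_shift W 3 = Suc t * W + (p + 1)"
        by (simp add: cell_shift_def c(2))
      have "Suc t \<le> T"
        using that by simp
      note ci = cell_index[OF this that(1)]
      show ?thesis
        using parts[of 3] v_dec[OF ci(1)] unfolding eq ci by simp
    qed
    have "rule M x l T c (dec (part m 0 (\<kappa> i))) (dec (part m 1 (\<kappa> i))) (dec (part m 2 (\<kappa> i))) (dec (part m 3 (\<kappa> i)))"
      unfolding rule_def t_def[symmetric] p_def[symmetric] c0(1)
    proof (intro conjI impI)
      assume "c < W"
      then have t0: "t = 0"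
        by (simp add: t_def)
      obtain q1 rs1 ss1 where d1: "dec (part m 1 (\<kappa> i)) = (q1, rs1, ss1)"
        by (metis surj_pair)
      have r: "row_symbols w 0 p ! j = string_content (if j = 0 then x else if j = 1 then w else []) (int p - int B)"
        if "j < tm_tapes M" for j
        by (rule row_0_nth[OF that])
      have sc3: "string_content y i < 3" for y i
      proof -
        have "bit_symbol b < 3" for b
          by (cases b) auto
        then show ?thesis
          by (simp add: string_content_def)
      qed
      have bs: "bit_symbol b \<noteq> 0" for b
        by (cases b) auto
      have sym0: "row_symbols w 0 p ! 0 = (if p < T + 1 then 0 else string_content x (int (p - (T + 1))))"
        using r[of 0] two by (auto simp: of_nat_diff string_content_def)
      have sym1: "row_symbols w 0 p ! 1 < 3" "p < T + 1 \<or> T + 1 + l \<le> p \<longrightarrow> row_symbols w 0 p ! 1 = 0"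
      proof -
        have r1: "row_symbols w 0 p ! 1 = string_content w (int p - int B)"
          using r[of 1] two by simp
        then show "row_symbols w 0 p ! 1 < 3"
          using sc3 by simp
        show "p < T + 1 \<or> T + 1 + l \<le> p \<longrightarrow> row_symbols w 0 p ! 1 = 0"
          unfolding r1 using w by (auto simp: string_content_def)
      qed
      have symj: "\<forall>j<tm_tapes M. 2 \<le> j \<longrightarrow> row_symbols w 0 p ! j = 0"
        using r by (auto simp: string_content_def)
      have "ss1 ! 1 = 0" if h: "B \<le> p" "p + 1 < W" "row_symbols w 0 p ! 1 = 0"
      proof -
        have "\<not> int p - int B < int (length w)"
          using h r[of 1] two bs[of "w ! nat (int p - int B)"] by (auto simp: string_content_def split: if_splits)
        moreover have "ss1 = row_symbols w 0 (p + 1)"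
          using c1[OF h(2)] d1 t0 by (simp add: cell_def)
        ultimately show ?thesis
          using row_0_nth[of 1 w "p + 1"] two by (simp add: string_content_def)
      qed
      then show "initial M x l T p (cell w t p) (dec (part m 1 (\<kappa> i)))"
        unfolding initial_def d1 t0 cell_def prod.case
        using sym0 sym1 symj fst_run_0 by blast
    next
      assume "t = T"
      then show "fst (cell w t p) = tm_acc M"
        using acc by (simp add: cell_def)
    next
      assume "p + 1 < W"
      from c1[OF this] show "fst (cell w t p) = fst (dec (part m 1 (\<kappa> i)))"
        "fst (snd (cell w t p)) = fst (snd (dec (part m 1 (\<kappa> i))))"
        by (simp_all add: cell_def)
    next
      assume "p = T + 1"
      then show "fst (snd (cell w t p)) = snd (snd (cell w t p))"
        using read_row by (simp add: cell_def)
    next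
      assume "t < T \<and> p + 2 < W"
      then have tp: "t < T" "p + 1 < W" "p + 2 < W"
        by auto
      show "(fst (dec (part m 3 (\<kappa> i))), snd (snd (dec (part m 3 (\<kappa> i))))) =
        transition M (p = T + 1) (p + 1 = T + 1) (p + 2 = T + 1) (cell w t p) (dec (part m 1 (\<kappa> i))) (dec (part m 2 (\<kappa> i)))"
        unfolding c1[OF tp(2)] c2[OF tp(3)] c3[OF tp(2,1)]
        unfolding cell_def using transition_cell[of p _ _ w t] by simp
    qed
    then show ?thesis
      using True c0(2) by (simp add: allowed_def c_def)
  qed
  have "bit (\<kappa> i) s = bit (\<kappa> (cell_partner m W C s i)) s" if i: "i < 2 * C" and s: "s < D" for i s
  proof -
    \<comment> \<open>Both partners describe the same cell in this part: one shows it at the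
      distance \<open>cell_shift\<close>, the other is its copy node.\<close>
    have "g (cell_partner m W C s i) (s div m) = g i (s div m)"
      unfolding g_def cell_partner_def using i by auto
    then show ?thesis
      using \<kappa>(2)[OF s] by simp
  qed
  then show ?thesis
    unfolding solvable_def using \<kappa>(1) allowed by blast
qed

lemma accepting_if_solvable:
  assumes solvable
  shows "\<exists>w. length w \<le> l \<and> fst (tm_run M [x, w] T) = tm_acc M"
proof -
  obtain \<kappa> where \<kappa>: "\<And>i. i < 2 * C \<Longrightarrow> allowed M m e x l T i (\<kappa> i)"
    "\<And>i s. i < 2 * C \<Longrightarrow> s < D \<Longrightarrow> bit (\<kappa> i) s = bit (\<kappa> (cell_partner m W C s i)) s"
    using assms unfolding solvable_def by blast
  define v where "v c = part m 0 (\<kappa> (2 * c))" for c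
  \<comment> \<open>A bit travels from part \<open>r\<close> of node \<open>2 * c\<close> to part
    \<open>r\<close> of the copy node of the cell shown there, equals the bit in part 0 of that copy
    node, and from there agrees with part 0 of the node of that cell.\<close>
  have parts: "part m r (\<kappa> (2 * c)) = v (c + cell_shift W r)" if r: "r < 4" and c: "c + cell_shift W r < C" for r c
  proof (rule part_eqI)
    show "v (c + cell_shift W r) < 2 ^ m"
      by (simp add: v_def part_less)
    let ?c = "c + cell_shift W r"
    fix b assume b: "b < m"
    have "m * Suc r \<le> m * 4"
      using r by (intro mult_le_mono2) simp
    then have s: "m * r + b < D" "b < D"
      using b unfolding mult_Suc_right by linarith+
    have "bit (\<kappa> (2 * c)) (m * r + b) = bit (\<kappa> (2 * ?c + 1)) (m * r + b)"
      using \<kappa>(2)[of "2 * c" "m * r + b"] c s b by (simp add: cell_partner_def)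
    also have "\<dots> = bit (part m r (\<kappa> (2 * ?c + 1))) b"
      using b by (simp add: bit_part)
    also have "part m r (\<kappa> (2 * ?c + 1)) = part m 0 (\<kappa> (2 * ?c + 1))"
    proof -
      have "(2 * ?c + 1) mod 2 = 0 \<longleftrightarrow> False" "2 * ?c + 1 < 2 * C"
        using c by simp_all
      then have "part m 1 (\<kappa> (2 * ?c + 1)) = part m 0 (\<kappa> (2 * ?c + 1)) \<and>
          part m 2 (\<kappa> (2 * ?c + 1)) = part m 0 (\<kappa> (2 * ?c + 1)) \<and>
          part m 3 (\<kappa> (2 * ?c + 1)) = part m 0 (\<kappa> (2 * ?c + 1))"
        using \<kappa>(1)[of "2 * ?c + 1"] unfolding allowed_def by (simp only: if_False)
      moreover have "r = 0 \<or> r = 1 \<or> r = 2 \<or> r = 3"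
        using r by linarith
      ultimately show ?thesis
        by (elim disjE) (simp_all only:)
    qed
    also have "bit (part m 0 (\<kappa> (2 * ?c + 1))) b = bit (\<kappa> (2 * ?c)) b"
      using \<kappa>(2)[of "2 * ?c + 1" b] c s b by (simp add: cell_partner_def cell_shift_def bit_part)
    also have "\<dots> = bit (v ?c) b"
      using b by (simp add: v_def bit_part)
    finally show "bit (\<kappa> (2 * c)) (m * r + b) = bit (v ?c) b" .
  qed
  define u where "u t p = dec (v (t * W + p))" for t p
  have valid: "u t p \<in> contents M" if "t \<le> T" "p < W" for t p
  proof -
    have "v (t * W + p) \<in> e ` contents M"
      using \<kappa>(1)[of "2 * (t * W + p)"] cell_index[OF that] by (simp add: allowed_def v_def)
    then show ?thesis
      unfolding u_def by (rule inv_into_into)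
  qed
  have len: "length (snd (snd (u t p))) = tm_tapes M" if "t \<le> T" "p < W" for t p
    using valid[OF that] by (auto simp: contents_def)
  have rule: "rule M x l T (t * W + p) (u t p) (dec (part m 1 (\<kappa> (2 * (t * W + p)))))
      (dec (part m 2 (\<kappa> (2 * (t * W + p))))) (dec (part m 3 (\<kappa> (2 * (t * W + p)))))"
    if "t \<le> T" "p < W" for t p
    using \<kappa>(1)[of "2 * (t * W + p)"] cell_index[OF that] by (simp add: allowed_def u_def v_def)
  have R_init: "initial M x l T p (u 0 p) (dec (part m 1 (\<kappa> (2 * p))))" if "p < W" for p
    using rule[of 0 p] that unfolding rule_def by simp
  have R_acc: "fst (u T p) = tm_acc M" if "p < W" for p
    using rule[OF order_refl that] unfolding rule_def cell_index(2,3)[OF order_refl that] by blast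
  have R_read: "fst (snd (u t p)) = snd (snd (u t p))" if "t \<le> T" "p < W" "p = B" for t p
    using rule[OF that(1,2)] that(3) unfolding rule_def cell_index(2,3)[OF that(1,2)] by blast
  have R_row: "fst (u t p) = fst (dec (part m 1 (\<kappa> (2 * (t * W + p)))))"
    "fst (snd (u t p)) = fst (snd (dec (part m 1 (\<kappa> (2 * (t * W + p))))))" if "t \<le> T" "p < W" "p + 1 < W" for t p
    using rule[OF that(1,2)] that(3) unfolding rule_def cell_index(2,3)[OF that(1,2)] by blast+
  have R_trans: "(fst (dec (part m 3 (\<kappa> (2 * (t * W + p))))), snd (snd (dec (part m 3 (\<kappa> (2 * (t * W + p))))))) =
      transition M (p = B) (p + 1 = B) (p + 2 = B) (u t p) (dec (part m 1 (\<kappa> (2 * (t * W + p)))))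
        (dec (part m 2 (\<kappa> (2 * (t * W + p)))))" if "t \<le> T" "p < W" "t < T" "p + 2 < W" for t p
    using rule[OF that(1,2)] that(3,4) unfolding rule_def cell_index(2,3)[OF that(1,2)] by blast
  have u1: "dec (part m 1 (\<kappa> (2 * (t * W + p)))) = u t (p + 1)" if "t \<le> T" "p + 1 < W" for t p
    using parts[of 1 "t * W + p"] cell_index[OF that] by (simp add: u_def cell_shift_def add.assoc)
  have u2: "dec (part m 2 (\<kappa> (2 * (t * W + p)))) = u t (p + 2)" if "t \<le> T" "p + 2 < W" for t p
    using parts[of 2 "t * W + p"] cell_index[OF that] by (simp add: u_def cell_shift_def add.assoc)
  have u3: "dec (part m 3 (\<kappa> (2 * (t * W + p)))) = u (Suc t) (p + 1)" if "t < T" "p + 1 < W" for t p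
  proof -
    have eq: "t * W + p + cell_shift W 3 = Suc t * W + (p + 1)"
      by (simp add: cell_shift_def)
    have "Suc t \<le> T"
      using that by simp
    then show ?thesis
      using parts[of 3 "t * W + p"] cell_index[of "Suc t" "p + 1"] that(2) unfolding u_def eq by simp
  qed
  have row: "fst (snd (u t p)) = fst (snd (u t 0))" if "t \<le> T" "p < W" for t p
    using that(2)
  proof (induction p)
    case (Suc p)
    then show ?case
      using R_row(2)[OF that(1), of p] u1[OF that(1), of p] by simp
  qed simp
  note init = R_init
  \<comment> \<open>The length of the certificate: the first blank of tape 1 from the head column
    on. There are \<open>B + 1\<close> columns from the head column to the end of the row, hence the
    cutoff.\<close>
  define n where "n = (LEAST n. n = B + 1 \<or> snd (snd (u 0 (B + n))) ! 1 = 0)"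
  have n: "n = B + 1 \<or> snd (snd (u 0 (B + n))) ! 1 = 0"
    unfolding n_def by (rule LeastI[of _ "B + 1"]) simp
  have n_le: "n \<le> B + 1"
    unfolding n_def by (rule Least_le) simp
  have before: "snd (snd (u 0 (B + k))) ! 1 \<noteq> 0" if "k < n" for k
    using not_less_Least[of k "\<lambda>n. n = B + 1 \<or> snd (snd (u 0 (B + n))) ! 1 = 0"] that by (simp add: n_def)
  have after: "snd (snd (u 0 (B + k))) ! 1 = 0" if "n \<le> k" "k < B + 1" for k
    using that
  proof (induction k rule: dec_induct)
    case base
    then show ?case
      using n by simp
  next
    case (step k)
    then show ?case
      using init[of "B + k"] u1[of 0 "B + k"] unfolding initial_def by (auto split: prod.splits)
  qed
  define w where "w = map (\<lambda>k. snd (snd (u 0 (B + k))) ! 1 = 2) [0..<n]"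
  have "n \<le> l"
  proof (rule ccontr)
    assume "\<not> n \<le> l"
    then have "snd (snd (u 0 (B + l))) ! 1 = 0"
      using init[of "B + l"] n_le unfolding initial_def by (auto split: prod.splits)
    then show False
      using before[of l] \<open>\<not> n \<le> l\<close> by simp
  qed
  then have wl: "length w \<le> l"
    by (simp add: w_def)
  have start: "fst (u 0 p) = tm_start M \<and> snd (snd (u 0 p)) = row_symbols w 0 p" if p: "p < W" for p
  proof
    note ip = init[OF p]
    show "fst (u 0 p) = tm_start M"
      using ip unfolding initial_def by (auto split: prod.splits)
    show "snd (snd (u 0 p)) = row_symbols w 0 p"
    proof (rule nth_equalityI)
      show "length (snd (snd (u 0 p))) = length (row_symbols w 0 p)"
        using len[of 0 p] p row_length[of w 0] by (simp add: row_symbols_def)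
      fix j assume "j < length (snd (snd (u 0 p)))"
      then have j: "j < tm_tapes M"
        using len[of 0 p] p by simp
      consider "j = 0" | "j = 1" | "2 \<le> j"
        by linarith
      then show "snd (snd (u 0 p)) ! j = row_symbols w 0 p ! j"
      proof cases
        case 1
        then have "snd (snd (u 0 p)) ! j = (if p < B then 0 else string_content x (int (p - B)))"
          using ip unfolding initial_def by (auto split: prod.splits)
        then show ?thesis
          using row_0_nth[OF j, of w p] 1 by (auto simp: string_content_def of_nat_diff)
      next
        case 3
        then have "snd (snd (u 0 p)) ! j = 0"
          using ip j unfolding initial_def by (auto split: prod.splits)
        then show ?thesis
          using row_0_nth[OF j, of w p] 3 by (simp add: string_content_def)
      next
        case 2
        have lt3: "snd (snd (u 0 p)) ! 1 < 3" and low: "p < B \<Longrightarrow> snd (snd (u 0 p)) ! 1 = 0"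
          using ip unfolding initial_def by (auto split: prod.splits)
        show ?thesis
        proof (cases "p < B")
          case True
          then show ?thesis
            using low row_0_nth[OF j, of w p] 2 by (simp add: string_content_def)
        next
          case False
          define k where "k = p - B"
          have k: "p = B + k" "k < B + 1"
            using False p by (auto simp: k_def)
          have eq: "row_symbols w 0 p ! j = string_content w (int k)"
            using row_0_nth[OF j, of w p] 2 k(1) by simp
          show ?thesis
          proof (cases "k < n")
            case True
            then have "string_content w (int k) = bit_symbol (snd (snd (u 0 p)) ! 1 = 2)"
              by (simp add: string_content_def w_def k(1))
            moreover have "snd (snd (u 0 p)) ! 1 = 1 \<or> snd (snd (u 0 p)) ! 1 = 2"
              using before[OF True] lt3 k(1) by (simp add: less_Suc_eq numeral_eq_Suc)
            ultimately show ?thesis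
              using eq 2 by auto
          next
            case False
            then show ?thesis
              using after[of k] k eq 2 by (simp add: string_content_def w_def)
          qed
        qed
      qed
    qed
  qed
  \<comment> \<open>Induction over a trapezoid: row \<open>t\<close> is known to be correct only in
    the columns at distance at least \<open>t\<close> from both ends.\<close>
  have sim: "fst (u t p) = fst (tm_run M [x, w] t) \<and> snd (snd (u t p)) = row_symbols w t p"
    if "t \<le> T" "t \<le> p" "p + t < W" for t p
    using that
  proof (induction t arbitrary: p)
    case 0
    then show ?case
      using start[of p] fst_run_0 by simp
  next
    case (Suc t)
    then have t: "t < T" "t \<le> T"
      by auto
    define p' where "p' = p - 1"
    have p': "p = p' + 1" "t \<le> p'" "p' + 2 + t < W" "p' + 1 < W" "p' + 2 < W" "p' < W"
      using Suc.prems by (auto simp: p'_def)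
    have ih: "fst (u t r) = fst (tm_run M [x, w] t)" "snd (snd (u t r)) = row_symbols w t r"
      if "r \<in> {p', p' + 1, p' + 2, B}" for r
      using Suc.IH[of r] that p' t by auto
    \<comment> \<open>The symbols under the heads are checked in the head column; being constant
      along the row they are available to the local rule in every column.\<close>
    have "fst (snd (u t B)) = snd (snd (u t B))"
      by (rule R_read[OF t(2) _ refl]) simp
    then have rd: "fst (snd (u t r)) = map tape_read (snd (tm_run M [x, w] t))" if "r < W" for r
      using row[OF t(2), of B] row[OF t(2) that] ih(2)[of B] read_row by simp
    have uu: "u t r = (fst (u t r), fst (snd (u t r)), snd (snd (u t r)))" for r
      by simp
    have "(fst (u (Suc t) (p' + 1)), snd (snd (u (Suc t) (p' + 1)))) =
        transition M (p' = B) (p' + 1 = B) (p' + 2 = B) (u t p') (u t (p' + 1)) (u t (p' + 2))"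
      using R_trans[OF t(2) p'(6) t(1) p'(5)] unfolding u1[OF t(2) p'(4)] u2[OF t(2) p'(5)] u3[OF t(1) p'(4)] .
    also have "\<dots> = (fst (tm_run M [x, w] (Suc t)), row_symbols w (Suc t) (p' + 1))"
      using transition_cell[of p' "fst (u t p')" "fst (snd (u t p'))" w t "fst (u t (p' + 2))" "fst (snd (u t (p' + 2)))"]
        ih rd p' uu by (metis insertI1 insertI2)
    finally show ?case
      using p'(1) by simp
  qed
  have "fst (u T B) = tm_acc M"
    by (rule R_acc) simp
  then show ?thesis
    using sim[of T B] wl by auto
qed

theorem solvable_iff: "solvable \<longleftrightarrow> (\<exists>w. length w \<le> l \<and> fst (tm_run M [x, w] T) = tm_acc M)"
  using solvable_if_accepting accepting_if_solvable by blast

end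

section \<open>The reduction\<close>

lemma reaches_iso:
  assumes inj: "inj_on \<phi> (pverts G)" and arcs: "\<And>u v. (u, v) \<in> parcs G \<Longrightarrow> u \<in> pverts G \<and> v \<in> pverts G \<and> (\<phi> u, \<phi> v) \<in> parcs G'"
    and "I \<subseteq> pverts G" "(broadcast_step G ^^ t) I J"
  shows "reaches G' (\<phi> ` I) t (\<phi> ` J) \<and> J \<subseteq> pverts G"
  using assms(4)
proof (induction t arbitrary: J)
  case 0
  then show ?case
    using assms(3) by (auto simp: reaches_0)
next
  case (Suc t)
  then obtain L where L: "(broadcast_step G ^^ t) I L" "broadcast_step G L J"
    by auto
  then have IH: "reaches G' (\<phi> ` I) t (\<phi> ` L)" "L \<subseteq> pverts G"
    using Suc.IH by auto
  obtain c where c: "\<And>u v. c u = Some v \<Longrightarrow> u \<in> L \<and> (u, v) \<in> parcs G" "J = L \<union> {v. \<exists>u. c u = Some v}"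
    using L(2) by (auto simp: broadcast_step_def)
  define P where "P = {(\<phi> u, \<phi> v) | u v. c u = Some v}"
  have "reaches G' (\<phi> ` L) 1 (\<phi> ` J)"
  proof (rule reaches_calls[of P])
    show "single_valued P"
    proof (rule single_valuedI)
      fix a b b' assume "(a, b) \<in> P" "(a, b') \<in> P"
      then obtain u v u' v' where uv: "a = \<phi> u" "b = \<phi> v" "c u = Some v" "a = \<phi> u'" "b' = \<phi> v'" "c u' = Some v'"
        unfolding P_def by blast
      then have "u = u'"
        using inj c(1) IH(2) by (metis inj_onD subsetD)
      then show "b = b'"
        using uv by simp
    qed
    show "u \<in> \<phi> ` L \<and> (u, v) \<in> parcs G'" if "(u, v) \<in> P" for u v
      using that c(1) arcs by (auto simp: P_def)
    show "\<phi> ` J \<subseteq> \<phi> ` L \<union> snd ` P"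
      unfolding c(2) P_def by force
  qed
  then have "reaches G' (\<phi> ` I) (t + 1) (\<phi> ` J)"
    by (rule reaches_trans'[OF IH(1)])
  moreover have "J \<subseteq> pverts G"
    using c IH(2) arcs by blast
  ultimately show ?case
    by simp
qed

lemma is_broadcast_graph_iso_imp:
  fixes \<phi> :: "'a \<Rightarrow> 'b"
  assumes bij: "bij_betw \<phi> (pverts G) (pverts G')" and fin: "finite (pverts G)" "pverts G \<noteq> {}"
    and arcs: "\<And>u v. (u, v) \<in> parcs G \<Longrightarrow> u \<in> pverts G \<and> v \<in> pverts G \<and> (\<phi> u, \<phi> v) \<in> parcs G'"
    and arcs': "\<And>u v. (u, v) \<in> parcs G' \<Longrightarrow> v \<in> pverts G'"
    and bg: "is_broadcast_graph G"
  shows "is_broadcast_graph G'"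
proof -
  have V: "\<phi> ` pverts G = pverts G'" "inj_on \<phi> (pverts G)" "card (pverts G') = card (pverts G)"
    using bij bij_betw_same_card[OF bij] by (auto simp: bij_betw_def)
  have fin': "finite (pverts G')" "pverts G' \<noteq> {}"
    using fin V(1) by (metis finite_imageI, metis image_is_empty)
  let ?T = "clog (card (pverts G))"
  have "(broadcast_step G' ^^ ?T) {v} (pverts G')" if v: "v \<in> pverts G'" for v
  proof -
    obtain u where u: "u \<in> pverts G" "v = \<phi> u"
      using v V(1) by blast
    then have "(broadcast_step G ^^ ?T) {u} (pverts G)"
      using bg is_broadcast_graph_iff[OF fin] by simp
    with u have "reaches G' {v} ?T (pverts G')"
      using reaches_iso[OF V(2) arcs, of "{u}" ?T "pverts G"] V(1) by simp
    then show ?thesis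
      using fin' arcs' v by (intro reaches_all) auto
  qed
  then show ?thesis
    using is_broadcast_graph_iff[OF fin'] V(3) by simp
qed

text \<open>The arguments are separated by size: \<open>k\<close>, \<open>x\<close>,
  \<open>k'\<close>, \<open>x'\<close> range over constant sets and will be handled by tables, while
  \<open>i\<close> and \<open>i'\<close> grow with the input and will be handled by
  arithmetic.\<close>

definition cell_link :: "nat \<Rightarrow> (nat \<Rightarrow> nat \<Rightarrow> nat) \<Rightarrow> (nat \<Rightarrow> nat \<Rightarrow> bool) \<Rightarrow>
    nat \<Rightarrow> nat \<Rightarrow> nat \<Rightarrow> nat \<Rightarrow> nat \<Rightarrow> nat \<Rightarrow> bool" where
  "cell_link D \<pi> A k x k' x' i i' \<longleftrightarrow>
     (i = i' \<and> k = k' \<and> tree (depth D) x x' \<and> \<not> (k = 0 \<and> x = 0 \<and> x' = 2 ^ D)) \<or>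
     (i = i' \<and> x = 0 \<and> (\<exists>\<tau>. tile_at D k' x' = Some \<tau> \<and> (k \<noteq> 0 \<or> A i \<tau>))) \<or>
     (\<exists>\<tau>. tile_at D k x = Some \<tau> \<and>
        (\<exists>s<D. k' = 0 \<and> x' = 2 ^ D + 2 ^ s \<and> i' = (if bit \<tau> s then \<pi> s i else i)))"

definition hub_offset :: "nat \<Rightarrow> nat \<Rightarrow> nat \<Rightarrow> bool" where
  "hub_offset d j x \<longleftrightarrow> x \<noteq> 0 \<and> x \<noteq> 2 ^ (d - 1) \<and> x \<noteq> 2 ^ (d - 2) \<and> (x = 3 * 2 ^ (d - 2) \<longrightarrow> j = 0)"

text \<open>
  The arcs between numbered vertices: offset \<open>x\<close> of the tree with number \<open>c\<close> is vertex
  \<open>c * 2 ^ depth D + x\<close>, the trees of \<open>Cell i k 0\<close> come first, with \<open>c = i * 2 ^ D + k\<close>, and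
  \<open>Pendant\<close> is the last vertex.
\<close>

definition num_arc :: "nat \<Rightarrow> nat \<Rightarrow> nat \<Rightarrow> (nat \<Rightarrow> nat \<Rightarrow> nat) \<Rightarrow> (nat \<Rightarrow> nat \<Rightarrow> bool) \<Rightarrow> nat \<Rightarrow> nat \<Rightarrow> bool" where
  "num_arc N D Z \<pi> A a b \<longleftrightarrow>
     (a \<noteq> Z * 2 ^ depth D \<and> b \<noteq> Z * 2 ^ depth D \<and> a mod 2 ^ depth D = 0 \<and> b mod 2 ^ depth D = 0 \<and> a \<noteq> b) \<or>
     (a div 2 ^ depth D < N * 2 ^ D \<and> b div 2 ^ depth D < N * 2 ^ D \<and>
       cell_link D \<pi> A (a div 2 ^ depth D mod 2 ^ D) (a mod 2 ^ depth D) (b div 2 ^ depth D mod 2 ^ D) (b mod 2 ^ depth D)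
         (a div 2 ^ depth D div 2 ^ D) (b div 2 ^ depth D div 2 ^ D)) \<or>
     (a \<noteq> Z * 2 ^ depth D \<and> b \<noteq> Z * 2 ^ depth D \<and> \<not> a div 2 ^ depth D < N * 2 ^ D \<and>
       a div 2 ^ depth D = b div 2 ^ depth D \<and> tree (depth D) (a mod 2 ^ depth D) (b mod 2 ^ depth D)) \<or>
     (b = Z * 2 ^ depth D \<and> a = 0) \<or>
     (a mod 2 ^ depth D = 0 \<and>
       (a div 2 ^ depth D = N * 2 ^ D \<and> hub_offset (depth D) 0 (b mod 2 ^ depth D) \<or>
        a div 2 ^ depth D = N * 2 ^ D + 1 \<and> hub_offset (depth D) 1 (b mod 2 ^ depth D)))"

section \<open>The gadget graph on numbered vertices\<close>

context gadget
begin

abbreviation Z :: nat where "Z \<equiv> 2 ^ z"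

definition vtx :: "nat \<Rightarrow> vertex" where
  "vtx a = (if a = Z * H then Pendant
     else if a div H < N * E then Cell (a div H div E) (a div H mod E) (a mod H)
     else Extra (a div H - N * E) (a mod H))"

fun vnum :: "vertex \<Rightarrow> nat" where
  "vnum Pendant = Z * H"
| "vnum (Cell i k x) = (i * E + k) * H + x"
| "vnum (Extra j x) = (N * E + j) * H + x"

definition num_graph :: "nat pair_pre_digraph" where
  "num_graph = \<lparr>pverts = {..<Z * H + 1},
     parcs = {(a, b). a < Z * H + 1 \<and> b < Z * H + 1 \<and> (num_arc N D Z \<pi> A a b \<or> num_arc N D Z \<pi> A b a)}\<rparr>"

lemma vert_vtx: "a < Z * H + 1 \<Longrightarrow> vert (vtx a)"
proof -
  assume a: "a < Z * H + 1"
  show ?thesis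
  proof (cases "a = Z * H")
    case False
    then have "a < Z * H"
      using a by simp
    then have "a div H < N * E + Y"
      by (simp add: size less_mult_imp_div_less)
    moreover have "a div H div E < N" if "a div H < N * E"
      using that by (rule less_mult_imp_div_less)
    ultimately show ?thesis
      using False by (auto simp: vtx_def)
  qed (simp add: vtx_def)
qed

lemma vnum_vtx:
  assumes "a < Z * H + 1"
  shows "vnum (vtx a) = a"
proof -
  consider "a = Z * H" | "a \<noteq> Z * H" "a div H < N * E" | "a \<noteq> Z * H" "N * E \<le> a div H"
    by linarith
  then show ?thesis
  proof cases
    case 2
    then have "vnum (vtx a) = (a div H div E * E + a div H mod E) * H + a mod H"
      by (simp add: vtx_def)
    then show ?thesis
      by (simp only: div_mult_mod_eq)
  next
    case 3
    then have "vnum (vtx a) = (N * E + (a div H - N * E)) * H + a mod H"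
      by (simp add: vtx_def)
    also have "N * E + (a div H - N * E) = a div H"
      using 3 by simp
    finally show ?thesis
      by (simp only: div_mult_mod_eq)
  qed (simp add: vtx_def)
qed

lemma vnum_less: "vert v \<Longrightarrow> vnum v < Z * H + 1"
proof (cases v)
  case (Cell i k x)
  assume "vert v"
  then have "i < N" "k < E" "x < H"
    using Cell by auto
  then have "(i * E + k) * H + x < (N * E) * H"
    by (intro index_less) auto
  also have "\<dots> \<le> Z * H"
    using size by (intro mult_le_mono1) simp
  finally show ?thesis
    using Cell by simp
next
  case (Extra j x)
  assume "vert v"
  then have "(N * E + j) * H + x < Z * H"
    using Extra size by (intro index_less) auto
  then show ?thesis
    using Extra by simp
qed simp

lemma num_div_mod:
  "x < H \<Longrightarrow> (c * H + x) div H = c" "x < H \<Longrightarrow> (c * H + x) mod H = x"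
  "k < E \<Longrightarrow> (i * E + k) div E = i" "k < E \<Longrightarrow> (i * E + k) mod E = k"
  by simp_all

lemma vtx_vnum:
  assumes "vert v"
  shows "vtx (vnum v) = v"
proof (cases v)
  case Pendant
  then show ?thesis by (simp add: vtx_def)
next
  case (Cell i k x)
  then have b: "i < N" "k < E" "x < H"
    using assms by auto
  have c: "i * E + k < N * E"
    by (rule index_less[OF b(1,2)])
  have "vnum v div H = i * E + k" "vnum v mod H = x"
    using num_div_mod(1,2)[OF b(3)] Cell by simp_all
  moreover from this have "vnum v \<noteq> Z * H"
    using c size by auto
  ultimately show ?thesis
    using c num_div_mod(3,4)[OF b(2)] Cell by (simp add: vtx_def)
next
  case (Extra j x)
  then have b: "j < Y" "x < H"
    using assms by auto
  have "vnum v div H = N * E + j" "vnum v mod H = x"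
    using num_div_mod(1,2)[OF b(2)] Extra by simp_all
  moreover from this have "vnum v \<noteq> Z * H"
    using b size by auto
  ultimately show ?thesis
    using Extra by (simp add: vtx_def)
qed

lemma link_cells: "link (Cell i k x) (Cell i' k' x') \<longleftrightarrow> cell_link D \<pi> A k x k' x' i i'"
  unfolding link.simps cell_link_def by (intro arg_cong2[where f = "(\<or>)"] refl) blast

text \<open>The number \<open>Z * H\<close> of \<open>Pendant\<close> is a multiple of
  \<open>H\<close> whose quotient lies beyond all trees. It would pass for a core vertex or for the
  root of an extra tree, and is therefore excluded where the formula speaks of these.\<close>

lemma arc_vtx:
  assumes a: "a < Z * H + 1" and b: "b < Z * H + 1"
  shows "arc (vtx a) (vtx b) \<longleftrightarrow> num_arc N D Z \<pi> A a b"
proof -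
  have eq: "vtx a = vtx b \<longleftrightarrow> a = b"
    using vnum_vtx a b by metis
  have core: "core (vtx c) \<longleftrightarrow> c \<noteq> Z * H \<and> c mod H = 0" for c
    by (simp add: vtx_def)
  have off: "off (vtx c) = c mod H" for c
    by (simp add: vtx_def)
  have ZH: "Z * H div H = N * E + Y"
    by (simp add: size)
  have notP: "c \<noteq> Z * H" if "c div H < N * E + 2" for c
    using that Y ZH by auto
  have hubs: "(\<exists>j<2. vtx a = Extra j 0 \<and> hubbed d j (vtx b)) \<longleftrightarrow>
      a mod H = 0 \<and> (a div H = N * E \<and> hub_offset d 0 (b mod H) \<or> a div H = N * E + 1 \<and> hub_offset d 1 (b mod H))"
  proof -
    have E0: "vtx a = Extra j 0 \<longleftrightarrow> a mod H = 0 \<and> a div H = N * E + j" if "j < 2" for j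
      using notP[of a] that by (auto simp: vtx_def)
    have "(\<exists>j<2. Q j) \<longleftrightarrow> Q 0 \<or> Q 1" for Q :: "nat \<Rightarrow> bool"
      by (auto simp: less_2_cases_iff)
    then have ex: "(\<exists>j<2. vtx a = Extra j 0 \<and> hubbed d j (vtx b)) \<longleftrightarrow>
        vtx a = Extra 0 0 \<and> hubbed d 0 (vtx b) \<or> vtx a = Extra 1 0 \<and> hubbed d 1 (vtx b)" .
    have hub: "hubbed d j (vtx b) \<longleftrightarrow> hub_offset d j (b mod H)" for j
      by (simp add: hubbed_def hub_offset_def off)
    have E01: "vtx a = Extra 0 0 \<longleftrightarrow> a mod H = 0 \<and> a div H = N * E"
      "vtx a = Extra 1 0 \<longleftrightarrow> a mod H = 0 \<and> a div H = N * E + 1"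
      using E0[of 0] E0[of 1] by simp_all
    have "(\<exists>j<2. vtx a = Extra j 0 \<and> hubbed d j (vtx b)) \<longleftrightarrow>
        vtx a = Extra 0 0 \<and> hub_offset d 0 (b mod H) \<or> vtx a = Extra 1 0 \<and> hub_offset d 1 (b mod H)"
      using ex by (simp only: hub)
    then show ?thesis
      by (simp only: E01 conj_disj_distribL conj_assoc)
  qed
  have a0: "a div H div E = 0 \<and> a div H mod E = 0 \<and> a mod H = 0 \<longleftrightarrow> a = 0"
    by (metis div_0 div_mult_mod_eq mod_0 mult_0 add_0)
  have P: "N * E + Y \<noteq> 0"
    using Y by simp
  have "link (vtx a) (vtx b) \<longleftrightarrow>
     (a div H < N * E \<and> b div H < N * E \<and>
       cell_link D \<pi> A (a div H mod E) (a mod H) (b div H mod E) (b mod H) (a div H div E) (b div H div E)) \<or>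
     (a \<noteq> Z * H \<and> b \<noteq> Z * H \<and> \<not> a div H < N * E \<and> a div H = b div H \<and> tree d (a mod H) (b mod H)) \<or>
     (b = Z * H \<and> a = 0)"
  proof -
    have Pdiv: "\<not> c div H < N * E" if "c = Z * H" for c
      using that ZH by simp
    consider (1) "a = Z * H" | (2) "a \<noteq> Z * H" "a div H < N * E" | (3) "a \<noteq> Z * H" "\<not> a div H < N * E"
      by blast
    then show ?thesis
    proof cases
      case 1
      then show ?thesis
        using Pdiv[OF 1] by (simp add: vtx_def)
    next
      case 2
      consider (1) "b = Z * H" | (2) "b \<noteq> Z * H" "b div H < N * E" | (3) "b \<noteq> Z * H" "\<not> b div H < N * E"
        by blast
      then show ?thesis
      proof cases
        case 1
        then show ?thesis
          using 2 Pdiv[OF 1] a0 by (simp add: vtx_def)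
      next
        case b2: 2
        have "vtx a = Cell (a div H div E) (a div H mod E) (a mod H)"
          "vtx b = Cell (b div H div E) (b div H mod E) (b mod H)"
          using 2 b2 by (simp_all add: vtx_def)
        then show ?thesis
          using 2 b2 by (simp only: link_cells) simp
      next
        case 3
        then show ?thesis
          using 2 by (auto simp: vtx_def)
      qed
    next
      case 3
      have "a \<noteq> 0"
        using 3 N by (intro notI) simp
      consider (1) "b = Z * H" | (2) "b \<noteq> Z * H" "b div H < N * E" | (3) "b \<noteq> Z * H" "\<not> b div H < N * E"
        by blast
      then show ?thesis
        by cases (use 3 \<open>a \<noteq> 0\<close> in \<open>auto simp: vtx_def eq_diff_iff\<close>)
    qed
  qed
  then show ?thesis
    unfolding arc_def num_arc_def core eq hubs by blast
qed

lemma num_graph_pair_graph: "pair_graph num_graph"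
proof (rule pair_graphI)
  interpret G: pair_graph graph
    by (rule graph_pair_graph)
  show "(a, a) \<notin> parcs num_graph" for a
  proof
    assume "(a, a) \<in> parcs num_graph"
    then have "a < Z * H + 1" "num_arc N D Z \<pi> A a a"
      by (auto simp: num_graph_def)
    then have "(vtx a, vtx a) \<in> parcs graph"
      using arc_vtx vert_vtx by (simp add: arcs_iff)
    then show False
      using G.no_loops by force
  qed
qed (auto simp: num_graph_def)

lemma num_graph_iff: "is_broadcast_graph num_graph \<longleftrightarrow> is_broadcast_graph graph"
proof
  have pv: "pverts graph = {v. vert v}" "pverts num_graph = {..<Z * H + 1}"
    by (simp_all add: graph_def num_graph_def)
  have bij: "bij_betw vnum (pverts graph) (pverts num_graph)"
    unfolding pv by (rule bij_betw_byWitness[of _ vtx]) (use vtx_vnum vnum_vtx vnum_less vert_vtx in auto)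
  have bij': "bij_betw vtx (pverts num_graph) (pverts graph)"
    unfolding pv by (rule bij_betw_byWitness[of _ vnum]) (use vtx_vnum vnum_vtx vnum_less vert_vtx in auto)
  have ne: "pverts graph \<noteq> {}" "pverts num_graph \<noteq> {}"
    unfolding pv by (auto intro!: exI[of _ Pendant])
  show "is_broadcast_graph num_graph \<Longrightarrow> is_broadcast_graph graph"
    by (rule is_broadcast_graph_iso_imp[OF bij' _ ne(2)])
      (use arc_vtx vert_vtx in \<open>auto simp: num_graph_def graph_def\<close>)
  show "is_broadcast_graph graph \<Longrightarrow> is_broadcast_graph num_graph"
  proof (rule is_broadcast_graph_iso_imp[OF bij _ ne(1)])
    show "u \<in> pverts graph \<and> v \<in> pverts graph \<and> (vnum u, vnum v) \<in> parcs num_graph" if "(u, v) \<in> parcs graph" for u v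
    proof -
      have uv: "vert u" "vert v" "arc u v \<or> arc v u"
        using that by (auto simp: arcs_iff)
      then show ?thesis
        using arc_vtx[OF vnum_less vnum_less, of u v] arc_vtx[OF vnum_less vnum_less, of v u] vnum_less vtx_vnum
        by (auto simp: num_graph_def graph_def)
    qed
  qed (use finite_verts in \<open>auto simp: pv num_graph_def\<close>)
qed

end

section \<open>Formulas with parameters of constant size\<close>

lemma dfn_bounded:
  assumes "\<And>xs e. F xs e < B" "dfn k m F" "\<And>c. c < B \<Longrightarrow> dfn k m (\<lambda>xs e. of_bool (P c xs e))"
  shows "dfn k m (\<lambda>xs e. of_bool (P (F xs e) xs e))"
  using dfn_table_bool[OF assms(2), of B P] assms(1,3) by simp

text \<open>The quantifier is unrolled into finitely many disjuncts, so \<open>s\<close> becomes a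
  constant in each of them and may occur in operations such as \<open>bit\<close> on a fixed
  tile.\<close>

lemma dfn_ex_const:
  fixes B :: nat
  assumes "\<And>s. s < B \<Longrightarrow> dfn k m (\<lambda>xs e. of_bool (P s xs e))"
  shows "dfn k m (\<lambda>xs e. of_bool (\<exists>s<B. P s xs e))"
  using assms
proof (induction B)
  case 0
  then show ?case by (simp add: dfn_const)
next
  case (Suc B)
  have "dfn k m (\<lambda>xs e. of_bool (P B xs e \<or> (\<exists>s<B. P s xs e)))"
    by (rule dfn_disj) (simp_all add: Suc)
  moreover have "(\<exists>s<Suc B. P s xs e) \<longleftrightarrow> P B xs e \<or> (\<exists>s<B. P s xs e)" for xs e
    by (auto simp: less_Suc_eq)
  ultimately show ?case
    by simp
qed

lemma dfn_bool_table:
  assumes "dfn k m (\<lambda>xs e. of_bool (Q xs e))" "\<And>b. dfn k m (\<lambda>xs e. of_bool (P b xs e))"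
  shows "dfn k m (\<lambda>xs e. of_bool (P (Q xs e) xs e))"
proof -
  have "(of_bool (P (Q xs e) xs e) :: nat) = (if Q xs e then of_bool (P True xs e) else of_bool (P False xs e))" for xs e
    by simp
  then show ?thesis
    using dfn_if[OF assms(1) assms(2)[of True] assms(2)[of False]] by simp
qed

lemma dfn_pow_clog:
  assumes "dfn k m F" "\<And>xs e. 1 \<le> F xs e"
  shows "dfn k m (\<lambda>xs e. 2 ^ clog (F xs e))"
proof -
  have "dfn k m (\<lambda>xs e. 1 + (\<Sum>y<F xs e. of_bool (is_pow2 y) * y))"
    by (intro dfn_add dfn_const dfn_comp1[OF _ assms(1), of "\<lambda>xs n. \<Sum>y<n. of_bool (is_pow2 y) * y"]
        dfn_sum dfn_mult dfn_is_pow2 dfn_var) simp_all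
  then show ?thesis
    using pow_clog_eq_sum[OF assms(2)] by simp
qed

locale reduction =
  fixes M :: tm and p q :: "nat poly" and m :: nat and e :: "content \<Rightarrow> nat"
  assumes wf: "wf_tm M" and two: "2 \<le> tm_tapes M"
    and e: "inj_on e (contents M)" "e ` contents M \<subseteq> {..<2 ^ m}" and m: "1 \<le> m"
begin

definition l :: "bool list \<Rightarrow> nat" where "l x = poly p (length x)"
definition T :: "bool list \<Rightarrow> nat" where "T x = poly q (length x + l x)"
definition C :: "bool list \<Rightarrow> nat" where "C x = (T x + 1) * (2 * T x + 3)"
definition N :: "bool list \<Rightarrow> nat" where "N x = 2 * C x"
definition D :: nat where "D = 4 * m"
text \<open>The power of two leaves room for at least 18 extra trees, so that both hubs exist and
  \<open>z \<ge> 4\<close>; the core needs 16 vertices for the schedules from arbitrary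
  originators.\<close>

definition Z :: "bool list \<Rightarrow> nat" where "Z x = 2 ^ clog (N x * 2 ^ D + 18)"

abbreviation \<pi> :: "bool list \<Rightarrow> nat \<Rightarrow> nat \<Rightarrow> nat" where
  "\<pi> x \<equiv> cell_partner m (2 * T x + 3) (C x)"

abbreviation A :: "bool list \<Rightarrow> nat \<Rightarrow> nat \<Rightarrow> bool" where
  "A x \<equiv> allowed M m e x (l x) (T x)"

lemma tableau: "tableau M m e"
  by unfold_locales (use wf two e m in auto)

lemma gadget: "gadget (N x) D (Z x - N x * 2 ^ D) (clog (N x * 2 ^ D + 18)) (\<pi> x)"
proof
  have Z: "N x * 2 ^ D + 18 \<le> Z x"
    unfolding Z_def by (rule le_pow_clog) simp
  show "1 \<le> N x" "1 \<le> D"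
    using m by (simp_all add: N_def C_def D_def)
  show "2 \<le> Z x - N x * 2 ^ D" "N x * 2 ^ D + (Z x - N x * 2 ^ D) = 2 ^ clog (N x * 2 ^ D + 18)"
    using Z by (simp_all add: Z_def)
  have "\<not> clog (N x * 2 ^ D + 18) \<le> 3"
    by (subst clog_le_iff) auto
  then show "4 \<le> clog (N x * 2 ^ D + 18)"
    by simp
  show "\<pi> x s i < N x" "\<pi> x s (\<pi> x s i) = i" if "i < N x" for s i
    using cell_partner that by (simp_all add: N_def)
qed

definition vertices :: "bool list \<Rightarrow> nat" where
  "vertices x = Z x * 2 ^ depth D + 1"

definition arc_bit :: "bool list \<Rightarrow> nat \<Rightarrow> nat \<Rightarrow> bool" where
  "arc_bit x a b \<longleftrightarrow> num_arc (N x) D (Z x) (\<pi> x) (A x) a b"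

definition reduct :: "bool list \<Rightarrow> bool list" where
  "reduct x = map (\<lambda>j. arc_bit x (j div vertices x) (j mod vertices x) \<or> arc_bit x (j mod vertices x) (j div vertices x))
     [0..<vertices x * vertices x]"

lemma reduct_iff: "reduct x \<in> BROADCAST_GRAPH \<longleftrightarrow> (\<exists>w. length w \<le> l x \<and> fst (tm_run M [x, w] (T x)) = tm_acc M)"
proof -
  interpret tb: tableau M m e x "l x" "T x"
    by (rule tableau)
  interpret G: gadget "N x" D "Z x - N x * 2 ^ D" "clog (N x * 2 ^ D + 18)" "\<pi> x" "A x"
    by (rule gadget)
  let ?G = G.num_graph
  have V: "pverts ?G = {..<vertices x}"
    by (simp add: G.num_graph_def vertices_def Z_def)
  have pos: "0 < vertices x"
    by (simp add: vertices_def)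
  have arcs: "(a, b) \<in> parcs ?G \<longleftrightarrow> arc_bit x a b \<or> arc_bit x b a" if "a < vertices x" "b < vertices x" for a b
    using that by (simp add: G.num_graph_def arc_bit_def vertices_def Z_def)
  have "adjacency_string ?G = map (\<lambda>j. (j div vertices x, j mod vertices x) \<in> parcs ?G) [0..<vertices x * vertices x]"
    by (rule adjacency_string_eq) (simp add: V)
  also have "\<dots> = reduct x"
    unfolding reduct_def
  proof (rule map_cong[OF refl])
    fix j assume "j \<in> set [0..<vertices x * vertices x]"
    then have "j div vertices x < vertices x" "j mod vertices x < vertices x"
      by (simp_all add: less_mult_imp_div_less pos)
    then show "((j div vertices x, j mod vertices x) \<in> parcs ?G) =
        (arc_bit x (j div vertices x) (j mod vertices x) \<or> arc_bit x (j mod vertices x) (j div vertices x))"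
      by (rule arcs)
  qed
  finally have "reduct x \<in> BROADCAST_GRAPH \<longleftrightarrow> is_broadcast_graph ?G"
    using adjacency_string_in_BROADCAST_GRAPH[OF G.num_graph_pair_graph V] by (simp add: vertices_def)
  also have "\<dots> \<longleftrightarrow> G.satisfiable"
    using G.num_graph_iff G.broadcast_graph_iff_satisfiable by simp
  also have "\<dots> \<longleftrightarrow> tb.solvable"
    unfolding G.satisfiable_def tb.solvable_def by (simp add: N_def D_def C_def)
  finally show ?thesis
    using tb.solvable_iff by simp
qed

lemma dfn_l: "dfn 1 k (\<lambda>xs e. l (xs ! 0))"
  unfolding l_def by (intro dfn_intros dfn_length) simp

lemma dfn_T: "dfn 1 k (\<lambda>xs e. T (xs ! 0))"
  unfolding T_def by (intro dfn_intros dfn_length dfn_l) simp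

lemma dfn_C: "dfn 1 k (\<lambda>xs e. C (xs ! 0))"
  unfolding C_def by (intro dfn_const dfn_intros dfn_T)

lemma dfn_N: "dfn 1 k (\<lambda>xs e. N (xs ! 0))"
  unfolding N_def by (intro dfn_const dfn_mult dfn_C)

lemma dfn_Z: "dfn 1 k (\<lambda>xs e. Z (xs ! 0))"
  unfolding Z_def by (rule dfn_pow_clog) (intro dfn_const dfn_add dfn_mult dfn_N, simp)

lemma dfn_vertices: "dfn 1 k (\<lambda>xs e. vertices (xs ! 0))"
  unfolding vertices_def by (intro dfn_const dfn_add dfn_mult dfn_Z)

lemma dfn_cell_shift:
  assumes "dfn 1 k F"
  shows "dfn 1 k (\<lambda>xs e. cell_shift (F xs e) r)"
  unfolding cell_shift_def by (intro dfn_const dfn_if dfn_add assms)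

lemma dfn_partner:
  assumes "dfn 1 k F"
  shows "dfn 1 k (\<lambda>xs e. \<pi> (xs ! 0) s (F xs e))"
  unfolding cell_partner_def
  by (intro dfn_const dfn_if dfn_less dfn_le dfn_eq dfn_add dfn_mult dfn_diff dfn_div dfn_mod dfn_cell_shift dfn_T dfn_C assms)

lemma dfn_initial:
  assumes P: "dfn 1 k F"
  shows "dfn 1 k (\<lambda>xs e. of_bool (initial M (xs ! 0) (l (xs ! 0)) (T (xs ! 0)) (F xs e) c0 c1))"
  unfolding initial_def case_prod_unfold
  by (intro dfn_const dfn_conj dfn_imp dfn_disj dfn_eq dfn_if dfn_less dfn_le dfn_add dfn_mult dfn_diff
      dfn_symbol dfn_T dfn_l assms) simp_all

lemma dfn_rule:
  assumes F: "dfn 1 k F"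
  shows "dfn 1 k (\<lambda>xs e. of_bool (rule M (xs ! 0) (l (xs ! 0)) (T (xs ! 0)) (F xs e) c0 c1 c2 c3))"
proof -
  let ?p = "\<lambda>xs e. F xs e mod (2 * T (xs ! 0) + 3)"
  have p: "dfn 1 k ?p"
    by (intro dfn_const dfn_mod dfn_add dfn_mult dfn_T F)
  have B: "dfn 1 k (\<lambda>xs e. T (xs ! 0) + 1)"
    by (intro dfn_const dfn_add dfn_T)
  have q: "dfn 1 k (\<lambda>xs e. of_bool (?p xs e = T (xs ! 0) + 1))"
    "dfn 1 k (\<lambda>xs e. of_bool (?p xs e + 1 = T (xs ! 0) + 1))"
    "dfn 1 k (\<lambda>xs e. of_bool (?p xs e + 2 = T (xs ! 0) + 1))"
    by (intro dfn_eq dfn_add dfn_const p B)+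
  \<comment> \<open>For fixed contents and fixed flags the comparison with the transition function
    is a constant; the three flags are then replaced by tests one after the other.\<close>
  let ?R = "\<lambda>b0 b1 b2. (fst c3, snd (snd c3)) = transition M b0 b1 b2 c0 c1 c2"
  have "dfn 1 k (\<lambda>xs e. of_bool (?R b0 b1 (?p xs e + 2 = T (xs ! 0) + 1)))" for b0 b1
    by (rule dfn_bool_table[where P = "\<lambda>b xs e. ?R b0 b1 b", OF q(3) dfn_const])
  then have "dfn 1 k (\<lambda>xs e. of_bool (?R b0 (?p xs e + 1 = T (xs ! 0) + 1) (?p xs e + 2 = T (xs ! 0) + 1)))" for b0
    by (rule dfn_bool_table[where P = "\<lambda>b xs e. ?R b0 b (?p xs e + 2 = T (xs ! 0) + 1)", OF q(2)])
  then have trans: "dfn 1 k (\<lambda>xs e. of_bool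
      (?R (?p xs e = T (xs ! 0) + 1) (?p xs e + 1 = T (xs ! 0) + 1) (?p xs e + 2 = T (xs ! 0) + 1)))"
    by (rule dfn_bool_table[where P =
          "\<lambda>b xs e. ?R b (?p xs e + 1 = T (xs ! 0) + 1) (?p xs e + 2 = T (xs ! 0) + 1)", OF q(1)])
  show ?thesis
    unfolding rule_def
    by (intro dfn_const dfn_conj dfn_imp dfn_eq dfn_less dfn_initial trans p dfn_add dfn_mult dfn_div dfn_T F)
qed

lemma dfn_allowed:
  assumes F: "dfn 1 k F"
  shows "dfn 1 k (\<lambda>xs e. of_bool (A (xs ! 0) (F xs e) \<tau>))"
proof -
  have "dfn 1 k (\<lambda>xs e'. if F xs e' mod 2 = 0
      then of_bool (part m 0 \<tau> \<in> e ` contents M \<and>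
        rule M (xs ! 0) (l (xs ! 0)) (T (xs ! 0)) (F xs e' div 2) (inv_into (contents M) e (part m 0 \<tau>))
          (inv_into (contents M) e (part m 1 \<tau>)) (inv_into (contents M) e (part m 2 \<tau>)) (inv_into (contents M) e (part m 3 \<tau>)))
      else of_bool (part m 1 \<tau> = part m 0 \<tau> \<and> part m 2 \<tau> = part m 0 \<tau> \<and> part m 3 \<tau> = part m 0 \<tau>))"
    by (intro dfn_const dfn_if dfn_eq dfn_mod dfn_conj dfn_rule dfn_div F)
  moreover have "(of_bool (A x i \<tau>) :: nat) = (if i mod 2 = 0
      then of_bool (part m 0 \<tau> \<in> e ` contents M \<and>
        rule M x (l x) (T x) (i div 2) (inv_into (contents M) e (part m 0 \<tau>))
          (inv_into (contents M) e (part m 1 \<tau>)) (inv_into (contents M) e (part m 2 \<tau>)) (inv_into (contents M) e (part m 3 \<tau>)))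
      else of_bool (part m 1 \<tau> = part m 0 \<tau> \<and> part m 2 \<tau> = part m 0 \<tau> \<and> part m 3 \<tau> = part m 0 \<tau>))" for x i
    unfolding allowed_def by (rule if_distrib)
  ultimately show ?thesis
    by (simp only:)
qed

lemma dfn_cell_link:
  assumes F: "dfn 1 n F" and G: "dfn 1 n G"
  shows "dfn 1 n (\<lambda>xs e. of_bool (cell_link D (\<pi> (xs ! 0)) (A (xs ! 0)) k x k' x' (F xs e) (G xs e)))"
proof -
  have 1: "dfn 1 n (\<lambda>xs e. of_bool (\<exists>\<tau>. tile_at D k' x' = Some \<tau> \<and> (k \<noteq> 0 \<or> A (xs ! 0) (F xs e) \<tau>)))"
    by (cases "tile_at D k' x'") (auto intro!: dfn_const dfn_disj dfn_allowed[OF F] simp del: One_nat_def)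
  have 2: "dfn 1 n (\<lambda>xs e. of_bool (\<exists>\<tau>. tile_at D k x = Some \<tau> \<and>
      (\<exists>s<D. k' = 0 \<and> x' = 2 ^ D + 2 ^ s \<and> G xs e = (if bit \<tau> s then \<pi> (xs ! 0) s (F xs e) else F xs e))))"
  proof (cases "tile_at D k x")
    case None
    then show ?thesis
      by (simp add: dfn_const del: One_nat_def)
  next
    case (Some \<tau>)
    have "dfn 1 n (\<lambda>xs e. of_bool (\<exists>s<D. k' = 0 \<and> x' = 2 ^ D + 2 ^ s \<and> G xs e = (if bit \<tau> s then \<pi> (xs ! 0) s (F xs e) else F xs e)))"
      by (intro dfn_ex_const dfn_conj dfn_const[of _ _ "of_bool _"] dfn_eq dfn_if dfn_partner F G)
    then show ?thesis
      using Some by (simp del: One_nat_def)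
  qed
  show ?thesis
    unfolding cell_link_def by (intro dfn_const dfn_disj dfn_conj dfn_eq 1 2 F G)
qed

lemma dfn_arc_bit: "dfn 1 2 (\<lambda>xs e. of_bool (arc_bit (xs ! 0) (e 0) (e 1)))"
proof -
  let ?H = "2 ^ depth D :: nat" and ?E = "2 ^ D :: nat"
  have ka: "dfn 1 2 (\<lambda>xs e. e i div ?H mod ?E)" and xa: "dfn 1 2 (\<lambda>xs e. e i mod ?H)"
    and ia: "dfn 1 2 (\<lambda>xs e. e i div ?H div ?E)" and ca: "dfn 1 2 (\<lambda>xs e. e i div ?H)" if "i < 2" for i
    by (intro dfn_const dfn_mod dfn_div dfn_var that)+
  have i: "0 < (2 :: nat)" "1 < (2 :: nat)"
    by simp_all
  have H: "0 < ?H" "0 < ?E"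
    by simp_all
  let ?L = "\<lambda>k x k' x' xs e. cell_link D (\<pi> (xs ! 0)) (A (xs ! 0)) k x k' x' (e 0 div ?H div ?E) (e 1 div ?H div ?E)"
  \<comment> \<open>With four constant arguments the formula is arithmetic in \<open>i\<close> and
    \<open>i'\<close>. The constants are then replaced by the remainders of the vertex numbers, each
    by a finite table, starting from the last.\<close>
  have "dfn 1 2 (\<lambda>xs e. of_bool (?L k x k' x' xs e))" for k x k' x'
    by (rule dfn_cell_link[OF ia[OF i(1)] ia[OF i(2)]])
  then have "dfn 1 2 (\<lambda>xs e. of_bool (?L k x k' (e 1 mod ?H) xs e))" for k x k'
    by (intro dfn_bounded[where P = "?L k x k'", OF mod_less_divisor[OF H(1)] xa[OF i(2)]])
  then have "dfn 1 2 (\<lambda>xs e. of_bool (?L k x (e 1 div ?H mod ?E) (e 1 mod ?H) xs e))" for k x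
    by (intro dfn_bounded[where P = "\<lambda>c xs e. ?L k x c (e 1 mod ?H) xs e", OF mod_less_divisor[OF H(2)] ka[OF i(2)]])
  then have "dfn 1 2 (\<lambda>xs e. of_bool (?L k (e 0 mod ?H) (e 1 div ?H mod ?E) (e 1 mod ?H) xs e))" for k
    by (intro dfn_bounded[where P = "\<lambda>c xs e. ?L k c (e 1 div ?H mod ?E) (e 1 mod ?H) xs e",
          OF mod_less_divisor[OF H(1)] xa[OF i(1)]])
  then have link: "dfn 1 2 (\<lambda>xs e. of_bool (?L (e 0 div ?H mod ?E) (e 0 mod ?H) (e 1 div ?H mod ?E) (e 1 mod ?H) xs e))"
    by (intro dfn_bounded[where P = "\<lambda>c xs e. ?L c (e 0 mod ?H) (e 1 div ?H mod ?E) (e 1 mod ?H) xs e",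
          OF mod_less_divisor[OF H(2)] ka[OF i(1)]])
  have "dfn 1 2 (\<lambda>xs e. of_bool (tree (depth D) x (e 1 mod ?H)))" for x
    by (intro dfn_bounded[where P = "\<lambda>y xs e. tree (depth D) x y", OF mod_less_divisor[OF H(1)] xa[OF i(2)]] dfn_const)
  then have tree: "dfn 1 2 (\<lambda>xs e. of_bool (tree (depth D) (e 0 mod ?H) (e 1 mod ?H)))"
    by (intro dfn_bounded[where P = "\<lambda>x xs e. tree (depth D) x (e 1 mod ?H)", OF mod_less_divisor[OF H(1)] xa[OF i(1)]])
  have hub: "dfn 1 2 (\<lambda>xs e. of_bool (hub_offset (depth D) j (e 1 mod ?H)))" for j
    by (intro dfn_bounded[where P = "\<lambda>x xs e. hub_offset (depth D) j x", OF mod_less_divisor[OF H(1)] xa[OF i(2)]] dfn_const)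
  show ?thesis
    unfolding arc_bit_def num_arc_def
    by (intro dfn_const link tree hub dfn_disj dfn_conj dfn_not dfn_eq dfn_less dfn_add dfn_mult dfn_div dfn_mod
        dfn_var dfn_N dfn_Z i)
qed

lemma reduct_computable: "poly_time_computable reduct"
  unfolding reduct_def
proof (rule transducer)
  show "dfn 1 0 (\<lambda>xs e. vertices (xs ! 0) * vertices (xs ! 0))"
    by (intro dfn_mult dfn_vertices)
  have j: "dfn 1 1 (\<lambda>xs e. e 0 div vertices (xs ! 0))" "dfn 1 1 (\<lambda>xs e. e 0 mod vertices (xs ! 0))"
    by (intro dfn_div dfn_mod dfn_vertices dfn_var; simp)+
  show "dfn 1 1 (\<lambda>xs e. of_bool (
      arc_bit (xs ! 0) (e 0 div vertices (xs ! 0)) (e 0 mod vertices (xs ! 0)) \<or>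
      arc_bit (xs ! 0) (e 0 mod vertices (xs ! 0)) (e 0 div vertices (xs ! 0))))"
    by (intro dfn_disj dfn_comp2[where F = "\<lambda>xs a b. of_bool (arc_bit (xs ! 0) a b)", OF dfn_arc_bit] j)
qed

end

theorem NP_hard_BROADCAST_GRAPH: "NP_hard BROADCAST_GRAPH"
  unfolding NP_hard_def
proof
  fix L assume "L \<in> NP"
  then obtain M p where M: "poly_time_tm 2 M"
    and L: "\<And>x. x \<in> L \<longleftrightarrow> (\<exists>w. length w \<le> poly p (length x) \<and> tm_accepts M [x, w])"
    unfolding NP_def by blast
  obtain q where q: "\<And>xs. length xs = 2 \<Longrightarrow> halted M (tm_run M xs (poly q (sum_list (map length xs))))"
    using M unfolding poly_time_tm_def by blast
  obtain e where e: "bij_betw e (contents M) {..<card (contents M)}"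
    using ex_bij_betw_finite_nat[OF finite_contents] by (auto simp: atLeast0LessThan)
  \<comment> \<open>Enough bits to number all cell contents; the successor makes \<open>m\<close>
    positive.\<close>
  define m where "m = Suc (card (contents M))"
  have "card (contents M) \<le> 2 ^ m"
    using less_exp[of m] by (simp add: m_def)
  then have "e ` contents M \<subseteq> {..<2 ^ m}"
    using e by (auto simp: bij_betw_def)
  then interpret reduction M p q m e
    using M e by unfold_locales (auto simp: poly_time_tm_def bij_betw_def m_def)
  have "x \<in> L \<longleftrightarrow> reduct x \<in> BROADCAST_GRAPH" for x
  proof -
    \<comment> \<open>For all certificates of admissible length the machine has halted by time
      \<open>T x\<close>, because polynomials over the natural numbers are monotone. So acceptance
      can be read off at this one time, in the last row of the tableau.\<close>
    have "tm_accepts M [x, w] \<longleftrightarrow> fst (tm_run M [x, w] (T x)) = tm_acc M" if "length w \<le> l x" for w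
    proof (rule accepts_iff)
      have "poly q s \<le> poly q s'" if "s \<le> s'" for s s'
        using that by (induction q) (auto intro!: add_mono mult_mono)
      then have "poly q (length x + length w) \<le> T x"
        using that by (simp add: T_def)
      then show "halted M (tm_run M [x, w] (T x))"
        using q[of "[x, w]"] run_halted[of M "[x, w]" "poly q (length x + length w)" "T x"] by simp
    qed
    then show ?thesis
      unfolding L reduct_iff by (auto simp: l_def)
  qed
  then show "poly_reducible L BROADCAST_GRAPH"
    unfolding poly_reducible_def using reduct_computable by blast
qed

theorem theorem8:
  shows "NP_complete BROADCAST_GRAPH"
  unfolding NP_complete_def using BROADCAST_GRAPH_in_NP NP_hard_BROADCAST_GRAPH by blast

end
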